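(* Let $hLR$ be the category of hom-Lie-Rinehart algebras and $hGR$ the category of hom-Gerstenhaber algebras (over a fixed commutative ring $R$ with unity). Let $\mathcal{F}:hGR\rightarrow hLR$ be the functor sending a hom-Gerstenhaber algebra $(\mathcal{A}=\bigoplus_{i\ge 0}\mathcal{A}_i,\wedge,[-,-],\alpha)$ to the hom-Lie-Rinehart algebra $(\mathcal{A}_0,\mathcal{A}_1,[-,-]|_{\mathcal{A}_1\otimes\mathcal{A}_1},\alpha|_{\mathcal{A}_0},\alpha|_{\mathcal{A}_1},\rho)$, where $\mathcal{A}_0$ acts on $\mathcal{A}_1$ by $\wedge$ and $\rho(x)(a)=[x,a]$ for $x\in\mathcal{A}_1$, $a\in\mathcal{A}_0$, and sending a morphism to its restriction to degrees $0$ and $1$. Let $\mathcal{G}$ assign to a hom-Lie-Rinehart algebra $(A,L,[-,-],\phi,\alpha,\rho)$ the quadruple $(\wedge_A^*L,\wedge,[-,-]_G,\alpha_G)$, where $\wedge^*_AL$ is the exterior algebra of the $A$-module $L$ (with $\wedge^0_AL=A$), $$\alpha_G(aX_1\wedge\cdots\wedge X_n)=\phi(a)\,\alpha(X_1)\wedge\cdots\wedge\alpha(X_n),$$ and $[-,-]_G$ is the $R$-bilinear, graded skew-symmetric bracket of degree $-1$ (so $[a,b]_G=0$ for $a,b\in A$) given by $$[X_1\wedge\cdots\wedge X_n,a]_G=\sum_{i=1}^n(-1)^{n+i}\rho(X_i)(a)\wedge\alpha_G(X_1\wedge\cdots\wedge\hat{X_i}\wedge\cdots\wedge X_n)$$ and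 by $$[X_1\wedge\cdots\wedge X_n,Y_1\wedge\cdots\wedge Y_m]_G=\sum_{i=1}^n\sum_{j=1}^m(-1)^{i+j}[X_i,Y_j]\wedge\alpha_G(X_1\wedge\cdots\wedge\hat{X_i}\wedge\cdots\wedge X_n\wedge Y_1\wedge\cdots\wedge\hat{Y_j}\wedge\cdots\wedge Y_m)$$ for $X_i,Y_j\in L$, $a\in A$, $1\le i\le n$, $1\le j\le m$. On a morphism $(g,f)$, $\mathcal{G}(g,f)$ is its extension $aX_1\wedge\cdots\wedge X_n\mapsto g(a)f(X_1)\wedge\cdots\wedge f(X_n)$. Then $\mathcal{G}$ is a functor from $hLR$ to $hGR$. Moreover, $\mathcal{G}$ is left adjoint to $\mathcal{F}$.
   Context: $R$ is a commutative ring with unity; all modules, algebras, tensor products and linear maps are over $R$ unless stated otherwise. A hat denotes omission. A hom-Lie algebra $(\mathfrak{g},[-,-],\alpha)$ is an $R$-module with a skew-symmetric $R$-bilinear bracket and a linear map $\alpha$ with $\alpha[x,y]=[\alpha(x),\alpha(y)]$ and $[\alpha(x),[y,z]]+[\alpha(y),[z,x]]+[\alpha(z),[x,y]]=0$. A representation of it on an $R$-module $V$ is a pair $(\theta,\beta)$ of linear maps $\theta:\mathfrak{g}\to\mathrm{End}_R(V)$, $\beta:V\to V$ with $\theta(\alpha(x))\circ\beta=\beta\circ\theta(x)$ and $\theta([x,y])\circ\beta=\theta(\alpha(x))\circ\theta(y)-\theta(\alpha(y))\circ\theta(x)$. For an associative commutative $R$-algebra $A$ and an algebra endomorphism $\phi$,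 $Der_\phi(A)$ is the $A$-module of $R$-linear maps $\delta:A\to A$ with $\delta(ab)=\phi(a)\delta(b)+\phi(b)\delta(a)$. A hom-Lie-Rinehart algebra is a tuple $(A,L,[-,-],\phi,\alpha,\rho)$ with $A$ an associative commutative $R$-algebra, $L$ an $A$-module, the action of $A$ being assumed faithful throughout, $[-,-]:L\times L\to L$ skew-symmetric $R$-bilinear, $\phi:A\to A$ an algebra homomorphism, $\alpha:L\to L$ linear with $\alpha[x,y]=[\alpha(x),\alpha(y)]$, and $\rho:L\to Der_\phi(A)$ $R$-linear, such that for all $a\in A$, $x,y\in L$: (1) $(L,[-,-],\alpha)$ is a hom-Lie algebra; (2) $\alpha(a.x)=\phi(a).\alpha(x)$; (3) $(\rho,\phi)$ is a representation of $(L,[-,-],\alpha)$ on $A$; (4) $\rho(a.x)=\phi(a).\rho(x)$; (5) $[x,a.y]=\phi(a)[x,y]+\rho(x)(a)\alpha(y)$. A homomorphism $(A,L,[-,-]_L,\phi,\alpha_L,\rho_L)\to(B,L',[-,-]_{L'},\psi,\alpha_{L'},\rho_{L'})$ is a pair $(g,f)$, $g:A\to B$ an $R$-algebra homomorphism and $f:L\to L'$ $R$-linear, with $f(a.x)=g(a).f(x)$, $f[x,y]_L=[f(x),f(y)]_{L'}$, $f\circ\alpha_L=\alpha_{L'}\circ f$, $g\circ\phi=\psi\circ g$, and $g(\rho_L(x)(a))=\rho_{L'}(f(x))(g(a))$. A hom-Gerstenhaber algebra is a quadruple $(\mathcal{A}=\bigoplus_{i\ge0}\mathcal{A}_i,\wedge,[-,-],\alpha)$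 where $(\mathcal{A},\wedge)$ is a graded commutative associative $R$-algebra, $\alpha$ is a degree $0$ endomorphism of $(\mathcal{A},\wedge)$, and $[-,-]$ is an $R$-bilinear bracket of degree $-1$ such that, for $X\in\mathcal{A}_i$, $Y\in\mathcal{A}_j$, $Z\in\mathcal{A}_k$: (i) the bracket is graded skew-symmetric, $[X,Y]=-(-1)^{(i-1)(j-1)}[Y,X]$, and $\alpha[X,Y]=[\alpha(X),\alpha(Y)]$; (ii) $(-1)^{(i-1)(k-1)}[\alpha(X),[Y,Z]]+(-1)^{(j-1)(i-1)}[\alpha(Y),[Z,X]]+(-1)^{(k-1)(j-1)}[\alpha(Z),[X,Y]]=0$; (iii) $[X,Y\wedge Z]=[X,Y]\wedge\alpha(Z)+(-1)^{(i-1)j}\alpha(Y)\wedge[X,Z]$. A homomorphism of hom-Gerstenhaber algebras is an $R$-linear map of degree $0$ preserving $\wedge$ and the brackets and commuting with the maps $\alpha$.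
   Formalization: Graded commutativity includes x∧x=0 in odd degree (else adjointness fails if 2 is not invertible). As F need not give faithful actions, adjointness is stated for faithful hLR with the part of hGR that F sends to it, and for all of hGR with hLR without faithfulness. *)

theory Defs
  imports "HOL-Algebra.Module" "HOL-Algebra.QuotRing"
begin

section \<open>Categories, functors, adjunctions\<close>

text \<open>
  A category is given by its hom-sets; these need not be disjoint, so composition and
  the arrow part of a functor take the relevant objects as arguments:
  \<open>cmp C X Y Z g f\<close> is the composite of \<open>f : X \<rightarrow> Y\<close> and \<open>g : Y \<rightarrow> Z\<close>.
\<close>

record ('o, 'm) category =
  Obj :: "'o set"
  Hom :: "'o \<Rightarrow> 'o \<Rightarrow> 'm set"
  idt :: "'o \<Rightarrow> 'm"
  cmp :: "'o \<Rightarrow> 'o \<Rightarrow> 'o \<Rightarrow> 'm \<Rightarrow> 'm \<Rightarrow> 'm"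

definition is_category :: "('o, 'm) category \<Rightarrow> bool" where
  "is_category C \<longleftrightarrow>
     (\<forall>X \<in> Obj C. idt C X \<in> Hom C X X) \<and>
     (\<forall>X \<in> Obj C. \<forall>Y \<in> Obj C. \<forall>Z \<in> Obj C. \<forall>f \<in> Hom C X Y. \<forall>g \<in> Hom C Y Z.
        cmp C X Y Z g f \<in> Hom C X Z) \<and>
     (\<forall>X \<in> Obj C. \<forall>Y \<in> Obj C. \<forall>f \<in> Hom C X Y.
        cmp C X X Y f (idt C X) = f \<and> cmp C X Y Y (idt C Y) f = f) \<and>
     (\<forall>W \<in> Obj C. \<forall>X \<in> Obj C. \<forall>Y \<in> Obj C. \<forall>Z \<in> Obj C.
        \<forall>f \<in> Hom C W X. \<forall>g \<in> Hom C X Y. \<forall>h \<in> Hom C Y Z.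
        cmp C W Y Z h (cmp C W X Y g f) = cmp C W X Z (cmp C X Y Z h g) f)"

definition full_subcategory :: "('o, 'm) category \<Rightarrow> 'o set \<Rightarrow> ('o, 'm) category" where
  "full_subcategory C S = C \<lparr> Obj := Obj C \<inter> S \<rparr>"

record ('o, 'm, 'p, 'n) functor_data =
  fobj :: "'o \<Rightarrow> 'p"
  fmor :: "'o \<Rightarrow> 'o \<Rightarrow> 'm \<Rightarrow> 'n"

definition is_functor ::
  "('o, 'm) category \<Rightarrow> ('p, 'n) category \<Rightarrow> ('o, 'm, 'p, 'n) functor_data \<Rightarrow> bool" where
  "is_functor C D F \<longleftrightarrow>
     is_category C \<and> is_category D \<and>
     (\<forall>X \<in> Obj C. fobj F X \<in> Obj D) \<and>
     (\<forall>X \<in> Obj C. \<forall>Y \<in> Obj C. \<forall>f \<in> Hom C X Y. fmor F X Y f \<in> Hom D (fobj F X) (fobj F Y)) \<and>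
     (\<forall>X \<in> Obj C. fmor F X X (idt C X) = idt D (fobj F X)) \<and>
     (\<forall>X \<in> Obj C. \<forall>Y \<in> Obj C. \<forall>Z \<in> Obj C. \<forall>f \<in> Hom C X Y. \<forall>g \<in> Hom C Y Z.
        fmor F X Z (cmp C X Y Z g f) =
        cmp D (fobj F X) (fobj F Y) (fobj F Z) (fmor F Y Z g) (fmor F X Y f))"

definition left_adjoint ::
  "('o, 'm) category \<Rightarrow> ('p, 'n) category \<Rightarrow>
   ('o, 'm, 'p, 'n) functor_data \<Rightarrow> ('p, 'n, 'o, 'm) functor_data \<Rightarrow> bool" where
  "left_adjoint C D G F \<longleftrightarrow>
     is_functor C D G \<and> is_functor D C F \<and>
     (\<exists>\<Phi>.
        (\<forall>X \<in> Obj C. \<forall>Y \<in> Obj D.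
           bij_betw (\<Phi> X Y) (Hom D (fobj G X) Y) (Hom C X (fobj F Y))) \<and>
        (\<forall>X \<in> Obj C. \<forall>X' \<in> Obj C. \<forall>Y \<in> Obj D. \<forall>Y' \<in> Obj D.
           \<forall>f \<in> Hom C X' X. \<forall>k \<in> Hom D Y Y'. \<forall>h \<in> Hom D (fobj G X) Y.
           \<Phi> X' Y' (cmp D (fobj G X') (fobj G X) Y'
                      (cmp D (fobj G X) Y Y' k h) (fmor G X' X f)) =
           cmp C X' X (fobj F Y')
             (cmp C X (fobj F Y) (fobj F Y') (fmor F Y Y' k) (\<Phi> X Y h)) f))"


section \<open>Linear and algebra maps\<close>

definition linear_map ::
  "('r, 'x) ring_scheme \<Rightarrow> ('r, 'm, 'y) module_scheme \<Rightarrow> ('r, 'n, 'z) module_scheme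
   \<Rightarrow> ('m \<Rightarrow> 'n) \<Rightarrow> bool" where
  "linear_map R M N f \<longleftrightarrow>
     f \<in> carrier M \<rightarrow> carrier N \<and>
     (\<forall>x \<in> carrier M. \<forall>y \<in> carrier M. f (x \<oplus>\<^bsub>M\<^esub> y) = f x \<oplus>\<^bsub>N\<^esub> f y) \<and>
     (\<forall>r \<in> carrier R. \<forall>x \<in> carrier M. f (r \<odot>\<^bsub>M\<^esub> x) = r \<odot>\<^bsub>N\<^esub> f x)"

definition bilinear_map ::
  "('r, 'x) ring_scheme \<Rightarrow> ('r, 'm, 'y) module_scheme \<Rightarrow> ('r, 'n, 'z) module_scheme
   \<Rightarrow> ('r, 'p, 'w) module_scheme \<Rightarrow> ('m \<Rightarrow> 'n \<Rightarrow> 'p) \<Rightarrow> bool" where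
  "bilinear_map R M N P b \<longleftrightarrow>
     (\<forall>x \<in> carrier M. linear_map R N P (b x)) \<and>
     (\<forall>y \<in> carrier N. linear_map R M P (\<lambda>x. b x y))"

definition algebra_hom ::
  "('r, 'x) ring_scheme \<Rightarrow> ('r, 'm, 'y) module_scheme \<Rightarrow> ('r, 'n, 'z) module_scheme
   \<Rightarrow> ('m \<Rightarrow> 'n) \<Rightarrow> bool" where
  "algebra_hom R A B g \<longleftrightarrow> linear_map R A B g \<and> g \<in> ring_hom A B"

text \<open>The \<open>R\<close>-module underlying a module \<open>L\<close> over an \<open>R\<close>-algebra \<open>A\<close>.\<close>

definition restrict_scalars ::
  "('r, 'a, 'x) module_scheme \<Rightarrow> ('a, 'l, 'y) module_scheme \<Rightarrow> ('r, 'l) module" where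
  "restrict_scalars A L =
     \<lparr> carrier = carrier L, mult = mult L, one = one L, zero = zero L, add = add L,
       smult = (\<lambda>r x. (r \<odot>\<^bsub>A\<^esub> \<one>\<^bsub>A\<^esub>) \<odot>\<^bsub>L\<^esub> x) \<rparr>"


section \<open>Hom-Lie-Rinehart algebras\<close>

locale hom_lie_algebra = module R M
  for R :: "('r, 'x) ring_scheme" and M :: "('r, 'l, 'y) module_scheme"
    and br :: "'l \<Rightarrow> 'l \<Rightarrow> 'l" and \<alpha> :: "'l \<Rightarrow> 'l" +
  assumes br_bilinear: "bilinear_map R M M M br"
    and br_skew: "\<And>x y. x \<in> carrier M \<Longrightarrow> y \<in> carrier M \<Longrightarrow> br x y = \<ominus>\<^bsub>M\<^esub> br y x"
    and alpha_linear: "linear_map R M M \<alpha>"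
    and alpha_br: "\<And>x y. x \<in> carrier M \<Longrightarrow> y \<in> carrier M \<Longrightarrow> \<alpha> (br x y) = br (\<alpha> x) (\<alpha> y)"
    and hom_jacobi: "\<And>x y z. x \<in> carrier M \<Longrightarrow> y \<in> carrier M \<Longrightarrow> z \<in> carrier M \<Longrightarrow>
      br (\<alpha> x) (br y z) \<oplus>\<^bsub>M\<^esub> br (\<alpha> y) (br z x) \<oplus>\<^bsub>M\<^esub> br (\<alpha> z) (br x y) = \<zero>\<^bsub>M\<^esub>"

text \<open>\<open>(\<theta>, \<beta>)\<close> is a representation of the hom-Lie algebra \<open>(M, br, \<alpha>)\<close> on \<open>V\<close>;
  linearity of \<open>\<theta> : M \<rightarrow> End V\<close> is expressed pointwise.\<close>

locale hom_lie_representation = hom_lie_algebra R M br \<alpha> + V?: module R V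
  for R :: "('r, 'x) ring_scheme" and M :: "('r, 'l, 'y) module_scheme"
    and br :: "'l \<Rightarrow> 'l \<Rightarrow> 'l" and \<alpha> :: "'l \<Rightarrow> 'l"
    and V :: "('r, 'v, 'z) module_scheme"
    and \<theta> :: "'l \<Rightarrow> 'v \<Rightarrow> 'v" and \<beta> :: "'v \<Rightarrow> 'v" +
  assumes theta_bilinear: "bilinear_map R M V V \<theta>"
    and beta_linear: "linear_map R V V \<beta>"
    and theta_beta: "\<And>x v. x \<in> carrier M \<Longrightarrow> v \<in> carrier V \<Longrightarrow> \<theta> (\<alpha> x) (\<beta> v) = \<beta> (\<theta> x v)"
    and theta_br: "\<And>x y v. x \<in> carrier M \<Longrightarrow> y \<in> carrier M \<Longrightarrow> v \<in> carrier V \<Longrightarrow>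
      \<theta> (br x y) (\<beta> v) = \<theta> (\<alpha> x) (\<theta> y v) \<ominus>\<^bsub>V\<^esub> \<theta> (\<alpha> y) (\<theta> x v)"

definition twisted_derivations ::
  "('r, 'x) ring_scheme \<Rightarrow> ('r, 'a, 'y) module_scheme \<Rightarrow> ('a \<Rightarrow> 'a) \<Rightarrow> ('a \<Rightarrow> 'a) set" where
  "twisted_derivations R A \<phi> =
     {\<delta>. linear_map R A A \<delta> \<and>
         (\<forall>a \<in> carrier A. \<forall>b \<in> carrier A.
            \<delta> (a \<otimes>\<^bsub>A\<^esub> b) = \<phi> a \<otimes>\<^bsub>A\<^esub> \<delta> b \<oplus>\<^bsub>A\<^esub> \<phi> b \<otimes>\<^bsub>A\<^esub> \<delta> a)}"

record ('r, 'a, 'l) hom_lie_rinehart_data =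
  base :: "('r, 'a) module"
  space :: "('a, 'l) module"
  lie :: "'l \<Rightarrow> 'l \<Rightarrow> 'l"
  phi :: "'a \<Rightarrow> 'a"
  alpha :: "'l \<Rightarrow> 'l"
  anchor :: "'l \<Rightarrow> 'a \<Rightarrow> 'a"

text \<open>Faithfulness of the action is not included; it is imposed in \<open>hLR\<close>.\<close>

definition hom_lie_rinehart ::
  "'r ring \<Rightarrow> ('r, 'a, 'l) hom_lie_rinehart_data \<Rightarrow> bool" where
  "hom_lie_rinehart R X \<longleftrightarrow>
     (let A = base X; L = space X; LR = restrict_scalars A L; br = lie X;
          \<phi> = phi X; \<alpha> = alpha X; \<rho> = anchor X
      in algebra R A \<and> module A L \<and>
         algebra_hom R A A \<phi> \<and>
         (\<forall>x \<in> carrier L. \<rho> x \<in> twisted_derivations R A \<phi>) \<and>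
         (\<forall>a \<in> carrier A. linear_map R LR A (\<lambda>x. \<rho> x a)) \<and>
         hom_lie_algebra R LR br \<alpha> \<and>
         (\<forall>a \<in> carrier A. \<forall>x \<in> carrier L. \<alpha> (a \<odot>\<^bsub>L\<^esub> x) = \<phi> a \<odot>\<^bsub>L\<^esub> \<alpha> x) \<and>
         hom_lie_representation R LR br \<alpha> A \<rho> \<phi> \<and>
         (\<forall>a \<in> carrier A. \<forall>x \<in> carrier L. \<forall>b \<in> carrier A.
            \<rho> (a \<odot>\<^bsub>L\<^esub> x) b = \<phi> a \<otimes>\<^bsub>A\<^esub> \<rho> x b) \<and>
         (\<forall>a \<in> carrier A. \<forall>x \<in> carrier L. \<forall>y \<in> carrier L.
            br x (a \<odot>\<^bsub>L\<^esub> y) = \<phi> a \<odot>\<^bsub>L\<^esub> br x y \<oplus>\<^bsub>L\<^esub> \<rho> x a \<odot>\<^bsub>L\<^esub> \<alpha> y))"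

definition faithful_action :: "('a, 'x) ring_scheme \<Rightarrow> ('a, 'l, 'y) module_scheme \<Rightarrow> bool" where
  "faithful_action A L \<longleftrightarrow>
     (\<forall>a \<in> carrier A. \<forall>b \<in> carrier A.
        (\<forall>x \<in> carrier L. a \<odot>\<^bsub>L\<^esub> x = b \<odot>\<^bsub>L\<^esub> x) \<longrightarrow> a = b)"

definition hom_lie_rinehart_homs ::
  "'r ring \<Rightarrow> ('r, 'a, 'l) hom_lie_rinehart_data \<Rightarrow> ('r, 'b, 'k) hom_lie_rinehart_data
   \<Rightarrow> (('a \<Rightarrow> 'b) \<times> ('l \<Rightarrow> 'k)) set" where
  "hom_lie_rinehart_homs R X Y =
     {(g, f).
        g \<in> extensional (carrier (base X)) \<and> f \<in> extensional (carrier (space X)) \<and>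
        algebra_hom R (base X) (base Y) g \<and>
        linear_map R (restrict_scalars (base X) (space X))
                     (restrict_scalars (base Y) (space Y)) f \<and>
        (\<forall>a \<in> carrier (base X). \<forall>x \<in> carrier (space X).
           f (a \<odot>\<^bsub>space X\<^esub> x) = g a \<odot>\<^bsub>space Y\<^esub> f x) \<and>
        (\<forall>x \<in> carrier (space X). \<forall>y \<in> carrier (space X). f (lie X x y) = lie Y (f x) (f y)) \<and>
        (\<forall>x \<in> carrier (space X). f (alpha X x) = alpha Y (f x)) \<and>
        (\<forall>a \<in> carrier (base X). g (phi X a) = phi Y (g a)) \<and>
        (\<forall>x \<in> carrier (space X). \<forall>a \<in> carrier (base X).
           g (anchor X x a) = anchor Y (f x) (g a))}"


section \<open>Hom-Gerstenhaber algebras\<close>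

record ('r, 'g) hom_gerstenhaber_data = "('r, 'g) module" +
  part :: "nat \<Rightarrow> 'g set"
  bracket :: "'g \<Rightarrow> 'g \<Rightarrow> 'g"
  twist :: "'g \<Rightarrow> 'g"

definition signed :: "('g, 'x) ring_scheme \<Rightarrow> int \<Rightarrow> 'g \<Rightarrow> 'g" where
  "signed M k x = (if even k then x else \<ominus>\<^bsub>M\<^esub> x)"

text \<open>Unital associative \<open>R\<close>-algebras with an internal grading by \<open>R\<close>-submodules.\<close>

definition graded_algebra :: "'r ring \<Rightarrow> ('r, 'g, 'x) module_scheme \<Rightarrow> (nat \<Rightarrow> 'g set) \<Rightarrow> bool" where
  "graded_algebra R E d \<longleftrightarrow>
     module R E \<and> ring E \<and>
     (\<forall>r \<in> carrier R. \<forall>x \<in> carrier E. \<forall>y \<in> carrier E.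
        (r \<odot>\<^bsub>E\<^esub> x) \<otimes>\<^bsub>E\<^esub> y = r \<odot>\<^bsub>E\<^esub> (x \<otimes>\<^bsub>E\<^esub> y) \<and>
        x \<otimes>\<^bsub>E\<^esub> (r \<odot>\<^bsub>E\<^esub> y) = r \<odot>\<^bsub>E\<^esub> (x \<otimes>\<^bsub>E\<^esub> y)) \<and>
     (\<forall>i. submodule (d i) R E) \<and>
     (\<forall>x \<in> carrier E. \<exists>!c. (\<forall>i. c i \<in> d i) \<and> finite {i. c i \<noteq> \<zero>\<^bsub>E\<^esub>} \<and>
        x = (\<Oplus>\<^bsub>E\<^esub> i \<in> {i. c i \<noteq> \<zero>\<^bsub>E\<^esub>}. c i)) \<and>
     \<one>\<^bsub>E\<^esub> \<in> d 0 \<and>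
     (\<forall>i j. \<forall>x \<in> d i. \<forall>y \<in> d j. x \<otimes>\<^bsub>E\<^esub> y \<in> d (i + j))"

text \<open>Over a ring in which \<open>2\<close> need not be invertible, graded commutativity includes
  \<open>x \<and> x = 0\<close> for \<open>x\<close> homogeneous of odd degree, as holds in exterior algebras.\<close>

definition graded_commutative :: "('g, 'x) ring_scheme \<Rightarrow> (nat \<Rightarrow> 'g set) \<Rightarrow> bool" where
  "graded_commutative E d \<longleftrightarrow>
     (\<forall>i j. \<forall>x \<in> d i. \<forall>y \<in> d j. x \<otimes>\<^bsub>E\<^esub> y = signed E (int i * int j) (y \<otimes>\<^bsub>E\<^esub> x)) \<and>
     (\<forall>i. odd i \<longrightarrow> (\<forall>x \<in> d i. x \<otimes>\<^bsub>E\<^esub> x = \<zero>\<^bsub>E\<^esub>))"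

text \<open>Degree \<open>-1\<close>, with the convention that the part of degree \<open>-1\<close> is zero.\<close>

definition degree_minus_one ::
  "('g, 'x) ring_scheme \<Rightarrow> (nat \<Rightarrow> 'g set) \<Rightarrow> ('g \<Rightarrow> 'g \<Rightarrow> 'g) \<Rightarrow> bool" where
  "degree_minus_one E d b \<longleftrightarrow>
     (\<forall>i j. \<forall>x \<in> d i. \<forall>y \<in> d j.
        if i + j = 0 then b x y = \<zero>\<^bsub>E\<^esub> else b x y \<in> d (i + j - 1))"

definition graded_skew ::
  "('g, 'x) ring_scheme \<Rightarrow> (nat \<Rightarrow> 'g set) \<Rightarrow> ('g \<Rightarrow> 'g \<Rightarrow> 'g) \<Rightarrow> bool" where
  "graded_skew E d b \<longleftrightarrow>
     (\<forall>i j. \<forall>x \<in> d i. \<forall>y \<in> d j.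
        b x y = \<ominus>\<^bsub>E\<^esub> (signed E ((int i - 1) * (int j - 1)) (b y x)))"

definition hom_gerstenhaber :: "'r ring \<Rightarrow> ('r, 'g) hom_gerstenhaber_data \<Rightarrow> bool" where
  "hom_gerstenhaber R E \<longleftrightarrow>
     (let d = part E; b = bracket E; \<alpha> = twist E
      in graded_algebra R E d \<and> graded_commutative E d \<and>
         algebra_hom R E E \<alpha> \<and> (\<forall>i. \<alpha> ` d i \<subseteq> d i) \<and>
         bilinear_map R E E E b \<and> degree_minus_one E d b \<and> graded_skew E d b \<and>
         (\<forall>x \<in> carrier E. \<forall>y \<in> carrier E. \<alpha> (b x y) = b (\<alpha> x) (\<alpha> y)) \<and>
         (\<forall>i j k. \<forall>x \<in> d i. \<forall>y \<in> d j. \<forall>z \<in> d k.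
            signed E ((int i - 1) * (int k - 1)) (b (\<alpha> x) (b y z)) \<oplus>\<^bsub>E\<^esub>
            signed E ((int j - 1) * (int i - 1)) (b (\<alpha> y) (b z x)) \<oplus>\<^bsub>E\<^esub>
            signed E ((int k - 1) * (int j - 1)) (b (\<alpha> z) (b x y)) = \<zero>\<^bsub>E\<^esub>) \<and>
         (\<forall>i j k. \<forall>x \<in> d i. \<forall>y \<in> d j. \<forall>z \<in> d k.
            b x (y \<otimes>\<^bsub>E\<^esub> z) =
            b x y \<otimes>\<^bsub>E\<^esub> \<alpha> z \<oplus>\<^bsub>E\<^esub>
            signed E ((int i - 1) * int j) (\<alpha> y \<otimes>\<^bsub>E\<^esub> b x z)))"

definition hom_gerstenhaber_homs ::
  "'r ring \<Rightarrow> ('r, 'g) hom_gerstenhaber_data \<Rightarrow> ('r, 'h) hom_gerstenhaber_data \<Rightarrow> ('g \<Rightarrow> 'h) set" where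
  "hom_gerstenhaber_homs R E E' =
     {h. h \<in> extensional (carrier E) \<and> algebra_hom R E E' h \<and>
         (\<forall>i. h ` part E i \<subseteq> part E' i) \<and>
         (\<forall>x \<in> carrier E. \<forall>y \<in> carrier E. h (bracket E x y) = bracket E' (h x) (h y)) \<and>
         (\<forall>x \<in> carrier E. h (twist E x) = twist E' (h x))}"


section \<open>The exterior algebra of a module\<close>

text \<open>
  The free associative \<open>A\<close>-algebra on the set \<open>L\<close>: finitely supported \<open>A\<close>-valued functions on
  words in \<open>L\<close>, with convolution along concatenation. The exterior algebra is its quotient by
  the ideal that makes the generators \<open>A\<close>-linear (giving the tensor algebra) and their squares
  zero.
\<close>

definition word_monomial :: "('a, 'x) ring_scheme \<Rightarrow> 'a \<Rightarrow> 'l list \<Rightarrow> ('l list \<Rightarrow> 'a)" where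
  "word_monomial A a xs = (\<lambda>w. if w = xs then a else \<zero>\<^bsub>A\<^esub>)"

definition free_algebra ::
  "('a, 'x) ring_scheme \<Rightarrow> ('a, 'l, 'y) module_scheme \<Rightarrow> ('l list \<Rightarrow> 'a) ring" where
  "free_algebra A L =
     \<lparr> carrier = {p. (\<forall>w. p w \<in> carrier A) \<and> finite {w. p w \<noteq> \<zero>\<^bsub>A\<^esub>} \<and>
                     (\<forall>w. p w \<noteq> \<zero>\<^bsub>A\<^esub> \<longrightarrow> set w \<subseteq> carrier L)},
       mult = (\<lambda>p q w. \<Oplus>\<^bsub>A\<^esub> i \<in> {0..length w}. p (take i w) \<otimes>\<^bsub>A\<^esub> q (drop i w)),
       one = word_monomial A \<one>\<^bsub>A\<^esub> [],
       zero = (\<lambda>w. \<zero>\<^bsub>A\<^esub>),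
       add = (\<lambda>p q w. p w \<oplus>\<^bsub>A\<^esub> q w) \<rparr>"

definition exterior_ideal ::
  "('a, 'x) ring_scheme \<Rightarrow> ('a, 'l, 'y) module_scheme \<Rightarrow> ('l list \<Rightarrow> 'a) set" where
  "exterior_ideal A L =
     (let T = free_algebra A L; m = word_monomial A
      in genideal T
           ({m \<one>\<^bsub>A\<^esub> [x \<oplus>\<^bsub>L\<^esub> y] \<ominus>\<^bsub>T\<^esub> (m \<one>\<^bsub>A\<^esub> [x] \<oplus>\<^bsub>T\<^esub> m \<one>\<^bsub>A\<^esub> [y])
               | x y. x \<in> carrier L \<and> y \<in> carrier L} \<union>
            {m \<one>\<^bsub>A\<^esub> [a \<odot>\<^bsub>L\<^esub> x] \<ominus>\<^bsub>T\<^esub> m a [x]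
               | a x. a \<in> carrier A \<and> x \<in> carrier L} \<union>
            {m \<one>\<^bsub>A\<^esub> [x, x] | x. x \<in> carrier L}))"

text \<open>\<open>wedge A L a [X\<^sub>1, \<dots>, X\<^sub>n]\<close> is \<open>a X\<^sub>1 \<and> \<dots> \<and> X\<^sub>n\<close>; in particular
  \<open>wedge A L a []\<close> is \<open>a\<close> in degree \<open>0\<close>.\<close>

definition wedge ::
  "('a, 'x) ring_scheme \<Rightarrow> ('a, 'l, 'y) module_scheme \<Rightarrow> 'a \<Rightarrow> 'l list \<Rightarrow> ('l list \<Rightarrow> 'a) set" where
  "wedge A L a xs = exterior_ideal A L +>\<^bsub>free_algebra A L\<^esub> word_monomial A a xs"

definition exterior ::
  "('r, 'a, 'x) module_scheme \<Rightarrow> ('a, 'l, 'y) module_scheme \<Rightarrow> ('r, ('l list \<Rightarrow> 'a) set) module" where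
  "exterior A L =
     (let Q = free_algebra A L Quot exterior_ideal A L
      in \<lparr> carrier = carrier Q, mult = mult Q, one = one Q, zero = zero Q, add = add Q,
           smult = (\<lambda>r u. wedge A L (r \<odot>\<^bsub>A\<^esub> \<one>\<^bsub>A\<^esub>) [] \<otimes>\<^bsub>Q\<^esub> u) \<rparr>)"

definition exterior_part ::
  "('a, 'x) ring_scheme \<Rightarrow> ('a, 'l, 'y) module_scheme \<Rightarrow> nat \<Rightarrow> ('l list \<Rightarrow> 'a) set set" where
  "exterior_part A L n =
     {exterior_ideal A L +>\<^bsub>free_algebra A L\<^esub> p
        | p. p \<in> carrier (free_algebra A L) \<and> (\<forall>w. p w \<noteq> \<zero>\<^bsub>A\<^esub> \<longrightarrow> length w = n)}"

text \<open>The map \<open>a X\<^sub>1 \<and> \<dots> \<and> X\<^sub>n \<mapsto> g(a) f(X\<^sub>1) \<and> \<dots> \<and> f(X\<^sub>n)\<close>.\<close>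

definition exterior_map ::
  "'r ring \<Rightarrow> ('r, 'a) module \<Rightarrow> ('a, 'l) module \<Rightarrow> ('r, 'b) module \<Rightarrow> ('b, 'k) module
   \<Rightarrow> ('a \<Rightarrow> 'b) \<Rightarrow> ('l \<Rightarrow> 'k) \<Rightarrow> ('l list \<Rightarrow> 'a) set \<Rightarrow> ('k list \<Rightarrow> 'b) set" where
  "exterior_map R A L B K g f =
     (THE h. h \<in> extensional (carrier (exterior A L)) \<and>
             linear_map R (exterior A L) (exterior B K) h \<and>
             (\<forall>a \<in> carrier A. \<forall>xs. set xs \<subseteq> carrier L \<longrightarrow>
                h (wedge A L a xs) = wedge B K (g a) (map f xs)))"


section \<open>The functor \<open>\<G>\<close>\<close>

definition exterior_twist ::
  "'r ring \<Rightarrow> ('r, 'a, 'l) hom_lie_rinehart_data \<Rightarrow> ('l list \<Rightarrow> 'a) set \<Rightarrow> ('l list \<Rightarrow> 'a) set" where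
  "exterior_twist R X =
     exterior_map R (base X) (space X) (base X) (space X) (phi X) (alpha X)"

text \<open>The list \<open>xs\<close> without its \<open>i\<close>-th entry, counting from \<open>1\<close>.\<close>

definition omit :: "nat \<Rightarrow> 'l list \<Rightarrow> 'l list" where
  "omit i xs = take (i - 1) xs @ drop i xs"

definition is_exterior_bracket ::
  "'r ring \<Rightarrow> ('r, 'a, 'l) hom_lie_rinehart_data
   \<Rightarrow> (('l list \<Rightarrow> 'a) set \<Rightarrow> ('l list \<Rightarrow> 'a) set \<Rightarrow> ('l list \<Rightarrow> 'a) set) \<Rightarrow> bool" where
  "is_exterior_bracket R X b \<longleftrightarrow>
     (let A = base X; L = space X; E = exterior A L; d = exterior_part A L;
          w = wedge A L; \<alpha>\<^sub>G = exterior_twist R X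
      in (\<forall>u v. u \<notin> carrier E \<or> v \<notin> carrier E \<longrightarrow> b u v = undefined) \<and>
         bilinear_map R E E E b \<and> degree_minus_one E d b \<and> graded_skew E d b \<and>
         (\<forall>xs. \<forall>a \<in> carrier A. xs \<noteq> [] \<and> set xs \<subseteq> carrier L \<longrightarrow>
            b (w \<one>\<^bsub>A\<^esub> xs) (w a []) =
            (\<Oplus>\<^bsub>E\<^esub> i \<in> {1..length xs}.
               signed E (int (length xs + i))
                 (w (anchor X (xs ! (i - 1)) a) [] \<otimes>\<^bsub>E\<^esub> \<alpha>\<^sub>G (w \<one>\<^bsub>A\<^esub> (omit i xs))))) \<and>
         (\<forall>xs ys. xs \<noteq> [] \<and> ys \<noteq> [] \<and> set xs \<subseteq> carrier L \<and> set ys \<subseteq> carrier L \<longrightarrow>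
            b (w \<one>\<^bsub>A\<^esub> xs) (w \<one>\<^bsub>A\<^esub> ys) =
            (\<Oplus>\<^bsub>E\<^esub> i \<in> {1..length xs}. \<Oplus>\<^bsub>E\<^esub> j \<in> {1..length ys}.
               signed E (int (i + j))
                 (w \<one>\<^bsub>A\<^esub> [lie X (xs ! (i - 1)) (ys ! (j - 1))] \<otimes>\<^bsub>E\<^esub>
                  \<alpha>\<^sub>G (w \<one>\<^bsub>A\<^esub> (omit i xs @ omit j ys))))))"

definition exterior_gerstenhaber ::
  "'r ring \<Rightarrow> ('r, 'a, 'l) hom_lie_rinehart_data
   \<Rightarrow> ('r, ('l list \<Rightarrow> 'a) set) hom_gerstenhaber_data" where
  "exterior_gerstenhaber R X =
     (let E = exterior (base X) (space X)
      in \<lparr> carrier = carrier E, mult = mult E, one = one E, zero = zero E, add = add E,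
           smult = smult E,
           part = exterior_part (base X) (space X),
           bracket = (THE b. is_exterior_bracket R X b),
           twist = exterior_twist R X \<rparr>)"

text \<open>
  To have \<open>\<G>\<close> and \<open>\<F>\<close> between the same two categories, all underlying sets are subsets of one
  type \<open>'u\<close>, the universe. The exterior algebra is built on a different type, so its elements
  are renamed along a chosen injection into \<open>'u\<close>. If \<open>'u\<close> is infinite, one exists: when the
  carriers of \<open>A\<close> and \<open>L\<close> lie in \<open>'u\<close>, the exterior algebra has no more elements than there
  are finite lists over \<open>'u\<close>.
\<close>

definition transport ::
  "('g \<Rightarrow> 'h) \<Rightarrow> ('r, 'g) hom_gerstenhaber_data \<Rightarrow> ('r, 'h) hom_gerstenhaber_data" where
  "transport e E =
     (let e' = inv_into (carrier E) e
      in \<lparr> carrier = e ` carrier E,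
           mult = (\<lambda>x y. e (e' x \<otimes>\<^bsub>E\<^esub> e' y)),
           one = e \<one>\<^bsub>E\<^esub>,
           zero = e \<zero>\<^bsub>E\<^esub>,
           add = (\<lambda>x y. e (e' x \<oplus>\<^bsub>E\<^esub> e' y)),
           smult = (\<lambda>r x. e (r \<odot>\<^bsub>E\<^esub> e' x)),
           part = (\<lambda>i. e ` part E i),
           bracket = (\<lambda>x y. e (bracket E (e' x) (e' y))),
           twist = (\<lambda>x. e (twist E (e' x))) \<rparr>)"

definition exterior_code ::
  "('r, 'u, 'u) hom_lie_rinehart_data \<Rightarrow> ('u list \<Rightarrow> 'u) set \<Rightarrow> 'u" where
  "exterior_code X = (SOME e. inj_on e (carrier (exterior (base X) (space X))))"

definition functor_G ::
  "'r ring \<Rightarrow> (('r, 'u, 'u) hom_lie_rinehart_data, ('u \<Rightarrow> 'u) \<times> ('u \<Rightarrow> 'u),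
               ('r, 'u) hom_gerstenhaber_data, 'u \<Rightarrow> 'u) functor_data" where
  "functor_G R =
     \<lparr> fobj = (\<lambda>X. transport (exterior_code X) (exterior_gerstenhaber R X)),
       fmor = (\<lambda>X Y (g, f).
         (let C = carrier (exterior (base X) (space X)); e = exterior_code X
          in (\<lambda>u \<in> e ` C.
                exterior_code Y
                  (exterior_map R (base X) (space X) (base Y) (space Y) g f
                    (inv_into C e u))))) \<rparr>"


section \<open>The functor \<open>\<F>\<close>\<close>

text \<open>The multiplicative fields of \<open>space\<close> are irrelevant, as it is used only as a module.\<close>

definition functor_F ::
  "(('r, 'u) hom_gerstenhaber_data, 'u \<Rightarrow> 'u,
    ('r, 'u, 'u) hom_lie_rinehart_data, ('u \<Rightarrow> 'u) \<times> ('u \<Rightarrow> 'u)) functor_data" where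
  "functor_F =
     \<lparr> fobj = (\<lambda>E.
         \<lparr> base = \<lparr> carrier = part E 0, mult = mult E, one = one E, zero = zero E, add = add E,
                    smult = smult E \<rparr>,
           space = \<lparr> carrier = part E 1, mult = mult E, one = one E, zero = zero E, add = add E,
                     smult = mult E \<rparr>,
           lie = bracket E,
           phi = twist E,
           alpha = twist E,
           anchor = bracket E \<rparr>),
       fmor = (\<lambda>E E' h. (restrict h (part E 0), restrict h (part E 1))) \<rparr>"


section \<open>The categories\<close>

text \<open>Morphisms are maps that are \<^const>\<open>undefined\<close> outside the carriers.\<close>

definition hLR_all ::
  "'r ring \<Rightarrow> (('r, 'u, 'u) hom_lie_rinehart_data, ('u \<Rightarrow> 'u) \<times> ('u \<Rightarrow> 'u)) category" where
  "hLR_all R =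
     \<lparr> Obj = {X. hom_lie_rinehart R X},
       Hom = hom_lie_rinehart_homs R,
       idt = (\<lambda>X. (\<lambda>a \<in> carrier (base X). a, \<lambda>x \<in> carrier (space X). x)),
       cmp = (\<lambda>X Y Z (g', f') (g, f).
                (compose (carrier (base X)) g' g, compose (carrier (space X)) f' f)) \<rparr>"

definition hLR ::
  "'r ring \<Rightarrow> (('r, 'u, 'u) hom_lie_rinehart_data, ('u \<Rightarrow> 'u) \<times> ('u \<Rightarrow> 'u)) category" where
  "hLR R = full_subcategory (hLR_all R) {X. faithful_action (base X) (space X)}"

definition hGR :: "'r ring \<Rightarrow> (('r, 'u) hom_gerstenhaber_data, 'u \<Rightarrow> 'u) category" where
  "hGR R =
     \<lparr> Obj = {E. hom_gerstenhaber R E},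
       Hom = hom_gerstenhaber_homs R,
       idt = (\<lambda>E. \<lambda>x \<in> carrier E. x),
       cmp = (\<lambda>E E' E'' h' h. compose (carrier E) h' h) \<rparr>"

text \<open>The degree \<open>0\<close> part of a hom-Gerstenhaber algebra need not act faithfully on the degree \<open>1\<close>
  part, so \<open>\<F>\<close> is defined on \<open>hGR\<close> with values in \<open>hLR_all\<close>, and on the following full
  subcategory with values in \<open>hLR\<close>.\<close>

definition hGR_faithful :: "'r ring \<Rightarrow> (('r, 'u) hom_gerstenhaber_data, 'u \<Rightarrow> 'u) category" where
  "hGR_faithful R =
     full_subcategory (hGR R)
       {E. faithful_action (base (fobj functor_F E)) (space (fobj functor_F E))}"

end

theory Submission
  imports Defs
begin

text \<open>
  The exterior algebra \<open>E\<close> of \<open>L\<close> is used only through one recursion principle: if \<open>A\<close> and \<open>L\<close> act on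
  an abelian group \<open>N\<close> compatibly with the defining relations, then so does \<open>E\<close>. For \<open>N\<close> a ring
  acting on itself this is the universal property; acting on pairs \<open>(\<alpha>\<^sub>G v, D v)\<close> it extends a map
  on generators to a twisted derivation \<open>D\<close>, which yields \<open>[x, -]\<close> and \<open>[a, -]\<close> for generators \<open>x \<in> L\<close>
  and \<open>a \<in> A\<close>; acting on pairs \<open>(\<alpha>\<^sub>G u, [u, -])\<close> it yields the bracket itself.

  A graded skew bracket satisfying the twisted Leibniz rule on an algebra generated in degrees \<open>0\<close>
  and \<open>1\<close> is determined by its values on generators. Hence a homomorphism of graded algebras
  commuting with the twists preserves brackets as soon as it does so on generators, and the graded
  Jacobi identity, both sides of which are derivations in each argument, holds as soon as it holds on
  generators. The first fact gives the multiplicativity of the twist and the adjunction: a morphism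
  out of \<open>\<G>(X)\<close> is the same as its restriction to \<open>A\<close> and \<open>L\<close>. Functoriality of \<open>\<G>\<close> follows, since
  \<open>\<G>(k)\<close> is the morphism adjunct to the composite of \<open>k\<close> with the unit.
\<close>

section \<open>The free algebra on words\<close>

text \<open>The bracket is linear over \<open>R\<close> only, while words are taken modulo relations
  over \<open>A\<close>. Moving a scalar \<open>a\<close> out of the first argument of
  \<open>[-, v]\<close> leaves a term containing \<open>[a, v]\<close>; so the brackets of scalars,
  which the given formulas prescribe only through skew-symmetry, have to be constructed beside those
  of elements of \<open>L\<close>, before anything can be shown to respect the relations. A twisted
  rule for \<open>D (x v)\<close> mentions \<open>\<alpha>_G v\<close> as well as
  \<open>D v\<close>; hence \<open>D\<close> alone is not given by an action, and a pair is. The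
  recursion runs over inhomogeneous elements, where the sign \<open>(-1)^|u|\<close> has no meaning;
  an involution of the whole algebra replaces it. Faithfulness is a separate obstacle. It can fail
  for the values of \<open>functor_F\<close>, so the adjunction is established between
  \<open>hLR_all\<close> and \<open>hGR\<close> and then cut down to full subcategories. That step
  needs \<open>L\<close> to embed into its exterior algebra, which is read off from a suitable
  action, since a presentation by generators and relations does not display it.\<close>

definition cauchy :: "('a, 'x) ring_scheme \<Rightarrow> ('l list \<Rightarrow> 'a) \<Rightarrow> ('l list \<Rightarrow> 'a) \<Rightarrow> 'l list \<Rightarrow> 'a" where
  "cauchy A p q = (\<lambda>w. \<Oplus>\<^bsub>A\<^esub> i \<in> {0..length w}. p (take i w) \<otimes>\<^bsub>A\<^esub> q (drop i w))"

section \<open>Convolution of functions on words\<close>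

context ring
begin

lemma cauchy_Nil:
  assumes "\<And>w. p w \<in> carrier R" "\<And>w. q w \<in> carrier R"
  shows "cauchy R p q [] = p [] \<otimes> q []"
  using assms by (simp add: cauchy_def)

text \<open>The cut before the first letter is split off; the other cuts of \<open>x # w\<close> are
  the cuts of \<open>w\<close>, with \<open>p\<close> replaced by its tail
  \<open>\<lambda>w. p (x # w)\<close>. The support plays no part in this, so \<open>cauchy\<close>
  is studied for arbitrary functions into the carrier.\<close>

lemma cauchy_Cons:
  assumes "\<And>w. p w \<in> carrier R" "\<And>w. q w \<in> carrier R"
  shows "cauchy R p q (x # w) = p [] \<otimes> q (x # w) \<oplus> cauchy R (\<lambda>w. p (x # w)) q w"
proof -
  have "cauchy R p q (x # w) = (\<Oplus>i \<in> {..Suc (length w)}. p (take i (x # w)) \<otimes> q (drop i (x # w)))"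
    by (simp add: cauchy_def atLeast0AtMost)
  also have "\<dots> = (\<Oplus>i \<in> {..length w}. p (take (Suc i) (x # w)) \<otimes> q (drop (Suc i) (x # w))) \<oplus>
      p (take 0 (x # w)) \<otimes> q (drop 0 (x # w))"
    by (rule finsum_Suc2) (use assms in auto)
  finally show ?thesis using assms by (simp add: cauchy_def atLeast0AtMost a_comm)
qed

lemma cauchy_closed [simp]:
  assumes "\<And>w. p w \<in> carrier R" "\<And>w. q w \<in> carrier R"
  shows "cauchy R p q w \<in> carrier R"
  using assms by (simp add: cauchy_def)

lemma cauchy_add_left:
  assumes "\<And>w. p w \<in> carrier R" "\<And>w. p' w \<in> carrier R" "\<And>w. q w \<in> carrier R"
  shows "cauchy R (\<lambda>w. p w \<oplus> p' w) q w = cauchy R p q w \<oplus> cauchy R p' q w"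
  using assms by (simp add: cauchy_def l_distr finsum_addf Pi_def)

lemma cauchy_add_right:
  assumes "\<And>w. p w \<in> carrier R" "\<And>w. q w \<in> carrier R" "\<And>w. q' w \<in> carrier R"
  shows "cauchy R p (\<lambda>w. q w \<oplus> q' w) w = cauchy R p q w \<oplus> cauchy R p q' w"
  using assms by (simp add: cauchy_def r_distr finsum_addf Pi_def)

lemma cauchy_scale_left:
  assumes "a \<in> carrier R" "\<And>w. p w \<in> carrier R" "\<And>w. q w \<in> carrier R"
  shows "cauchy R (\<lambda>w. a \<otimes> p w) q w = a \<otimes> cauchy R p q w"
  using assms by (simp add: cauchy_def finsum_rdistr m_assoc Pi_def)

lemma cauchy_zero_left:
  assumes "\<And>w. q w \<in> carrier R"
  shows "cauchy R (\<lambda>w. \<zero>) q w = \<zero>"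
  using assms by (simp add: cauchy_def)

text \<open>Peeling the first letter replaces \<open>p\<close> by its tail and leaves
  \<open>q\<close> and \<open>r\<close> alone, so induction on the word with \<open>p\<close>
  generalised avoids rearranging a double sum.\<close>

lemma cauchy_assoc:
  assumes "\<And>w. p w \<in> carrier R" "\<And>w. q w \<in> carrier R" "\<And>w. r w \<in> carrier R"
  shows "cauchy R (cauchy R p q) r w = cauchy R p (cauchy R q r) w"
  using assms(1)
proof (induction w arbitrary: p)
  case Nil
  then show ?case using assms by (simp add: cauchy_Nil m_assoc)
next
  case (Cons x w)
  have "cauchy R (\<lambda>w. cauchy R p q (x # w)) r w =
      p [] \<otimes> cauchy R (\<lambda>w. q (x # w)) r w \<oplus> cauchy R (cauchy R (\<lambda>w. p (x # w)) q) r w"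
    using Cons.prems assms by (simp add: cauchy_Cons cauchy_add_left cauchy_scale_left)
  then show ?case
    using Cons.prems assms
    by (simp add: cauchy_Cons cauchy_Nil Cons.IH m_assoc r_distr a_assoc)
qed

lemma word_monomial_closed [simp]: "a \<in> carrier R \<Longrightarrow> word_monomial R a xs w \<in> carrier R"
  by (simp add: word_monomial_def)

lemma cauchy_monomial_Nil:
  assumes "a \<in> carrier R" "\<And>w. q w \<in> carrier R"
  shows "cauchy R (word_monomial R a []) q w = a \<otimes> q w"
proof (cases w)
  case Nil
  then show ?thesis using assms by (simp add: cauchy_Nil word_monomial_def)
next
  case (Cons x v)
  then show ?thesis
    using assms by (simp add: cauchy_Cons word_monomial_def cauchy_zero_left)
qed

lemma cauchy_monomial_one_right:
  assumes "\<And>w. p w \<in> carrier R"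
  shows "cauchy R p (word_monomial R \<one> []) w = p w"
  using assms
proof (induction w arbitrary: p)
  case Nil
  then show ?case by (simp add: cauchy_Nil word_monomial_def)
next
  case (Cons x w)
  show ?case using Cons by (simp add: cauchy_Cons) (simp add: word_monomial_def)
qed

lemma cauchy_monomial_Cons:
  assumes "a \<in> carrier R" "\<And>w. q w \<in> carrier R"
  shows "cauchy R (word_monomial R a (x # xs)) q w =
    (case w of [] \<Rightarrow> \<zero> | y # v \<Rightarrow> if x = y then cauchy R (word_monomial R a xs) q v else \<zero>)"
proof (cases w)
  case Nil
  then show ?thesis using assms by (simp add: cauchy_Nil word_monomial_def)
next
  case (Cons y v)
  have "(\<lambda>w. word_monomial R a (x # xs) (y # w)) =
      (if x = y then word_monomial R a xs else (\<lambda>w. \<zero>))"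
    by (auto simp: word_monomial_def)
  moreover have "word_monomial R a (x # xs) [] = \<zero>"
    by (simp add: word_monomial_def)
  ultimately show ?thesis
    using Cons assms by (simp add: cauchy_Cons cauchy_zero_left)
qed

lemma cauchy_monomial_mult:
  assumes "a \<in> carrier R" "b \<in> carrier R"
  shows "cauchy R (word_monomial R a xs) (word_monomial R b ys) = word_monomial R (a \<otimes> b) (xs @ ys)"
proof (rule ext)
  show "cauchy R (word_monomial R a xs) (word_monomial R b ys) w = word_monomial R (a \<otimes> b) (xs @ ys) w" for w
  proof (induction xs arbitrary: w)
    case Nil
    then show ?case using assms by (simp add: cauchy_monomial_Nil) (simp add: word_monomial_def)
  next
    case (Cons x xs)
    then show ?case
      using assms by (auto simp: cauchy_monomial_Cons split: list.splits) (auto simp: word_monomial_def)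
  qed
qed

lemma cauchy_support:
  assumes "\<And>w. p w \<in> carrier R" "\<And>w. q w \<in> carrier R" "cauchy R p q w \<noteq> \<zero>"
  shows "\<exists>u v. w = u @ v \<and> p u \<noteq> \<zero> \<and> q v \<noteq> \<zero>"
proof (rule ccontr)
  assume "\<not> ?thesis"
  then have "p (take i w) \<otimes> q (drop i w) = \<zero>" for i
    using assms(1,2) by (metis append_take_drop_id l_null r_null)
  then show False using assms(3) by (simp add: cauchy_def)
qed

end

section \<open>The ring of finitely supported functions on words\<close>

locale exterior_module = module A L
  for A :: "('r, 'a) module" (structure) and L :: "('a, 'l) module" (structure)
begin

abbreviation T where "T \<equiv> free_algebra A L"
abbreviation mon where "mon \<equiv> word_monomial A"

lemma T_carrier:
  "p \<in> carrier T \<longleftrightarrow> (\<forall>w. p w \<in> carrier A) \<and> finite {w. p w \<noteq> \<zero>} \<and>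
     (\<forall>w. p w \<noteq> \<zero> \<longrightarrow> set w \<subseteq> carrier L)"
  by (simp add: free_algebra_def)

lemma T_closed: "p \<in> carrier T \<Longrightarrow> p w \<in> carrier A"
  by (simp add: T_carrier)

lemma T_mult: "p \<otimes>\<^bsub>T\<^esub> q = cauchy A p q"
  by (simp add: free_algebra_def cauchy_def)

lemma T_add: "p \<oplus>\<^bsub>T\<^esub> q = (\<lambda>w. p w \<oplus> q w)"
  by (simp add: free_algebra_def)

lemma T_zero: "\<zero>\<^bsub>T\<^esub> = (\<lambda>w. \<zero>)"
  by (simp add: free_algebra_def)

lemma T_one: "\<one>\<^bsub>T\<^esub> = mon \<one> []"
  by (simp add: free_algebra_def)

lemma mon_closed [simp, intro]: "a \<in> carrier A \<Longrightarrow> set xs \<subseteq> carrier L \<Longrightarrow> mon a xs \<in> carrier T"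
  by (auto simp: T_carrier word_monomial_def)

lemma T_mult_closed: "p \<in> carrier T \<Longrightarrow> q \<in> carrier T \<Longrightarrow> p \<otimes>\<^bsub>T\<^esub> q \<in> carrier T"
proof -
  assume p: "p \<in> carrier T" and q: "q \<in> carrier T"
  let ?P = "{w. p w \<noteq> \<zero>}" and ?Q = "{w. q w \<noteq> \<zero>}"
  have sub: "\<exists>u v. w = u @ v \<and> p u \<noteq> \<zero> \<and> q v \<noteq> \<zero>" if "cauchy A p q w \<noteq> \<zero>" for w
    using R.cauchy_support p q that by (meson T_closed)
  have "{w. cauchy A p q w \<noteq> \<zero>} \<subseteq> (\<lambda>(u, v). u @ v) ` (?P \<times> ?Q)"
    using sub by fastforce
  moreover have "finite ((\<lambda>(u, v). u @ v) ` (?P \<times> ?Q))"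
    using p q by (simp add: T_carrier)
  ultimately have "finite {w. cauchy A p q w \<noteq> \<zero>}" by (rule finite_subset)
  moreover have "set w \<subseteq> carrier L" if "cauchy A p q w \<noteq> \<zero>" for w
    using sub[OF that] p q by (metis T_carrier Un_least set_append)
  moreover have "cauchy A p q w \<in> carrier A" for w
    using p q by (simp add: T_closed)
  ultimately show ?thesis by (simp add: T_carrier T_mult)
qed

lemma T_ring: "ring T"
proof (rule ringI)
  show "abelian_group T"
  proof (rule abelian_groupI)
    fix x y assume x: "x \<in> carrier T" and y: "y \<in> carrier T"
    have "{w. x w \<oplus> y w \<noteq> \<zero>} \<subseteq> {w. x w \<noteq> \<zero>} \<union> {w. y w \<noteq> \<zero>}" by auto
    moreover have "finite ({w. x w \<noteq> \<zero>} \<union> {w. y w \<noteq> \<zero>})"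
      using x y by (simp add: T_carrier)
    ultimately have "finite {w. x w \<oplus> y w \<noteq> \<zero>}" by (rule finite_subset)
    moreover have "set w \<subseteq> carrier L" if "x w \<oplus> y w \<noteq> \<zero>" for w
      using that x y by (metis T_carrier R.l_zero R.zero_closed)
    ultimately show "x \<oplus>\<^bsub>T\<^esub> y \<in> carrier T"
      using x y by (simp add: T_carrier T_add)
  next
    fix x assume x: "x \<in> carrier T"
    have "(\<ominus> x w = \<zero>) = (x w = \<zero>)" for w
      using x by (metis T_closed R.minus_minus R.minus_zero)
    then have "(\<lambda>w. \<ominus> x w) \<in> carrier T" using x by (simp add: T_carrier)
    moreover have "(\<lambda>w. \<ominus> x w) \<oplus>\<^bsub>T\<^esub> x = \<zero>\<^bsub>T\<^esub>"
      using x by (auto simp: T_add T_zero R.l_neg T_closed)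
    ultimately show "\<exists>y\<in>carrier T. y \<oplus>\<^bsub>T\<^esub> x = \<zero>\<^bsub>T\<^esub>" by blast
  qed (auto simp: T_add T_zero T_closed R.a_ac T_carrier)
  show "monoid T"
    by (rule monoidI)
      (auto simp: T_mult_closed T_one, auto simp: T_mult T_closed R.cauchy_assoc fun_eq_iff
        R.cauchy_monomial_Nil R.cauchy_monomial_one_right)
qed (auto simp: T_mult T_add T_closed R.cauchy_add_left R.cauchy_add_right fun_eq_iff)

sublocale T: ring "free_algebra A L" by (rule T_ring)

lemma mon_mult: "a \<in> carrier A \<Longrightarrow> b \<in> carrier A \<Longrightarrow> mon a xs \<otimes>\<^bsub>T\<^esub> mon b ys = mon (a \<otimes> b) (xs @ ys)"
  by (simp add: T_mult R.cauchy_monomial_mult)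

lemma mon_add: "a \<in> carrier A \<Longrightarrow> b \<in> carrier A \<Longrightarrow> mon a xs \<oplus>\<^bsub>T\<^esub> mon b xs = mon (a \<oplus> b) xs"
  by (auto simp: T_add word_monomial_def)

lemma mon_zero: "mon \<zero> xs = \<zero>\<^bsub>T\<^esub>"
  by (auto simp: T_zero word_monomial_def)

text \<open>The words of the support are removed one at a time. The set \<open>S\<close> is kept so
  that only monomials on words of the original support occur; this is what lets a homogeneous
  element be decomposed without leaving its degree.\<close>

lemma T_induct_support [consumes 3, case_names zero mon add]:
  assumes "p \<in> carrier T" "finite S" "{w. p w \<noteq> \<zero>} \<subseteq> S"
    and zero: "P \<zero>\<^bsub>T\<^esub>"
    and mon: "\<And>a xs. a \<in> carrier A \<Longrightarrow> set xs \<subseteq> carrier L \<Longrightarrow> xs \<in> S \<Longrightarrow> P (mon a xs)"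
    and add: "\<And>p q. p \<in> carrier T \<Longrightarrow> q \<in> carrier T \<Longrightarrow> P p \<Longrightarrow> P q \<Longrightarrow> P (p \<oplus>\<^bsub>T\<^esub> q)"
  shows "P p"
proof -
  have "P p" if "p \<in> carrier T" "finite F" "F \<subseteq> S" "{w. p w \<noteq> \<zero>} \<subseteq> F" for F p
    using that(2,1,3,4)
  proof (induction F arbitrary: p)
    case empty
    then have "p = \<zero>\<^bsub>T\<^esub>" by (auto simp: T_zero)
    then show ?case by (simp add: zero)
  next
    case (insert v F)
    let ?q = "p(v := \<zero>)"
    have pv: "p v \<in> carrier A" using insert.prems by (simp add: T_closed)
    have q: "?q \<in> carrier T"
      using insert.prems by (auto simp: T_carrier intro: finite_subset[rotated])
    have Pq: "P ?q" using insert.prems by (intro insert.IH q) auto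
    show ?case
    proof (cases "p v = \<zero>")
      case True
      then have "?q = p" by auto
      then show ?thesis using Pq by simp
    next
      case False
      then have v: "set v \<subseteq> carrier L" using insert.prems by (simp add: T_carrier)
      have "p = mon (p v) v \<oplus>\<^bsub>T\<^esub> ?q"
        using insert.prems by (auto simp: T_add word_monomial_def T_closed)
      moreover have "P (mon (p v) v \<oplus>\<^bsub>T\<^esub> ?q)"
        using insert.prems by (intro add mon q Pq v pv mon_closed) auto
      ultimately show ?thesis by metis
    qed
  qed
  then show ?thesis using assms(1-3) by blast
qed

lemma T_induct [consumes 1, case_names mon add]:
  assumes "p \<in> carrier T"
    and "\<And>a xs. a \<in> carrier A \<Longrightarrow> set xs \<subseteq> carrier L \<Longrightarrow> P (mon a xs)"
    and "\<And>p q. p \<in> carrier T \<Longrightarrow> q \<in> carrier T \<Longrightarrow> P p \<Longrightarrow> P q \<Longrightarrow> P (p \<oplus>\<^bsub>T\<^esub> q)"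
  shows "P p"
  using assms(1)
  by (rule T_induct_support[where S = "{w. p w \<noteq> \<zero>}"])
    (use assms in \<open>auto simp: T_carrier mon_zero[symmetric, of "[]"]\<close>)

end

section \<open>The exterior algebra and its universal property\<close>

text \<open>Instead of ring homomorphisms into a ring, the universal property is stated for actions on
  an abelian group \<open>N\<close>: this covers ring homomorphisms (\<open>N\<close> a ring, acting by left multiplication),
  twisted derivations and the grading at once.\<close>

locale exterior_action = exterior_module A L + N: abelian_group N
  for A :: "('r, 'a) module" (structure) and L :: "('a, 'l) module" (structure) and N (structure) +
  fixes G :: "'a \<Rightarrow> 'n \<Rightarrow> 'n" and F :: "'l \<Rightarrow> 'n \<Rightarrow> 'n"
  assumes G_closed [simp]: "a \<in> carrier A \<Longrightarrow> n \<in> carrier N \<Longrightarrow> G a n \<in> carrier N"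
    and F_closed [simp]: "x \<in> carrier L \<Longrightarrow> n \<in> carrier N \<Longrightarrow> F x n \<in> carrier N"
    and G_add: "a \<in> carrier A \<Longrightarrow> n \<in> carrier N \<Longrightarrow> n' \<in> carrier N \<Longrightarrow>
      G a (n \<oplus>\<^bsub>N\<^esub> n') = G a n \<oplus>\<^bsub>N\<^esub> G a n'"
    and F_add: "x \<in> carrier L \<Longrightarrow> n \<in> carrier N \<Longrightarrow> n' \<in> carrier N \<Longrightarrow>
      F x (n \<oplus>\<^bsub>N\<^esub> n') = F x n \<oplus>\<^bsub>N\<^esub> F x n'"
    and G_plus: "a \<in> carrier A \<Longrightarrow> b \<in> carrier A \<Longrightarrow> n \<in> carrier N \<Longrightarrow>
      G (a \<oplus> b) n = G a n \<oplus>\<^bsub>N\<^esub> G b n"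
    and G_mult: "a \<in> carrier A \<Longrightarrow> b \<in> carrier A \<Longrightarrow> n \<in> carrier N \<Longrightarrow> G (a \<otimes> b) n = G a (G b n)"
    and G_one: "n \<in> carrier N \<Longrightarrow> G \<one> n = n"
    and F_plus: "x \<in> carrier L \<Longrightarrow> y \<in> carrier L \<Longrightarrow> n \<in> carrier N \<Longrightarrow>
      F (x \<oplus>\<^bsub>L\<^esub> y) n = F x n \<oplus>\<^bsub>N\<^esub> F y n"
    and F_smult: "a \<in> carrier A \<Longrightarrow> x \<in> carrier L \<Longrightarrow> n \<in> carrier N \<Longrightarrow>
      F (a \<odot>\<^bsub>L\<^esub> x) n = G a (F x n)"
    and F_G: "a \<in> carrier A \<Longrightarrow> x \<in> carrier L \<Longrightarrow> n \<in> carrier N \<Longrightarrow> F x (G a n) = G a (F x n)"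
    and F_F: "x \<in> carrier L \<Longrightarrow> n \<in> carrier N \<Longrightarrow> F x (F x n) = \<zero>\<^bsub>N\<^esub>"
begin

text \<open>\<open>foldr\<close> lets the first letter act last, so that concatenation of words
  becomes composition of operators.\<close>

definition act :: "('l list \<Rightarrow> 'a) \<Rightarrow> 'n \<Rightarrow> 'n" where
  "act p n = (\<Oplus>\<^bsub>N\<^esub> w \<in> {w. p w \<noteq> \<zero>}. G (p w) (foldr F w n))"

lemma foldr_F_closed [simp]: "set w \<subseteq> carrier L \<Longrightarrow> n \<in> carrier N \<Longrightarrow> foldr F w n \<in> carrier N"
  by (induction w) auto

lemma G_zero: "n \<in> carrier N \<Longrightarrow> G \<zero> n = \<zero>\<^bsub>N\<^esub>"
  using G_plus[of \<zero> \<zero> n] by (metis G_closed N.add.r_cancel_one R.l_zero R.zero_closed)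

lemma foldr_F_add: "set w \<subseteq> carrier L \<Longrightarrow> n \<in> carrier N \<Longrightarrow> n' \<in> carrier N \<Longrightarrow>
    foldr F w (n \<oplus>\<^bsub>N\<^esub> n') = foldr F w n \<oplus>\<^bsub>N\<^esub> foldr F w n'"
  by (induction w) (auto simp: F_add)

lemma foldr_F_G: "set w \<subseteq> carrier L \<Longrightarrow> n \<in> carrier N \<Longrightarrow> a \<in> carrier A \<Longrightarrow>
    foldr F w (G a n) = G a (foldr F w n)"
  by (induction w) (auto simp: F_G)

text \<open>Because \<open>G \<zero>\<close> is zero, the sum may run over any finite set containing
  the support. Two elements can then be added over a common index set.\<close>

lemma act_eq_sum:
  assumes "p \<in> carrier T" "n \<in> carrier N" "finite S" "{w. p w \<noteq> \<zero>} \<subseteq> S" "\<And>w. w \<in> S \<Longrightarrow> set w \<subseteq> carrier L"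
  shows "act p n = (\<Oplus>\<^bsub>N\<^esub> w \<in> S. G (p w) (foldr F w n))"
  unfolding act_def
  by (rule N.add.finprod_mono_neutral_cong_left) (use assms in \<open>auto simp: T_closed G_zero\<close>)

lemma act_closed [simp]: "p \<in> carrier T \<Longrightarrow> n \<in> carrier N \<Longrightarrow> act p n \<in> carrier N"
  unfolding act_def by (rule N.finsum_closed) (auto simp: T_carrier)

lemma act_mon:
  "a \<in> carrier A \<Longrightarrow> set xs \<subseteq> carrier L \<Longrightarrow> n \<in> carrier N \<Longrightarrow> act (mon a xs) n = G a (foldr F xs n)"
  by (subst act_eq_sum[OF mon_closed, where S = "{xs}"]) (auto simp: word_monomial_def)

lemma act_add_left:
  assumes p: "p \<in> carrier T" and q: "q \<in> carrier T" and n: "n \<in> carrier N"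
  shows "act (p \<oplus>\<^bsub>T\<^esub> q) n = act p n \<oplus>\<^bsub>N\<^esub> act q n"
proof -
  let ?S = "{w. p w \<noteq> \<zero>} \<union> {w. q w \<noteq> \<zero>}"
  have S: "finite ?S" "\<And>w. w \<in> ?S \<Longrightarrow> set w \<subseteq> carrier L"
    using p q by (auto simp: T_carrier)
  have "act (p \<oplus>\<^bsub>T\<^esub> q) n = (\<Oplus>\<^bsub>N\<^esub> w \<in> ?S. G ((p \<oplus>\<^bsub>T\<^esub> q) w) (foldr F w n))"
    by (rule act_eq_sum[OF T.a_closed[OF p q]]) (use p q n S in \<open>auto simp: T_add\<close>)
  also have "\<dots> = (\<Oplus>\<^bsub>N\<^esub> w \<in> ?S. G (p w) (foldr F w n) \<oplus>\<^bsub>N\<^esub> G (q w) (foldr F w n))"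
    using S p q n by (intro N.finsum_cong') (auto simp: T_add T_closed G_plus)
  also have "\<dots> = (\<Oplus>\<^bsub>N\<^esub> w \<in> ?S. G (p w) (foldr F w n)) \<oplus>\<^bsub>N\<^esub> (\<Oplus>\<^bsub>N\<^esub> w \<in> ?S. G (q w) (foldr F w n))"
    using S p q n by (intro N.finsum_addf) (auto simp: T_closed)
  moreover have "act p n = (\<Oplus>\<^bsub>N\<^esub> w \<in> ?S. G (p w) (foldr F w n))"
    by (rule act_eq_sum) (use p n S in auto)
  moreover have "act q n = (\<Oplus>\<^bsub>N\<^esub> w \<in> ?S. G (q w) (foldr F w n))"
    by (rule act_eq_sum) (use q n S in auto)
  ultimately show ?thesis by simp
qed

lemma act_add_right:
  assumes p: "p \<in> carrier T" and n: "n \<in> carrier N" "n' \<in> carrier N"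
  shows "act p (n \<oplus>\<^bsub>N\<^esub> n') = act p n \<oplus>\<^bsub>N\<^esub> act p n'"
  using p
proof (induction rule: T_induct)
  case (mon a xs)
  then show ?case using n by (simp add: act_mon foldr_F_add G_add)
next
  case (add p q)
  then show ?case using n by (simp add: act_add_left N.a_ac)
qed

lemma act_mult:
  assumes p: "p \<in> carrier T" and q: "q \<in> carrier T" and n: "n \<in> carrier N"
  shows "act (p \<otimes>\<^bsub>T\<^esub> q) n = act p (act q n)"
  using p
proof (induction rule: T_induct)
  case (mon a xs)
  show ?case using q
  proof (induction rule: T_induct)
    case (mon b ys)
    then show ?case
      using \<open>a \<in> carrier A\<close> \<open>set xs \<subseteq> carrier L\<close> n by (simp add: mon_mult act_mon foldr_F_G G_mult)
  next
    case (add q q')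
    then show ?case using mon n by (simp add: T.r_distr act_add_left act_add_right)
  qed
next
  case (add p p')
  then show ?case using q n by (simp add: T.l_distr act_add_left)
qed

text \<open>The annihilator of a module is a two-sided ideal. By minimality it contains
  \<open>I\<close> as soon as it contains the generating relations.\<close>

lemma act_kernel_ideal: "ideal {p \<in> carrier T. \<forall>n \<in> carrier N. act p n = \<zero>\<^bsub>N\<^esub>} T" (is "ideal ?K T")
proof (rule idealI[OF T_ring])
  have z: "act \<zero>\<^bsub>T\<^esub> n = \<zero>\<^bsub>N\<^esub>" if "n \<in> carrier N" for n
    using that act_mon[of \<zero> "[]" n] by (simp add: mon_zero G_zero)
  have z': "act p \<zero>\<^bsub>N\<^esub> = \<zero>\<^bsub>N\<^esub>" if "p \<in> carrier T" for p
    using that act_add_right[of p "\<zero>\<^bsub>N\<^esub>" "\<zero>\<^bsub>N\<^esub>"] by simp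
  show "subgroup ?K (add_monoid T)"
  proof (rule T.add.subgroupI)
    show "?K \<noteq> {}" using z by blast
    show "\<ominus>\<^bsub>T\<^esub> p \<in> ?K" if "p \<in> ?K" for p
    proof -
      have "act (\<ominus>\<^bsub>T\<^esub> p \<oplus>\<^bsub>T\<^esub> p) n = \<zero>\<^bsub>N\<^esub>" if "n \<in> carrier N" for n
        using that \<open>p \<in> ?K\<close> z by (simp add: T.l_neg)
      then show ?thesis using that by (simp add: act_add_left)
    qed
  qed (auto simp: act_add_left)
  show "p \<otimes>\<^bsub>T\<^esub> q \<in> ?K" if "q \<in> ?K" "p \<in> carrier T" for p q
    using that z' by (simp add: act_mult)
  show "p \<otimes>\<^bsub>T\<^esub> q \<in> ?K" if "p \<in> ?K" "q \<in> carrier T" for p q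
    using that by (simp add: act_mult)
qed

end

text \<open>\<open>exterior\<close> repackages the quotient ring as a module record, so the ring
  axioms have to be carried from one record type to another.\<close>

lemma ring_transfer:
  assumes "ring Q" "carrier E = carrier Q" "mult E = mult Q" "one E = one Q" "zero E = zero Q"
    "add E = add Q"
  shows "ring E"
proof -
  interpret Q: ring Q by fact
  show ?thesis
  proof (rule ringI)
    show "abelian_group E"
      by (rule abelian_groupI) (auto simp: assms(2-6) Q.a_ac intro: Q.l_neg Q.a_inv_closed)
    show "monoid E"
      by (rule monoidI) (auto simp: assms(2-6) Q.m_assoc)
  qed (auto simp: assms(2-6) Q.l_distr Q.r_distr)
qed

section \<open>The quotient: scalars, generators and induction rules\<close>

context exterior_module
begin

abbreviation I where "I \<equiv> exterior_ideal A L"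
abbreviation E where "E \<equiv> exterior A L"
abbreviation wdg where "wdg \<equiv> wedge A L"

definition rels :: "('l list \<Rightarrow> 'a) set" where
  "rels = {mon \<one> [x \<oplus>\<^bsub>L\<^esub> y] \<ominus>\<^bsub>T\<^esub> (mon \<one> [x] \<oplus>\<^bsub>T\<^esub> mon \<one> [y]) | x y. x \<in> carrier L \<and> y \<in> carrier L} \<union>
    {mon \<one> [a \<odot>\<^bsub>L\<^esub> x] \<ominus>\<^bsub>T\<^esub> mon a [x] | a x. a \<in> carrier A \<and> x \<in> carrier L} \<union>
    {mon \<one> [x, x] | x. x \<in> carrier L}"

lemma I_eq: "I = Idl\<^bsub>T\<^esub> rels"
  by (simp add: exterior_ideal_def rels_def Let_def)

lemma rels_closed: "rels \<subseteq> carrier T"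
  unfolding rels_def by (auto intro!: T.minus_closed T.a_closed)

lemma I_ideal: "ideal I T"
  unfolding I_eq by (rule T.genideal_ideal[OF rels_closed])

sublocale I: ideal "exterior_ideal A L" "free_algebra A L" by (rule I_ideal)

lemma rels_in_I: "rels \<subseteq> I"
  unfolding I_eq by (rule T.genideal_self[OF rels_closed])

lemma I_minimal: "ideal J T \<Longrightarrow> rels \<subseteq> J \<Longrightarrow> I \<subseteq> J"
  unfolding I_eq by (rule T.genideal_minimal)

abbreviation cls where "cls p \<equiv> I +>\<^bsub>T\<^esub> p"

lemma E_sel: "carrier E = carrier (T Quot I)" "mult E = mult (T Quot I)"
  "one E = one (T Quot I)" "zero E = zero (T Quot I)" "add E = add (T Quot I)"
  by (simp_all add: exterior_def Let_def)

lemma E_ring: "ring E"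
  by (rule ring_transfer[OF I.quotient_is_ring]) (simp_all add: E_sel)

sublocale E: ring "exterior A L" by (rule E_ring)

abbreviation E_mult (infixl \<open>\<cdot>\<close> 70) where "u \<cdot> v \<equiv> u \<otimes>\<^bsub>E\<^esub> v"
abbreviation E_add (infixl \<open>\<^bold>+\<close> 65) where "u \<^bold>+ v \<equiv> u \<oplus>\<^bsub>E\<^esub> v"
abbreviation E_zero (\<open>\<^bold>0\<close>) where "\<^bold>0 \<equiv> \<zero>\<^bsub>E\<^esub>"

lemma E_carrier: "u \<in> carrier E \<longleftrightarrow> (\<exists>p \<in> carrier T. u = cls p)"
  by (auto simp: E_sel FactRing_def A_RCOSETS_def' a_r_coset_def')

lemma cls_closed [simp]: "p \<in> carrier T \<Longrightarrow> cls p \<in> carrier E"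
  by (auto simp: E_carrier)

lemma cls_mult: "p \<in> carrier T \<Longrightarrow> q \<in> carrier T \<Longrightarrow> cls p \<cdot> cls q = cls (p \<otimes>\<^bsub>T\<^esub> q)"
  by (simp add: E_sel FactRing_def I.rcoset_mult_add)

lemma cls_add: "p \<in> carrier T \<Longrightarrow> q \<in> carrier T \<Longrightarrow> cls p \<^bold>+ cls q = cls (p \<oplus>\<^bsub>T\<^esub> q)"
  by (simp add: E_sel FactRing_def I.a_rcos_sum)

lemma cls_zero: "cls \<zero>\<^bsub>T\<^esub> = \<^bold>0"
  by (simp add: E_sel FactRing_def) (metis I.a_subset T.a_coset_add_zero)

lemma cls_one: "cls \<one>\<^bsub>T\<^esub> = \<one>\<^bsub>E\<^esub>"
  by (simp add: E_sel FactRing_def)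

lemma cls_eq_iff: "p \<in> carrier T \<Longrightarrow> q \<in> carrier T \<Longrightarrow> cls p = cls q \<longleftrightarrow> p \<ominus>\<^bsub>T\<^esub> q \<in> I"
  using T.quotient_eq_iff_same_a_r_cos[OF I_ideal] by blast

lemma wdg_cls: "wdg a xs = cls (mon a xs)"
  by (simp add: wedge_def)

lemma wdg_closed [simp]: "a \<in> carrier A \<Longrightarrow> set xs \<subseteq> carrier L \<Longrightarrow> wdg a xs \<in> carrier E"
  by (simp add: wdg_cls)

lemma wdg_mult:
  "a \<in> carrier A \<Longrightarrow> b \<in> carrier A \<Longrightarrow> set xs \<subseteq> carrier L \<Longrightarrow> set ys \<subseteq> carrier L \<Longrightarrow>
    wdg a xs \<cdot> wdg b ys = wdg (a \<otimes> b) (xs @ ys)"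
  by (simp add: wdg_cls cls_mult mon_mult)

lemma wdg_add:
  "a \<in> carrier A \<Longrightarrow> b \<in> carrier A \<Longrightarrow> set xs \<subseteq> carrier L \<Longrightarrow>
    wdg (a \<oplus> b) xs = wdg a xs \<^bold>+ wdg b xs"
  by (simp add: wdg_cls cls_add mon_add)

lemma wdg_zero: "wdg \<zero> xs = \<^bold>0"
  by (simp add: wdg_cls mon_zero cls_zero)

text \<open>\<open>sc\<close> and \<open>gn\<close> are the canonical maps from \<open>A\<close> to
  degree 0 and from \<open>L\<close> to degree 1: the unit of the adjunction, before its values are
  coded in the universe.\<close>

definition sc :: "'a \<Rightarrow> ('l list \<Rightarrow> 'a) set" where "sc a = wdg a []"
definition gn :: "'l \<Rightarrow> ('l list \<Rightarrow> 'a) set" where "gn x = wdg \<one> [x]"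

lemma sc_closed [simp]: "a \<in> carrier A \<Longrightarrow> sc a \<in> carrier E"
  and gn_closed [simp]: "x \<in> carrier L \<Longrightarrow> gn x \<in> carrier E"
  by (simp_all add: sc_def gn_def)

lemma sc_one: "sc \<one> = \<one>\<^bsub>E\<^esub>"
  by (simp add: sc_def wdg_cls T_one[symmetric] cls_one)

lemma sc_zero: "sc \<zero> = \<^bold>0"
  by (simp add: sc_def wdg_zero)

lemma sc_add: "a \<in> carrier A \<Longrightarrow> b \<in> carrier A \<Longrightarrow> sc (a \<oplus> b) = sc a \<^bold>+ sc b"
  by (simp add: sc_def wdg_add)

lemma sc_mult: "a \<in> carrier A \<Longrightarrow> b \<in> carrier A \<Longrightarrow> sc (a \<otimes> b) = sc a \<cdot> sc b"
  by (simp add: sc_def wdg_mult)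

lemma wdg_Cons: "a \<in> carrier A \<Longrightarrow> x \<in> carrier L \<Longrightarrow> set xs \<subseteq> carrier L \<Longrightarrow>
    wdg a (x # xs) = gn x \<cdot> wdg a xs"
  by (simp add: gn_def wdg_mult)

lemma sc_wdg: "a \<in> carrier A \<Longrightarrow> b \<in> carrier A \<Longrightarrow> set xs \<subseteq> carrier L \<Longrightarrow>
    sc a \<cdot> wdg b xs = wdg (a \<otimes> b) xs"
  by (simp add: sc_def wdg_mult)

lemma wdg_eq_sc_mult: "a \<in> carrier A \<Longrightarrow> set xs \<subseteq> carrier L \<Longrightarrow> wdg a xs = sc a \<cdot> wdg \<one> xs"
  by (simp add: sc_wdg)

lemma gn_add: "x \<in> carrier L \<Longrightarrow> y \<in> carrier L \<Longrightarrow> gn (x \<oplus>\<^bsub>L\<^esub> y) = gn x \<^bold>+ gn y"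
proof -
  assume xy: "x \<in> carrier L" "y \<in> carrier L"
  have "mon \<one> [x \<oplus>\<^bsub>L\<^esub> y] \<ominus>\<^bsub>T\<^esub> (mon \<one> [x] \<oplus>\<^bsub>T\<^esub> mon \<one> [y]) \<in> I"
    by (rule subsetD[OF rels_in_I]) (use xy in \<open>auto simp: rels_def\<close>)
  then have "cls (mon \<one> [x \<oplus>\<^bsub>L\<^esub> y]) = cls (mon \<one> [x] \<oplus>\<^bsub>T\<^esub> mon \<one> [y])"
    by (subst cls_eq_iff) (use xy in auto)
  then show ?thesis using xy by (simp add: gn_def wdg_cls cls_add)
qed

lemma gn_smult: "a \<in> carrier A \<Longrightarrow> x \<in> carrier L \<Longrightarrow> gn (a \<odot>\<^bsub>L\<^esub> x) = sc a \<cdot> gn x"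
proof -
  assume ax: "a \<in> carrier A" "x \<in> carrier L"
  have "mon \<one> [a \<odot>\<^bsub>L\<^esub> x] \<ominus>\<^bsub>T\<^esub> mon a [x] \<in> I"
    by (rule subsetD[OF rels_in_I]) (use ax in \<open>auto simp: rels_def\<close>)
  then have "cls (mon \<one> [a \<odot>\<^bsub>L\<^esub> x]) = cls (mon a [x])"
    by (subst cls_eq_iff) (use ax in auto)
  moreover have "sc a \<cdot> gn x = wdg a [x]"
    using ax by (simp add: gn_def sc_wdg)
  ultimately show ?thesis by (simp add: gn_def wdg_cls)
qed

lemma gn_square: "x \<in> carrier L \<Longrightarrow> gn x \<cdot> gn x = \<^bold>0"
proof -
  assume x: "x \<in> carrier L"
  have "mon \<one> [x, x] \<in> I"
    by (rule subsetD[OF rels_in_I]) (use x in \<open>auto simp: rels_def\<close>)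
  then have "cls (mon \<one> [x, x]) = cls \<zero>\<^bsub>T\<^esub>"
    by (subst cls_eq_iff) (use x in \<open>auto simp: a_minus_def\<close>)
  then show ?thesis using x by (simp add: gn_def wdg_mult) (simp add: wdg_cls cls_zero)
qed

lemma E_induct_wdg [consumes 1, case_names wdg add]:
  assumes u: "u \<in> carrier E"
    and wdg: "\<And>a xs. a \<in> carrier A \<Longrightarrow> set xs \<subseteq> carrier L \<Longrightarrow> P (wdg a xs)"
    and add: "\<And>u v. u \<in> carrier E \<Longrightarrow> v \<in> carrier E \<Longrightarrow> P u \<Longrightarrow> P v \<Longrightarrow> P (u \<^bold>+ v)"
  shows "P u"
proof -
  obtain p where p: "p \<in> carrier T" and u: "u = cls p" using u by (auto simp: E_carrier)
  from p have "P (cls p)"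
  proof (induction rule: T_induct)
    case (mon a xs)
    then show ?case using wdg by (simp add: wdg_cls)
  next
    case (add p q)
    have "P (cls p \<^bold>+ cls q)"
      by (rule assms(3)) (use add in simp_all)
    then show ?case using add by (simp add: cls_add)
  qed
  then show ?thesis by (simp add: u)
qed

text \<open>Peeling one generator from the left is the shape of all later recursions: each map out
  of the exterior algebra is known by its values at \<open>sc a\<close> and
  \<open>gn x \<cdot> v\<close> and by additivity.\<close>

lemma E_induct [consumes 1, case_names sc gn add]:
  assumes u: "u \<in> carrier E"
    and sc: "\<And>a. a \<in> carrier A \<Longrightarrow> P (sc a)"
    and gn: "\<And>x v. x \<in> carrier L \<Longrightarrow> v \<in> carrier E \<Longrightarrow> P v \<Longrightarrow> P (gn x \<cdot> v)"
    and add: "\<And>u v. u \<in> carrier E \<Longrightarrow> v \<in> carrier E \<Longrightarrow> P u \<Longrightarrow> P v \<Longrightarrow> P (u \<^bold>+ v)"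
  shows "P u"
  using u
proof (induction rule: E_induct_wdg)
  case (wdg a xs)
  then show ?case
  proof (induction xs)
    case Nil
    then show ?case using sc[of a] by (simp add: sc_def)
  next
    case (Cons x xs)
    then show ?case using gn by (simp add: wdg_Cons)
  qed
qed (rule add)

lemma sc_central: "a \<in> carrier A \<Longrightarrow> u \<in> carrier E \<Longrightarrow> u \<cdot> sc a = sc a \<cdot> u"
proof -
  assume a: "a \<in> carrier A" and u: "u \<in> carrier E"
  from u show ?thesis
  proof (induction rule: E_induct_wdg)
    case (wdg b xs)
    then show ?case using a by (simp add: sc_def wdg_mult R.m_comm)
  next
    case (add u v)
    then show ?case using a by (simp add: E.l_distr E.r_distr)
  qed
qed

lemma sc_left_comm: "a \<in> carrier A \<Longrightarrow> u \<in> carrier E \<Longrightarrow> v \<in> carrier E \<Longrightarrow>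
    u \<cdot> (sc a \<cdot> v) = sc a \<cdot> (u \<cdot> v)"
  by (metis E.m_assoc sc_central sc_closed)

lemma gn_sc: "a \<in> carrier A \<Longrightarrow> x \<in> carrier L \<Longrightarrow> v \<in> carrier E \<Longrightarrow>
    gn x \<cdot> (sc a \<cdot> v) = sc a \<cdot> (gn x \<cdot> v)"
  by (simp add: sc_left_comm)

lemma gn_sc_comm: "a \<in> carrier A \<Longrightarrow> x \<in> carrier L \<Longrightarrow> gn x \<cdot> sc a = sc a \<cdot> gn x"
  by (simp add: sc_central)

text \<open>Polarisation of \<open>gn_square\<close>. The converse would divide by 2, which is why
  the relation imposed is the vanishing of squares.\<close>

lemma gn_anticomm:
  assumes "x \<in> carrier L" "y \<in> carrier L"
  shows "gn x \<cdot> gn y = \<ominus>\<^bsub>E\<^esub> (gn y \<cdot> gn x)"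
proof -
  have "gn (x \<oplus>\<^bsub>L\<^esub> y) \<cdot> gn (x \<oplus>\<^bsub>L\<^esub> y) = \<^bold>0"
    using assms by (simp add: gn_square)
  then have "gn x \<cdot> gn y \<^bold>+ gn y \<cdot> gn x = \<^bold>0"
    using assms by (simp add: gn_add E.l_distr E.r_distr gn_square E.a_ac)
  then show ?thesis
    using assms by (metis E.minus_equality E.m_closed gn_closed)
qed

lemma E_smult: "r \<odot>\<^bsub>E\<^esub> u = sc (r \<odot>\<^bsub>A\<^esub> \<one>) \<cdot> u"
  by (simp add: exterior_def Let_def sc_def)

end

section \<open>Descent of an action to the exterior algebra\<close>

context exterior_action
begin

lemma I_acts_zero:
  assumes "p \<in> I" "n \<in> carrier N"
  shows "act p n = \<zero>\<^bsub>N\<^esub>"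
proof -
  let ?K = "{p \<in> carrier T. \<forall>n \<in> carrier N. act p n = \<zero>\<^bsub>N\<^esub>}"
  \<comment> \<open>The linearity relations are differences, and a difference annihilates
    \<open>N\<close> once both members act alike. Only the relation for squares is a plain
    monomial.\<close>
  have minus: "p \<ominus>\<^bsub>T\<^esub> q \<in> ?K"
    if "p \<in> carrier T" "q \<in> carrier T" "\<And>n. n \<in> carrier N \<Longrightarrow> act p n = act q n" for p q
  proof -
    have "act (p \<ominus>\<^bsub>T\<^esub> q \<oplus>\<^bsub>T\<^esub> q) n = act (p \<ominus>\<^bsub>T\<^esub> q) n \<oplus>\<^bsub>N\<^esub> act q n" if "n \<in> carrier N" for n
      using that \<open>p \<in> _\<close> \<open>q \<in> _\<close> by (simp add: act_add_left)
    moreover have "p \<ominus>\<^bsub>T\<^esub> q \<oplus>\<^bsub>T\<^esub> q = p"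
      using that by (simp add: a_minus_def T.a_assoc T.l_neg)
    ultimately have "act (p \<ominus>\<^bsub>T\<^esub> q) n = \<zero>\<^bsub>N\<^esub>" if "n \<in> carrier N" for n
      using that \<open>p \<in> _\<close> \<open>q \<in> _\<close> \<open>\<And>n. n \<in> carrier N \<Longrightarrow> act p n = act q n\<close>
      by (metis N.add.l_cancel_one' T.minus_closed act_closed N.a_comm)
    then show ?thesis using that by simp
  qed
  have "rels \<subseteq> ?K"
  proof
    fix r assume "r \<in> rels"
    then consider
        (add) x y where "r = mon \<one> [x \<oplus>\<^bsub>L\<^esub> y] \<ominus>\<^bsub>T\<^esub> (mon \<one> [x] \<oplus>\<^bsub>T\<^esub> mon \<one> [y])" "x \<in> carrier L" "y \<in> carrier L"
      | (smult) a x where "r = mon \<one> [a \<odot>\<^bsub>L\<^esub> x] \<ominus>\<^bsub>T\<^esub> mon a [x]" "a \<in> carrier A" "x \<in> carrier L"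
      | (sq) x where "r = mon \<one> [x, x]" "x \<in> carrier L"
      unfolding rels_def by blast
    then show "r \<in> ?K"
    proof cases
      case add
      show ?thesis unfolding add(1)
        by (rule minus) (use add in \<open>auto simp: act_mon act_add_left G_one F_plus\<close>)
    next
      case smult
      show ?thesis unfolding smult(1)
        by (rule minus) (use smult in \<open>auto simp: act_mon act_add_left G_one F_smult\<close>)
    next
      case sq
      then show ?thesis by (simp add: act_mon G_one F_F)
    qed
  qed
  then have "I \<subseteq> ?K" by (rule I_minimal[OF act_kernel_ideal])
  then show ?thesis using assms by blast
qed

text \<open>The value is read off at a chosen representative. Any other one differs from it by an
  element of \<open>I\<close>, which acts as zero.\<close>

definition rec :: "('l list \<Rightarrow> 'a) set \<Rightarrow> 'n \<Rightarrow> 'n" where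
  "rec u n = act (SOME p. p \<in> carrier T \<and> u = cls p) n"

lemma rec_cls: "p \<in> carrier T \<Longrightarrow> n \<in> carrier N \<Longrightarrow> rec (cls p) n = act p n"
proof -
  assume p: "p \<in> carrier T" and n: "n \<in> carrier N"
  define q where "q = (SOME q. q \<in> carrier T \<and> cls p = cls q)"
  have q: "q \<in> carrier T \<and> cls p = cls q"
    unfolding q_def by (rule someI[of _ p]) (use p in simp)
  then have "p \<ominus>\<^bsub>T\<^esub> q \<in> I" using p cls_eq_iff by blast
  then have "act (p \<ominus>\<^bsub>T\<^esub> q) n = \<zero>\<^bsub>N\<^esub>" using n by (rule I_acts_zero)
  moreover have "p = p \<ominus>\<^bsub>T\<^esub> q \<oplus>\<^bsub>T\<^esub> q"
    using p q by (simp add: a_minus_def T.a_assoc T.l_neg)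
  then have "act p n = act (p \<ominus>\<^bsub>T\<^esub> q) n \<oplus>\<^bsub>N\<^esub> act q n"
    using p q n by (metis T.minus_closed act_add_left)
  ultimately show ?thesis using q n unfolding rec_def q_def[symmetric] by simp
qed

lemma rec_closed [simp]: "u \<in> carrier E \<Longrightarrow> n \<in> carrier N \<Longrightarrow> rec u n \<in> carrier N"
  by (auto simp: E_carrier rec_cls)

lemma rec_add: "u \<in> carrier E \<Longrightarrow> v \<in> carrier E \<Longrightarrow> n \<in> carrier N \<Longrightarrow>
    rec (u \<^bold>+ v) n = rec u n \<oplus>\<^bsub>N\<^esub> rec v n"
  by (auto simp: E_carrier rec_cls cls_add act_add_left)

lemma rec_wdg: "a \<in> carrier A \<Longrightarrow> set xs \<subseteq> carrier L \<Longrightarrow> n \<in> carrier N \<Longrightarrow>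
    rec (wdg a xs) n = G a (foldr F xs n)"
  by (simp add: wdg_cls rec_cls act_mon)

lemma rec_sc: "a \<in> carrier A \<Longrightarrow> n \<in> carrier N \<Longrightarrow> rec (sc a) n = G a n"
  by (simp add: sc_def rec_wdg)

lemma rec_sc_mult:
  assumes "a \<in> carrier A" "u \<in> carrier E" "n \<in> carrier N"
  shows "rec (sc a \<cdot> u) n = G a (rec u n)"
  using assms(2)
proof (induction rule: E_induct_wdg)
  case (wdg b xs)
  then show ?case using assms by (simp add: sc_wdg rec_wdg G_mult)
next
  case (add u v)
  then show ?case using assms by (simp add: E.r_distr rec_add G_add)
qed

text \<open>Together with \<open>rec_sc\<close> and \<open>rec_add\<close>, this is the interface
  through which actions are used from here on. The axiom \<open>F_G\<close> enters because the
  coefficient of a wedge stands to the left of its letters.\<close>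

lemma rec_gn_mult:
  assumes "x \<in> carrier L" "u \<in> carrier E" "n \<in> carrier N"
  shows "rec (gn x \<cdot> u) n = F x (rec u n)"
  using assms(2)
proof (induction rule: E_induct_wdg)
  case (wdg b xs)
  then show ?case using assms by (simp add: wdg_Cons[symmetric] rec_wdg F_G)
next
  case (add u v)
  then show ?case using assms by (simp add: E.r_distr rec_add F_add)
qed

end

section \<open>Signs and auxiliary groups\<close>

context abelian_group
begin

lemma signed_closed [simp]: "x \<in> carrier G \<Longrightarrow> signed G k x \<in> carrier G"
  by (simp add: signed_def)

lemma signed_add: "x \<in> carrier G \<Longrightarrow> y \<in> carrier G \<Longrightarrow> signed G k (x \<oplus> y) = signed G k x \<oplus> signed G k y"
  by (simp add: signed_def minus_add)

lemma signed_zero [simp]: "signed G k \<zero> = \<zero>"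
  by (simp add: signed_def)

lemma signed_signed: "x \<in> carrier G \<Longrightarrow> signed G k (signed G l x) = signed G (k + l) x"
  by (simp add: signed_def)

lemma additive_zero:
  assumes "\<And>x y. x \<in> carrier H \<Longrightarrow> y \<in> carrier H \<Longrightarrow> f (x \<oplus>\<^bsub>H\<^esub> y) = f x \<oplus> f y"
    and "\<And>x. x \<in> carrier H \<Longrightarrow> f x \<in> carrier G" and "abelian_group H"
  shows "f \<zero>\<^bsub>H\<^esub> = \<zero>"
proof -
  interpret H: abelian_group H by fact
  have "f \<zero>\<^bsub>H\<^esub> \<oplus> f \<zero>\<^bsub>H\<^esub> = f \<zero>\<^bsub>H\<^esub>"
    using assms(1)[of "\<zero>\<^bsub>H\<^esub>" "\<zero>\<^bsub>H\<^esub>"] by simp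
  then show ?thesis using assms(2)[of "\<zero>\<^bsub>H\<^esub>"] by simp
qed

lemma additive_minus:
  assumes "\<And>x y. x \<in> carrier H \<Longrightarrow> y \<in> carrier H \<Longrightarrow> f (x \<oplus>\<^bsub>H\<^esub> y) = f x \<oplus> f y"
    and "\<And>x. x \<in> carrier H \<Longrightarrow> f x \<in> carrier G" and "abelian_group H" and x: "x \<in> carrier H"
  shows "f (\<ominus>\<^bsub>H\<^esub> x) = \<ominus> f x"
proof -
  interpret H: abelian_group H by fact
  have "f (\<ominus>\<^bsub>H\<^esub> x) \<oplus> f x = f (\<ominus>\<^bsub>H\<^esub> x \<oplus>\<^bsub>H\<^esub> x)"
    using assms(1)[of "\<ominus>\<^bsub>H\<^esub> x" x] x by simp
  also have "\<dots> = \<zero>" using additive_zero[OF assms(1-3)] x by (simp add: H.l_neg)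
  finally show ?thesis using assms(2) x by (metis H.a_inv_closed minus_equality)
qed

lemma additive_finsum:
  assumes "\<And>x y. x \<in> carrier H \<Longrightarrow> y \<in> carrier H \<Longrightarrow> f (x \<oplus>\<^bsub>H\<^esub> y) = f x \<oplus> f y"
    and "\<And>x. x \<in> carrier H \<Longrightarrow> f x \<in> carrier G" and "abelian_group H"
    and "finite S" and "c \<in> S \<rightarrow> carrier H"
  shows "f (\<Oplus>\<^bsub>H\<^esub> i \<in> S. c i) = (\<Oplus> i \<in> S. f (c i))"
proof -
  interpret H: abelian_group H by fact
  show ?thesis using assms(4,5)
  proof (induction S)
    case empty
    then show ?case using additive_zero[OF assms(1-3)] by simp
  next
    case (insert i S)
    then show ?case using assms(1,2) by (simp add: Pi_def)
  qed
qed

end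

context ring
begin

lemma signed_mult_left: "x \<in> carrier R \<Longrightarrow> y \<in> carrier R \<Longrightarrow> signed R k x \<otimes> y = signed R k (x \<otimes> y)"
  by (simp add: signed_def l_minus)

lemma signed_mult_right: "x \<in> carrier R \<Longrightarrow> y \<in> carrier R \<Longrightarrow> x \<otimes> signed R k y = signed R k (x \<otimes> y)"
  by (simp add: signed_def r_minus)

end

text \<open>A ring record with undefined multiplication, because \<open>exterior_action\<close> asks
  of \<open>N\<close> only that it be an abelian group. The same holds for
  \<open>fun_group\<close>.\<close>

definition prod_group :: "('a, 'x) ring_scheme \<Rightarrow> ('b, 'y) ring_scheme \<Rightarrow> ('a \<times> 'b) ring" where
  "prod_group G H = \<lparr> carrier = carrier G \<times> carrier H, mult = undefined, one = undefined,
     zero = (\<zero>\<^bsub>G\<^esub>, \<zero>\<^bsub>H\<^esub>), add = (\<lambda>(x, y) (x', y'). (x \<oplus>\<^bsub>G\<^esub> x', y \<oplus>\<^bsub>H\<^esub> y')) \<rparr>"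

definition fun_group :: "('b, 'y) ring_scheme \<Rightarrow> ('i \<Rightarrow> 'b) ring" where
  "fun_group H = \<lparr> carrier = {f. \<forall>i. f i \<in> carrier H}, mult = undefined, one = undefined,
     zero = (\<lambda>i. \<zero>\<^bsub>H\<^esub>), add = (\<lambda>f g i. f i \<oplus>\<^bsub>H\<^esub> g i) \<rparr>"

lemma prod_group: 
  assumes "abelian_group G" "abelian_group H"
  shows "abelian_group (prod_group G H)"
proof -
  interpret G: abelian_group G by fact
  interpret H: abelian_group H by fact
  show ?thesis
  proof (rule abelian_groupI)
    show "\<exists>y\<in>carrier (prod_group G H). y \<oplus>\<^bsub>prod_group G H\<^esub> x = \<zero>\<^bsub>prod_group G H\<^esub>"
      if "x \<in> carrier (prod_group G H)" for x
      using that by (intro bexI[of _ "(\<ominus>\<^bsub>G\<^esub> fst x, \<ominus>\<^bsub>H\<^esub> snd x)"])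
        (auto simp: prod_group_def G.l_neg H.l_neg)
  qed (auto simp: prod_group_def G.a_ac H.a_ac)
qed

lemma fun_group:
  assumes "abelian_group H"
  shows "abelian_group (fun_group H)"
proof -
  interpret H: abelian_group H by fact
  show ?thesis
  proof (rule abelian_groupI)
    show "\<exists>y\<in>carrier (fun_group H). y \<oplus>\<^bsub>fun_group H\<^esub> x = \<zero>\<^bsub>fun_group H\<^esub>"
      if "x \<in> carrier (fun_group H)" for x :: "'i \<Rightarrow> _"
      using that by (intro bexI[of _ "\<lambda>i. \<ominus>\<^bsub>H\<^esub> x i"]) (auto simp: fun_group_def H.l_neg)
  qed (auto simp: fun_group_def H.a_ac)
qed

section \<open>The grading of the exterior algebra\<close>

context exterior_module
begin

abbreviation dg where "dg \<equiv> exterior_part A L"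

lemma T_minus: "p \<in> carrier T \<Longrightarrow> \<ominus>\<^bsub>T\<^esub> p = (\<lambda>w. \<ominus> p w)"
proof -
  assume p: "p \<in> carrier T"
  have "(\<ominus>\<^bsub>T\<^esub> p \<oplus>\<^bsub>T\<^esub> p) w = \<zero>" for w
    using p by (simp add: T.l_neg T_zero)
  then have "(\<ominus>\<^bsub>T\<^esub> p) w = \<ominus> p w" for w
    using p T.a_inv_closed[OF p] by (metis R.minus_equality T_add T_closed)
  then show ?thesis by auto
qed

lemma dg_iff: "u \<in> dg n \<longleftrightarrow> (\<exists>p \<in> carrier T. u = cls p \<and> (\<forall>w. p w \<noteq> \<zero> \<longrightarrow> length w = n))"
  by (auto simp: exterior_part_def)

lemma dg_closed [simp]: "u \<in> dg n \<Longrightarrow> u \<in> carrier E"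
  by (auto simp: dg_iff)

lemma wdg_dg: "a \<in> carrier A \<Longrightarrow> set xs \<subseteq> carrier L \<Longrightarrow> length xs = n \<Longrightarrow> wdg a xs \<in> dg n"
  unfolding dg_iff by (rule bexI[of _ "mon a xs"]) (simp_all add: wdg_cls, simp add: word_monomial_def)

lemma sc_dg [simp]: "a \<in> carrier A \<Longrightarrow> sc a \<in> dg 0"
  and gn_dg [simp]: "x \<in> carrier L \<Longrightarrow> gn x \<in> dg 1"
  by (auto simp: sc_def gn_def intro: wdg_dg)

lemma gn_dg_Suc_0 [simp]: "x \<in> carrier L \<Longrightarrow> gn x \<in> dg (Suc 0)"
  using gn_dg by simp

lemma dg_add [simp]: "u \<in> dg n \<Longrightarrow> v \<in> dg n \<Longrightarrow> u \<^bold>+ v \<in> dg n"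
proof -
  assume "u \<in> dg n" "v \<in> dg n"
  then obtain p q where p: "p \<in> carrier T" "u = cls p" "\<And>w. p w \<noteq> \<zero> \<Longrightarrow> length w = n"
    and q: "q \<in> carrier T" "v = cls q" "\<And>w. q w \<noteq> \<zero> \<Longrightarrow> length w = n"
    unfolding dg_iff by blast
  have "length w = n" if "(p \<oplus>\<^bsub>T\<^esub> q) w \<noteq> \<zero>" for w
    using that p(3)[of w] q(3)[of w] by (cases "p w = \<zero>"; cases "q w = \<zero>") (auto simp: T_add)
  then show ?thesis unfolding dg_iff
    by (intro bexI[of _ "p \<oplus>\<^bsub>T\<^esub> q"]) (auto simp: p q cls_add)
qed

lemma dg_zero [simp]: "\<^bold>0 \<in> dg n"
proof -
  have "\<forall>w. \<zero>\<^bsub>T\<^esub> w \<noteq> \<zero> \<longrightarrow> length w = n" by (simp add: T_zero)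
  then show ?thesis unfolding dg_iff by (intro bexI[of _ "\<zero>\<^bsub>T\<^esub>"]) (simp_all add: cls_zero)
qed

lemma dg_minus [simp]: "u \<in> dg n \<Longrightarrow> \<ominus>\<^bsub>E\<^esub> u \<in> dg n"
proof -
  assume "u \<in> dg n"
  then obtain p where p: "p \<in> carrier T" "u = cls p" "\<And>w. p w \<noteq> \<zero> \<Longrightarrow> length w = n"
    unfolding dg_iff by blast
  have "cls (\<ominus>\<^bsub>T\<^esub> p) \<^bold>+ cls p = \<^bold>0"
    using p by (simp add: cls_add T.l_neg cls_zero)
  then have "\<ominus>\<^bsub>E\<^esub> u = cls (\<ominus>\<^bsub>T\<^esub> p)"
    using p by (simp add: E.minus_equality)
  then show ?thesis unfolding dg_iff
  proof (intro bexI[of _ "\<ominus>\<^bsub>T\<^esub> p"] conjI allI impI)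
    show "length w = n" if "(\<ominus>\<^bsub>T\<^esub> p) w \<noteq> \<zero>" for w
      using that p(1) p(3)[of w] by (cases "p w = \<zero>") (auto simp: T_minus)
  qed (use p in auto)
qed

lemma dg_signed [simp]: "u \<in> dg n \<Longrightarrow> signed E k u \<in> dg n"
  by (simp add: signed_def)

text \<open>Takes place inside one degree: a homogeneous element has a representative supported on
  words of length \<open>n\<close>, and \<open>T_induct_support\<close> meets no other
  words.\<close>

lemma dg_induct_wdg [consumes 1, case_names wdg add zero]:
  assumes u: "u \<in> dg n"
    and wdg: "\<And>a xs. a \<in> carrier A \<Longrightarrow> set xs \<subseteq> carrier L \<Longrightarrow> length xs = n \<Longrightarrow> P (wdg a xs)"
    and add: "\<And>u v. u \<in> dg n \<Longrightarrow> v \<in> dg n \<Longrightarrow> P u \<Longrightarrow> P v \<Longrightarrow> P (u \<^bold>+ v)"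
    and zero: "P \<^bold>0"
  shows "P u"
proof -
  note P_zero = zero
  obtain p where p: "p \<in> carrier T" "u = cls p" "\<And>w. p w \<noteq> \<zero> \<Longrightarrow> length w = n"
    using u unfolding dg_iff by blast
  have "finite {w. p w \<noteq> \<zero>}" using p by (simp add: T_carrier)
  \<comment> \<open>Membership in \<open>dg n\<close> is carried along because the hypothesis
    \<open>add\<close> asks for it.\<close>
  have "P (cls p) \<and> cls p \<in> dg n" using p(1) \<open>finite {w. p w \<noteq> \<zero>}\<close> subset_refl
  proof (induction rule: T_induct_support)
    case zero
    show ?case using P_zero by (simp add: cls_zero)
  next
    case (mon a xs)
    then show ?case using wdg[of a xs] p(3)[of xs] wdg_dg[of a xs n] by (simp add: wdg_cls)
  next
    case (add p q)
    have "P (cls p \<^bold>+ cls q) \<and> cls p \<^bold>+ cls q \<in> dg n"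
      by (intro conjI assms(3) dg_add) (use add in simp_all)
    then show ?case using add by (simp add: cls_add)
  qed
  then show ?thesis by (simp add: p)
qed

lemma dg_mult [simp]:
  assumes u: "u \<in> dg n" and v: "v \<in> dg m" 
  shows "u \<cdot> v \<in> dg (n + m)"
  using u
proof (induction rule: dg_induct_wdg)
  case (wdg a xs)
  show ?case using v
  proof (induction rule: dg_induct_wdg)
    case (wdg b ys)
    then show ?case
      using \<open>a \<in> carrier A\<close> \<open>set xs \<subseteq> carrier L\<close> \<open>length xs = n\<close>
      by (simp add: wdg_mult wdg_dg)
  qed (use wdg in \<open>simp_all add: E.r_distr\<close>)
qed (use v in \<open>simp_all add: E.l_distr\<close>)

lemma dg_sc_mult [simp]: "a \<in> carrier A \<Longrightarrow> v \<in> dg n \<Longrightarrow> sc a \<cdot> v \<in> dg n"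
  using dg_mult[of "sc a" 0 v n] by simp

lemma dg_gn_mult [simp]: "x \<in> carrier L \<Longrightarrow> v \<in> dg n \<Longrightarrow> gn x \<cdot> v \<in> dg (Suc n)"
  using dg_mult[of "gn x" 1 v n] gn_dg[of x] by simp

lemma dg_induct [consumes 1, case_names sc gn add zero]:
  assumes u: "u \<in> dg n"
    and sc: "\<And>a. a \<in> carrier A \<Longrightarrow> P 0 (sc a)"
    and gn: "\<And>n x v. x \<in> carrier L \<Longrightarrow> v \<in> dg n \<Longrightarrow> P n v \<Longrightarrow> P (Suc n) (gn x \<cdot> v)"
    and add: "\<And>n u v. u \<in> dg n \<Longrightarrow> v \<in> dg n \<Longrightarrow> P n u \<Longrightarrow> P n v \<Longrightarrow> P n (u \<^bold>+ v)"
    and zero: "\<And>n. P n \<^bold>0"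
  shows "P n u"
  using u
proof (induction rule: dg_induct_wdg)
  case (wdg a xs)
  then show ?case
  proof (induction xs arbitrary: n)
    case Nil
    then show ?case using sc by (simp add: sc_def)
  next
    case (Cons x xs)
    then show ?case using gn[of x "wdg a xs" "length xs"] by (auto simp: wdg_Cons wdg_dg)
  qed
qed (use add zero in auto)

lemma sc_in_dg_0: "u \<in> dg 0 \<Longrightarrow> \<exists>a \<in> carrier A. u = sc a"
proof (induction rule: dg_induct_wdg)
  case (wdg a xs)
  then show ?case by (auto simp: sc_def)
next
  case (add u v)
  then show ?case by (metis R.a_closed sc_add)
next
  case zero
  show ?case by (rule bexI[of _ \<zero>]) (simp_all add: sc_zero)
qed

text \<open>A wedge \<open>a [x]\<close> of length one equals \<open>gn (a x)\<close>, so sums of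
  such wedges are again single generators. With \<open>sc_in_dg_0\<close> this turns conditions on
  degrees 0 and 1 into conditions on \<open>A\<close> and \<open>L\<close>.\<close>

lemma gn_in_dg_1: "u \<in> dg 1 \<Longrightarrow> \<exists>x \<in> carrier L. u = gn x"
proof (induction rule: dg_induct_wdg)
  case (wdg a xs)
  then obtain x where "xs = [x]" by (auto simp: length_Suc_conv)
  then show ?case using wdg
    by (intro bexI[of _ "a \<odot>\<^bsub>L\<^esub> x"]) (simp_all add: gn_smult, simp add: gn_def sc_wdg)
next
  case (add u v)
  then show ?case by (metis M.a_closed gn_add)
next
  case zero
  have "gn (\<zero> \<odot>\<^bsub>L\<^esub> \<zero>\<^bsub>L\<^esub>) = \<^bold>0"
    by (subst gn_smult) (simp_all add: sc_zero)
  then show ?case by (intro bexI[of _ "\<zero>\<^bsub>L\<^esub>"]) auto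
qed

lemma gn_zero [simp]: "gn \<zero>\<^bsub>L\<^esub> = \<^bold>0"
  using gn_smult[of \<zero> "\<zero>\<^bsub>L\<^esub>"] by (simp add: sc_zero)

text \<open>The homogeneous components are the values of the action in which a generator multiplies and
  shifts degrees by one.\<close>

definition shift_gn :: "'l \<Rightarrow> (nat \<Rightarrow> ('l list \<Rightarrow> 'a) set) \<Rightarrow> nat \<Rightarrow> ('l list \<Rightarrow> 'a) set" where
  "shift_gn x f = (\<lambda>k. case k of 0 \<Rightarrow> \<^bold>0 | Suc i \<Rightarrow> gn x \<cdot> f i)"

lemma grading_action: "exterior_action A L (fun_group E) (\<lambda>a f k. sc a \<cdot> f k) shift_gn"
proof -
  interpret N: abelian_group "fun_group E :: (nat \<Rightarrow> _) ring"
    by (rule fun_group) (rule E.is_abelian_group)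
  have gg: "gn x \<cdot> (gn x \<cdot> u) = \<^bold>0" if "x \<in> carrier L" "u \<in> carrier E" for x u
    using that by (simp add: E.m_assoc[symmetric] gn_square)
  show ?thesis
    by (intro exterior_action.intro exterior_action_axioms.intro exterior_module_axioms N.abelian_group_axioms)
      (simp_all add: fun_group_def shift_gn_def fun_eq_iff sc_add sc_mult sc_one gn_add gn_smult
        E.l_distr E.r_distr E.m_assoc gn_sc gg split: nat.split)
qed

text \<open>The start vector is 1 in position 0. A word of length \<open>n\<close> moves it to
  position \<open>n\<close>, where the word itself appears.\<close>

definition proj :: "nat \<Rightarrow> ('l list \<Rightarrow> 'a) set \<Rightarrow> ('l list \<Rightarrow> 'a) set" where
  "proj k u = exterior_action.rec A L (fun_group E) (\<lambda>a f k. sc a \<cdot> f k) shift_gn u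
     (\<lambda>k. if k = 0 then \<one>\<^bsub>E\<^esub> else \<^bold>0) k"

lemma proj_facts:
  shows proj_closed [simp]: "u \<in> carrier E \<Longrightarrow> proj k u \<in> carrier E"
    and proj_add: "u \<in> carrier E \<Longrightarrow> v \<in> carrier E \<Longrightarrow> proj k (u \<^bold>+ v) = proj k u \<^bold>+ proj k v"
    and proj_sc: "a \<in> carrier A \<Longrightarrow> proj k (sc a) = (if k = 0 then sc a else \<^bold>0)"
    and proj_gn: "x \<in> carrier L \<Longrightarrow> u \<in> carrier E \<Longrightarrow>
      proj k (gn x \<cdot> u) = (case k of 0 \<Rightarrow> \<^bold>0 | Suc i \<Rightarrow> gn x \<cdot> proj i u)"
proof -
  interpret P: exterior_action A L "fun_group E" "\<lambda>a f k. sc a \<cdot> f k" shift_gn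
    by (rule grading_action)
  have n: "(\<lambda>k. if k = (0::nat) then \<one>\<^bsub>E\<^esub> else \<^bold>0) \<in> carrier (fun_group E)"
    by (simp add: fun_group_def)
  show "u \<in> carrier E \<Longrightarrow> proj k u \<in> carrier E"
    using P.rec_closed[OF _ n, of u] by (simp add: proj_def fun_group_def)
  show "u \<in> carrier E \<Longrightarrow> v \<in> carrier E \<Longrightarrow> proj k (u \<^bold>+ v) = proj k u \<^bold>+ proj k v"
    using P.rec_add[OF _ _ n, of u v] by (simp add: proj_def fun_group_def)
  show "a \<in> carrier A \<Longrightarrow> proj k (sc a) = (if k = 0 then sc a else \<^bold>0)"
    using P.rec_sc[OF _ n, of a] by (simp add: proj_def)
  show "x \<in> carrier L \<Longrightarrow> u \<in> carrier E \<Longrightarrow>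
      proj k (gn x \<cdot> u) = (case k of 0 \<Rightarrow> \<^bold>0 | Suc i \<Rightarrow> gn x \<cdot> proj i u)"
    using P.rec_gn_mult[OF _ _ n, of x u] by (simp add: proj_def shift_gn_def split: nat.splits)
qed

lemma proj_zero [simp]: "proj k \<^bold>0 = \<^bold>0"
  using proj_sc[of \<zero> k] by (simp add: sc_zero split: if_splits)

lemma proj_dg: "u \<in> dg n \<Longrightarrow> proj k u = (if k = n then u else \<^bold>0)"
proof (induction arbitrary: k rule: dg_induct)
  case (gn n x v)
  then show ?case by (auto simp: proj_gn split: nat.splits)
qed (auto simp: proj_sc proj_add)

lemma proj_in_dg: "u \<in> carrier E \<Longrightarrow> proj k u \<in> dg k"
proof (induction arbitrary: k rule: E_induct)
  case (gn x v)
  then show ?case by (auto simp: proj_gn split: nat.splits)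
qed (auto simp: proj_sc proj_add)

text \<open>The vanishing of the components above \<open>n\<close> is part of the claim, so that two
  sums can be padded to a common length when elements are added.\<close>

lemma proj_sum:
  assumes "u \<in> carrier E"
  shows "\<exists>n. (\<forall>m > n. proj m u = \<^bold>0) \<and> u = (\<Oplus>\<^bsub>E\<^esub> i \<in> {..n}. proj i u)"
proof -
  have ext: "(\<Oplus>\<^bsub>E\<^esub> i \<in> {..n}. proj i u) = (\<Oplus>\<^bsub>E\<^esub> i \<in> {..N}. proj i u)"
    if "\<forall>m > n. proj m u = \<^bold>0" "n \<le> N" "u \<in> carrier E" for n N u
    by (rule E.add.finprod_mono_neutral_cong_left) (use that in auto)
  show ?thesis using assms
  proof (induction rule: E_induct_wdg)
    case (wdg a xs)
    let ?n = "length xs"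
    have p: "proj i (wdg a xs) = (if i = ?n then wdg a xs else \<^bold>0)" for i
      using wdg by (intro proj_dg) (simp add: wdg_dg)
    have "(\<Oplus>\<^bsub>E\<^esub> i \<in> {..?n}. proj i (wdg a xs)) = (\<Oplus>\<^bsub>E\<^esub> i \<in> {..?n}. if ?n = i then wdg a xs else \<^bold>0)"
      by (rule E.finsum_cong') (use wdg in \<open>auto simp: p\<close>)
    also have "\<dots> = wdg a xs" by (rule E.finsum_singleton) (use wdg in auto)
    finally show ?case by (intro exI[of _ ?n]) (auto simp: p)
  next
    case (add u v)
    then obtain n m where n: "\<forall>k > n. proj k u = \<^bold>0" "u = (\<Oplus>\<^bsub>E\<^esub> i \<in> {..n}. proj i u)"
      and m: "\<forall>k > m. proj k v = \<^bold>0" "v = (\<Oplus>\<^bsub>E\<^esub> i \<in> {..m}. proj i v)" by blast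
    let ?N = "max n m"
    have "(\<Oplus>\<^bsub>E\<^esub> i \<in> {..?N}. proj i (u \<^bold>+ v)) = (\<Oplus>\<^bsub>E\<^esub> i \<in> {..?N}. proj i u \<^bold>+ proj i v)"
      by (rule E.finsum_cong') (use add in \<open>auto simp: proj_add\<close>)
    also have "\<dots> = (\<Oplus>\<^bsub>E\<^esub> i \<in> {..?N}. proj i u) \<^bold>+ (\<Oplus>\<^bsub>E\<^esub> i \<in> {..?N}. proj i v)"
      by (rule E.finsum_addf) (use add in auto)
    also have "\<dots> = u \<^bold>+ v"
      using ext[OF n(1), of ?N] ext[OF m(1), of ?N] n(2) m(2) add by simp
    finally show ?case
      by (intro exI[of _ ?N]) (use n m add in \<open>auto simp: proj_add\<close>)
  qed
qed

text \<open>The components \<open>proj i u\<close> give existence. Applying \<open>proj k\<close> to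
  any other decomposition returns its \<open>k\<close>-th term, which gives uniqueness.\<close>

lemma decomposition:
  assumes u: "u \<in> carrier E"
  shows "\<exists>!c. (\<forall>i. c i \<in> dg i) \<and> finite {i. c i \<noteq> \<^bold>0} \<and>
    u = (\<Oplus>\<^bsub>E\<^esub> i \<in> {i. c i \<noteq> \<^bold>0}. c i)"
proof (rule ex1I)
  obtain n where n: "\<forall>m > n. proj m u = \<^bold>0" "u = (\<Oplus>\<^bsub>E\<^esub> i \<in> {..n}. proj i u)"
    using proj_sum[OF u] by blast
  have sub: "{i. proj i u \<noteq> \<^bold>0} \<subseteq> {..n}" using n(1) not_le by auto
  have "(\<Oplus>\<^bsub>E\<^esub> i \<in> {i. proj i u \<noteq> \<^bold>0}. proj i u) = (\<Oplus>\<^bsub>E\<^esub> i \<in> {..n}. proj i u)"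
    by (rule E.add.finprod_mono_neutral_cong_left) (use sub u in auto)
  then show "(\<forall>i. proj i u \<in> dg i) \<and> finite {i. proj i u \<noteq> \<^bold>0} \<and>
      u = (\<Oplus>\<^bsub>E\<^esub> i \<in> {i. proj i u \<noteq> \<^bold>0}. proj i u)"
    using n(2) u finite_subset[OF sub] by (simp add: proj_in_dg)
next
  fix c assume c: "(\<forall>i. c i \<in> dg i) \<and> finite {i. c i \<noteq> \<^bold>0} \<and>
    u = (\<Oplus>\<^bsub>E\<^esub> i \<in> {i. c i \<noteq> \<^bold>0}. c i)"
  let ?S = "{i. c i \<noteq> \<^bold>0}"
  have cc: "c i \<in> carrier E" for i using c dg_closed by blast
  show "c = (\<lambda>i. proj i u)"
  proof
    fix k
    have "proj k u = proj k (\<Oplus>\<^bsub>E\<^esub> i \<in> ?S. c i)" using c by simp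
    also have "\<dots> = (\<Oplus>\<^bsub>E\<^esub> i \<in> ?S. proj k (c i))"
      by (rule E.additive_finsum) (use c cc proj_add E.is_abelian_group in auto)
    also have "\<dots> = (\<Oplus>\<^bsub>E\<^esub> i \<in> ?S. if k = i then c i else \<^bold>0)"
      by (rule E.finsum_cong') (use c cc in \<open>auto simp: proj_dg\<close>)
    also have "\<dots> = c k"
    proof (cases "k \<in> ?S")
      case True
      then show ?thesis using c cc by (intro E.finsum_singleton) auto
    next
      case False
      then have "(\<Oplus>\<^bsub>E\<^esub> i \<in> ?S. if k = i then c i else \<^bold>0) = (\<Oplus>\<^bsub>E\<^esub> i \<in> ?S. \<^bold>0)"
        by (intro E.finsum_cong') auto
      then show ?thesis using False by simp
    qed
    finally show "c k = proj k u" by simp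
  qed
qed

lemma gn_dg_comm:
  assumes x: "x \<in> carrier L" and v: "v \<in> dg n"
  shows "gn x \<cdot> v = signed E (int n) (v \<cdot> gn x)"
  using v
proof (induction rule: dg_induct)
  case (sc a)
  then show ?case using x by (simp add: sc_central signed_def)
next
  case (gn n y v)
  have "gn x \<cdot> (gn y \<cdot> v) = \<ominus>\<^bsub>E\<^esub> (gn y \<cdot> (gn x \<cdot> v))"
    using x gn(1,2) gn_anticomm[of x y] by (simp add: E.m_assoc[symmetric] E.l_minus)
  also have "gn x \<cdot> v = signed E (int n) (v \<cdot> gn x)" by (rule gn)
  finally show ?case using x gn by (simp add: signed_def E.r_minus E.m_assoc)
next
  case (add n u v)
  then show ?case using x by (simp add: E.r_distr E.l_distr E.signed_add)
qed (use x in simp)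

lemma dg_comm:
  assumes u: "u \<in> dg n" and v: "v \<in> dg m"
  shows "u \<cdot> v = signed E (int n * int m) (v \<cdot> u)"
  using u
proof (induction rule: dg_induct)
  case (sc a)
  then show ?case using v by (simp add: sc_central signed_def)
next
  case (gn n x u)
  have "gn x \<cdot> u \<cdot> v = gn x \<cdot> signed E (int n * int m) (v \<cdot> u)"
    using gn v by (simp add: E.m_assoc)
  also have "\<dots> = signed E (int n * int m) (gn x \<cdot> v \<cdot> u)"
    using gn v by (simp add: E.signed_mult_right E.m_assoc)
  also have "gn x \<cdot> v = signed E (int m) (v \<cdot> gn x)"
    using gn v by (simp add: gn_dg_comm)
  finally show ?case
    using gn v by (simp add: E.signed_mult_left E.signed_signed E.m_assoc algebra_simps)
next
  case (add n u w)
  then show ?case using v by (simp add: E.r_distr E.l_distr E.signed_add)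
qed (use v in simp)

text \<open>Graded commutativity yields only \<open>2 u u = 0\<close>. In the square of a word the
  two copies of its first letter can be brought together, where they vanish; in the square of a sum
  the mixed terms cancel, because odd elements anticommute.\<close>

lemma dg_odd_square:
  assumes "u \<in> dg n" "odd n"
  shows "u \<cdot> u = \<^bold>0"
  using assms(1)
proof (induction rule: dg_induct_wdg)
  case (wdg a xs)
  then obtain x ys where xs: "xs = x # ys" using assms(2) by (cases xs) auto
  let ?v = "wdg a ys"
  have v: "?v \<in> dg (length ys)" "x \<in> carrier L" using wdg xs by (auto intro: wdg_dg)
  have "wdg a xs \<cdot> wdg a xs = gn x \<cdot> (?v \<cdot> gn x) \<cdot> ?v"
    using wdg xs by (simp add: wdg_Cons E.m_assoc)
  also have "?v \<cdot> gn x = signed E (int (length ys)) (gn x \<cdot> ?v)"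
    using dg_comm[OF v(1) gn_dg[OF v(2)]] by simp
  also have "gn x \<cdot> signed E (int (length ys)) (gn x \<cdot> ?v) = \<^bold>0"
    using v by (simp add: E.signed_mult_right E.m_assoc[symmetric] gn_square)
  finally show ?case using v by simp
next
  case (add u v)
  have "v \<cdot> u = \<ominus>\<^bsub>E\<^esub> (u \<cdot> v)"
    using dg_comm[of v n u n] add assms(2) by (simp add: signed_def)
  then show ?case using add by (simp add: E.l_distr E.r_distr E.l_neg E.a_assoc)
qed simp

end

section \<open>Ring homomorphisms out of the exterior algebra\<close>

text \<open>The universal property for a target that need not be commutative: images of scalars have
  to commute with images of \<open>L\<close> only. The targets below are exterior algebras and
  graded commutative rings.\<close>

locale exterior_lift = exterior_module A L + S: ring S
  for A :: "('r, 'a) module" (structure) and L :: "('a, 'l) module" (structure) and S (structure) +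
  fixes g :: "'a \<Rightarrow> 's" and f :: "'l \<Rightarrow> 's"
  assumes g_closed [simp]: "a \<in> carrier A \<Longrightarrow> g a \<in> carrier S"
    and g_add: "a \<in> carrier A \<Longrightarrow> b \<in> carrier A \<Longrightarrow> g (a \<oplus> b) = g a \<oplus>\<^bsub>S\<^esub> g b"
    and g_mult: "a \<in> carrier A \<Longrightarrow> b \<in> carrier A \<Longrightarrow> g (a \<otimes> b) = g a \<otimes>\<^bsub>S\<^esub> g b"
    and g_one: "g \<one> = \<one>\<^bsub>S\<^esub>"
    and f_closed [simp]: "x \<in> carrier L \<Longrightarrow> f x \<in> carrier S"
    and f_add: "x \<in> carrier L \<Longrightarrow> y \<in> carrier L \<Longrightarrow> f (x \<oplus>\<^bsub>L\<^esub> y) = f x \<oplus>\<^bsub>S\<^esub> f y"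
    and f_smult: "a \<in> carrier A \<Longrightarrow> x \<in> carrier L \<Longrightarrow> f (a \<odot>\<^bsub>L\<^esub> x) = g a \<otimes>\<^bsub>S\<^esub> f x"
    and f_g_comm: "a \<in> carrier A \<Longrightarrow> x \<in> carrier L \<Longrightarrow> f x \<otimes>\<^bsub>S\<^esub> g a = g a \<otimes>\<^bsub>S\<^esub> f x"
    and f_square: "x \<in> carrier L \<Longrightarrow> f x \<otimes>\<^bsub>S\<^esub> f x = \<zero>\<^bsub>S\<^esub>"
begin

lemma lift_action: "exterior_action A L S (\<lambda>a n. g a \<otimes>\<^bsub>S\<^esub> n) (\<lambda>x n. f x \<otimes>\<^bsub>S\<^esub> n)"
proof -
  have ff: "f x \<otimes>\<^bsub>S\<^esub> (f x \<otimes>\<^bsub>S\<^esub> n) = \<zero>\<^bsub>S\<^esub>" if "x \<in> carrier L" "n \<in> carrier S" for x n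
    using that by (simp add: S.m_assoc[symmetric] f_square)
  have fg: "f x \<otimes>\<^bsub>S\<^esub> (g a \<otimes>\<^bsub>S\<^esub> n) = g a \<otimes>\<^bsub>S\<^esub> (f x \<otimes>\<^bsub>S\<^esub> n)"
    if "x \<in> carrier L" "a \<in> carrier A" "n \<in> carrier S" for x n a
    using that by (simp add: S.m_assoc[symmetric] f_g_comm)
  show ?thesis
    by (intro exterior_action.intro exterior_action_axioms.intro exterior_module_axioms
        S.abelian_group_axioms)
      (simp_all add: g_add g_mult g_one f_add f_smult S.l_distr S.r_distr S.m_assoc ff fg)
qed

sublocale act: exterior_action A L S "\<lambda>a n. g a \<otimes>\<^bsub>S\<^esub> n" "\<lambda>x n. f x \<otimes>\<^bsub>S\<^esub> n"
  by (rule lift_action)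

definition lift :: "('l list \<Rightarrow> 'a) set \<Rightarrow> 's" where "lift u = act.rec u \<one>\<^bsub>S\<^esub>"

lemma lift_closed [simp]: "u \<in> carrier E \<Longrightarrow> lift u \<in> carrier S"
  by (simp add: lift_def)

lemma lift_add: "u \<in> carrier E \<Longrightarrow> v \<in> carrier E \<Longrightarrow> lift (u \<^bold>+ v) = lift u \<oplus>\<^bsub>S\<^esub> lift v"
  by (simp add: lift_def act.rec_add)

lemma lift_sc: "a \<in> carrier A \<Longrightarrow> lift (sc a) = g a"
  by (simp add: lift_def act.rec_sc)

lemma lift_gn_mult: "x \<in> carrier L \<Longrightarrow> u \<in> carrier E \<Longrightarrow> lift (gn x \<cdot> u) = f x \<otimes>\<^bsub>S\<^esub> lift u"
  by (simp add: lift_def act.rec_gn_mult)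

lemma lift_sc_mult: "a \<in> carrier A \<Longrightarrow> u \<in> carrier E \<Longrightarrow> lift (sc a \<cdot> u) = g a \<otimes>\<^bsub>S\<^esub> lift u"
  by (simp add: lift_def act.rec_sc_mult)

lemma lift_one: "lift \<one>\<^bsub>E\<^esub> = \<one>\<^bsub>S\<^esub>"
  using lift_sc[of \<one>] by (simp add: sc_one g_one)

lemma lift_gn: "x \<in> carrier L \<Longrightarrow> lift (gn x) = f x"
  using lift_gn_mult[of x "\<one>\<^bsub>E\<^esub>"] by (simp add: lift_one)

lemma lift_mult:
  assumes "u \<in> carrier E" "v \<in> carrier E"
  shows "lift (u \<cdot> v) = lift u \<otimes>\<^bsub>S\<^esub> lift v"
  using assms(1)
proof (induction rule: E_induct)
  case (sc a)
  then show ?case using assms by (simp add: lift_sc_mult lift_sc)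
next
  case (gn x u)
  then show ?case using assms by (simp add: E.m_assoc lift_gn_mult S.m_assoc)
next
  case (add u w)
  then show ?case using assms by (simp add: E.l_distr S.l_distr lift_add)
qed

lemma lift_zero: "lift \<^bold>0 = \<zero>\<^bsub>S\<^esub>"
  by (rule S.additive_zero[OF lift_add lift_closed E.is_abelian_group])

lemma lift_wdg_Cons: "a \<in> carrier A \<Longrightarrow> x \<in> carrier L \<Longrightarrow> set xs \<subseteq> carrier L \<Longrightarrow>
    lift (wdg a (x # xs)) = f x \<otimes>\<^bsub>S\<^esub> lift (wdg a xs)"
  by (simp add: wdg_Cons lift_gn_mult)

end

section \<open>The bracket of a hom-Lie-Rinehart algebra on its exterior algebra\<close>

text \<open>The axioms of a hom-Lie-Rinehart algebra, element by element. The ground ring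
  \<open>R\<close> is kept out until \<open>hlr_over\<close>, since the bracket can be built over
  \<open>A\<close> with additive maps alone.\<close>

locale hlr = exterior_module A L
  for A :: "('r, 'a) module" (structure) and L :: "('a, 'l) module" (structure) +
  fixes br :: "'l \<Rightarrow> 'l \<Rightarrow> 'l" and \<phi> :: "'a \<Rightarrow> 'a" and \<alpha> :: "'l \<Rightarrow> 'l" and \<rho> :: "'l \<Rightarrow> 'a \<Rightarrow> 'a"
  assumes phi_closed [simp]: "a \<in> carrier A \<Longrightarrow> \<phi> a \<in> carrier A"
    and phi_add: "a \<in> carrier A \<Longrightarrow> b \<in> carrier A \<Longrightarrow> \<phi> (a \<oplus> b) = \<phi> a \<oplus> \<phi> b"
    and phi_mult: "a \<in> carrier A \<Longrightarrow> b \<in> carrier A \<Longrightarrow> \<phi> (a \<otimes> b) = \<phi> a \<otimes> \<phi> b"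
    and phi_one: "\<phi> \<one> = \<one>"
    and rho_closed [simp]: "x \<in> carrier L \<Longrightarrow> a \<in> carrier A \<Longrightarrow> \<rho> x a \<in> carrier A"
    and rho_add_right: "x \<in> carrier L \<Longrightarrow> a \<in> carrier A \<Longrightarrow> b \<in> carrier A \<Longrightarrow> \<rho> x (a \<oplus> b) = \<rho> x a \<oplus> \<rho> x b"
    and rho_mult: "x \<in> carrier L \<Longrightarrow> a \<in> carrier A \<Longrightarrow> b \<in> carrier A \<Longrightarrow>
      \<rho> x (a \<otimes> b) = \<phi> a \<otimes> \<rho> x b \<oplus> \<phi> b \<otimes> \<rho> x a"
    and rho_add_left: "x \<in> carrier L \<Longrightarrow> y \<in> carrier L \<Longrightarrow> a \<in> carrier A \<Longrightarrow> \<rho> (x \<oplus>\<^bsub>L\<^esub> y) a = \<rho> x a \<oplus> \<rho> y a"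
    and rho_smult: "x \<in> carrier L \<Longrightarrow> a \<in> carrier A \<Longrightarrow> b \<in> carrier A \<Longrightarrow> \<rho> (a \<odot>\<^bsub>L\<^esub> x) b = \<phi> a \<otimes> \<rho> x b"
    and br_closed [simp]: "x \<in> carrier L \<Longrightarrow> y \<in> carrier L \<Longrightarrow> br x y \<in> carrier L"
    and br_add_right: "x \<in> carrier L \<Longrightarrow> y \<in> carrier L \<Longrightarrow> z \<in> carrier L \<Longrightarrow> br x (y \<oplus>\<^bsub>L\<^esub> z) = br x y \<oplus>\<^bsub>L\<^esub> br x z"
    and br_skew: "x \<in> carrier L \<Longrightarrow> y \<in> carrier L \<Longrightarrow> br x y = \<ominus>\<^bsub>L\<^esub> br y x"
    and alpha_closed [simp]: "x \<in> carrier L \<Longrightarrow> \<alpha> x \<in> carrier L"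
    and alpha_add: "x \<in> carrier L \<Longrightarrow> y \<in> carrier L \<Longrightarrow> \<alpha> (x \<oplus>\<^bsub>L\<^esub> y) = \<alpha> x \<oplus>\<^bsub>L\<^esub> \<alpha> y"
    and alpha_smult: "a \<in> carrier A \<Longrightarrow> x \<in> carrier L \<Longrightarrow> \<alpha> (a \<odot>\<^bsub>L\<^esub> x) = \<phi> a \<odot>\<^bsub>L\<^esub> \<alpha> x"
    and br_leibniz: "x \<in> carrier L \<Longrightarrow> y \<in> carrier L \<Longrightarrow> a \<in> carrier A \<Longrightarrow>
      br x (a \<odot>\<^bsub>L\<^esub> y) = \<phi> a \<odot>\<^bsub>L\<^esub> br x y \<oplus>\<^bsub>L\<^esub> \<rho> x a \<odot>\<^bsub>L\<^esub> \<alpha> y"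
    and alpha_br: "x \<in> carrier L \<Longrightarrow> y \<in> carrier L \<Longrightarrow> \<alpha> (br x y) = br (\<alpha> x) (\<alpha> y)"
    and rho_alpha: "x \<in> carrier L \<Longrightarrow> a \<in> carrier A \<Longrightarrow> \<rho> (\<alpha> x) (\<phi> a) = \<phi> (\<rho> x a)"
    and rho_br: "x \<in> carrier L \<Longrightarrow> y \<in> carrier L \<Longrightarrow> a \<in> carrier A \<Longrightarrow>
      \<rho> (br x y) (\<phi> a) = \<rho> (\<alpha> x) (\<rho> y a) \<ominus> \<rho> (\<alpha> y) (\<rho> x a)"
    and hom_jacobi: "x \<in> carrier L \<Longrightarrow> y \<in> carrier L \<Longrightarrow> z \<in> carrier L \<Longrightarrow>
      br (\<alpha> x) (br y z) \<oplus>\<^bsub>L\<^esub> br (\<alpha> y) (br z x) \<oplus>\<^bsub>L\<^esub> br (\<alpha> z) (br x y) = \<zero>\<^bsub>L\<^esub>"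
begin

sublocale tw: exterior_lift A L E "\<lambda>a. sc (\<phi> a)" "\<lambda>x. gn (\<alpha> x)"
  by (unfold_locales)
    (simp_all add: phi_add phi_mult phi_one sc_add sc_mult sc_one alpha_add alpha_smult gn_add gn_smult
      gn_sc_comm gn_square)

abbreviation tw where "tw \<equiv> tw.lift"

lemma gn_minus: "x \<in> carrier L \<Longrightarrow> gn (\<ominus>\<^bsub>L\<^esub> x) = \<ominus>\<^bsub>E\<^esub> gn x"
  by (rule E.additive_minus[OF gn_add gn_closed M.abelian_group_axioms])

lemma sc_minus: "a \<in> carrier A \<Longrightarrow> sc (\<ominus> a) = \<ominus>\<^bsub>E\<^esub> sc a"
  by (rule E.additive_minus[OF sc_add sc_closed R.abelian_group_axioms])

lemma br_add_left: "x \<in> carrier L \<Longrightarrow> y \<in> carrier L \<Longrightarrow> z \<in> carrier L \<Longrightarrow> br (x \<oplus>\<^bsub>L\<^esub> y) z = br x z \<oplus>\<^bsub>L\<^esub> br y z"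
  using br_skew[of "x \<oplus>\<^bsub>L\<^esub> y" z] br_skew[of x z] br_skew[of y z]
  by (simp add: br_add_right M.minus_add)

text \<open>The right Leibniz rule seen through skew-symmetry. The second term is what makes
  \<open>[x, -]\<close> fail to be semilinear in \<open>x\<close>; it will reappear as
  \<open>gn (\<alpha> x) \<cdot> [a, y]\<close>, with
  \<open>[a, y] = - \<rho>(y)(a)\<close>.\<close>

lemma br_smult_left: 
  assumes "x \<in> carrier L" "y \<in> carrier L" "a \<in> carrier A"
  shows "gn (br (a \<odot>\<^bsub>L\<^esub> x) y) = sc (\<phi> a) \<cdot> gn (br x y) \<ominus>\<^bsub>E\<^esub> sc (\<rho> y a) \<cdot> gn (\<alpha> x)"
proof -
  have "br (a \<odot>\<^bsub>L\<^esub> x) y = \<ominus>\<^bsub>L\<^esub> (\<phi> a \<odot>\<^bsub>L\<^esub> br y x \<oplus>\<^bsub>L\<^esub> \<rho> y a \<odot>\<^bsub>L\<^esub> \<alpha> x)"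
    using assms br_skew[of "a \<odot>\<^bsub>L\<^esub> x" y] by (simp add: br_leibniz)
  moreover have "gn (br x y) = \<ominus>\<^bsub>E\<^esub> gn (br y x)"
    using assms br_skew[of x y] by (simp add: gn_minus)
  ultimately show ?thesis using assms
    by (simp add: gn_minus gn_add gn_smult E.minus_add E.r_minus a_minus_def)
qed

text \<open>\<open>k\<close> is the degree of \<open>D\<close>, of which only the parity matters.
  The Leibniz rule is required for a generator on the left; with additivity and the values on
  scalars this already determines \<open>D\<close>.\<close>

definition twisted_derivation ::
  "int \<Rightarrow> ('a \<Rightarrow> ('l list \<Rightarrow> 'a) set) \<Rightarrow> ('l \<Rightarrow> ('l list \<Rightarrow> 'a) set) \<Rightarrow>
   (('l list \<Rightarrow> 'a) set \<Rightarrow> ('l list \<Rightarrow> 'a) set) \<Rightarrow> bool" where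
  "twisted_derivation k D0 D1 D \<longleftrightarrow>
    (\<forall>v. D v \<in> carrier E) \<and> (\<forall>v. v \<notin> carrier E \<longrightarrow> D v = \<^bold>0) \<and>
    (\<forall>u \<in> carrier E. \<forall>v \<in> carrier E. D (u \<^bold>+ v) = D u \<^bold>+ D v) \<and>
    (\<forall>a \<in> carrier A. D (sc a) = D0 a) \<and>
    (\<forall>x \<in> carrier L. \<forall>v \<in> carrier E.
       D (gn x \<cdot> v) = D1 x \<cdot> tw v \<^bold>+ signed E k (gn (\<alpha> x) \<cdot> D v))"

text \<open>A derivation \<open>D\<close> twisted by \<open>tw\<close> is obtained from the action on pairs for which the orbit of
  \<open>(1, 0)\<close> consists of the pairs \<open>(tw v, D v)\<close>.\<close>

lemma derivation_exists:
  fixes k :: int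
  assumes D0_closed: "\<And>a. a \<in> carrier A \<Longrightarrow> D0 a \<in> carrier E"
    and D0_add: "\<And>a b. a \<in> carrier A \<Longrightarrow> b \<in> carrier A \<Longrightarrow> D0 (a \<oplus> b) = D0 a \<^bold>+ D0 b"
    and D0_mult: "\<And>a b. a \<in> carrier A \<Longrightarrow> b \<in> carrier A \<Longrightarrow>
      D0 (a \<otimes> b) = sc (\<phi> a) \<cdot> D0 b \<^bold>+ sc (\<phi> b) \<cdot> D0 a"
    and D1_closed: "\<And>x. x \<in> carrier L \<Longrightarrow> D1 x \<in> carrier E"
    and D1_add: "\<And>x y. x \<in> carrier L \<Longrightarrow> y \<in> carrier L \<Longrightarrow> D1 (x \<oplus>\<^bsub>L\<^esub> y) = D1 x \<^bold>+ D1 y"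
    and D1_smult: "\<And>a x. a \<in> carrier A \<Longrightarrow> x \<in> carrier L \<Longrightarrow>
      D1 (a \<odot>\<^bsub>L\<^esub> x) = sc (\<phi> a) \<cdot> D1 x \<^bold>+ D0 a \<cdot> gn (\<alpha> x)"
    and D1_gn: "\<And>x. x \<in> carrier L \<Longrightarrow>
      D1 x \<cdot> gn (\<alpha> x) \<^bold>+ signed E k (gn (\<alpha> x) \<cdot> D1 x) = \<^bold>0"
    and D0_gn: "\<And>a x. a \<in> carrier A \<Longrightarrow> x \<in> carrier L \<Longrightarrow>
      D0 a \<cdot> gn (\<alpha> x) = signed E k (gn (\<alpha> x) \<cdot> D0 a)"
  shows "\<exists>D. twisted_derivation k D0 D1 D"
proof -
  \<comment> \<open>Both operators are triangular on pairs \<open>(p, d)\<close>: the twist stands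
    on the diagonal, up to a sign in the second entry, and the derivation in the corner. Composing
    them reproduces the Leibniz rule.\<close>
  define G where "G a q = (sc (\<phi> a) \<cdot> fst q, D0 a \<cdot> fst q \<^bold>+ sc (\<phi> a) \<cdot> snd q)" for a q
  define F where "F x q = (gn (\<alpha> x) \<cdot> fst q,
    D1 x \<cdot> fst q \<^bold>+ signed E k (gn (\<alpha> x) \<cdot> snd q))" for x q
  have D0_one: "D0 \<one> = \<^bold>0"
    using D0_mult[of \<one> \<one>] D0_closed[of \<one>] by (simp add: phi_one sc_one)
  have c0: "D0 a \<cdot> (sc b \<cdot> p) = sc b \<cdot> (D0 a \<cdot> p)"
    if "a \<in> carrier A" "b \<in> carrier A" "p \<in> carrier E" for a b p
    using that D0_closed by (simp add: sc_left_comm)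
  have c1: "D1 x \<cdot> (sc b \<cdot> p) = sc b \<cdot> (D1 x \<cdot> p)"
    if "x \<in> carrier L" "b \<in> carrier A" "p \<in> carrier E" for x b p
    using that D1_closed by (simp add: sc_left_comm)
  have c2: "signed E k (gn (\<alpha> x) \<cdot> (D0 a \<cdot> p)) = D0 a \<cdot> (gn (\<alpha> x) \<cdot> p)"
    if "x \<in> carrier L" "a \<in> carrier A" "p \<in> carrier E" for x a p
    using that D0_closed D0_gn[of a x]
    by (simp add: E.m_assoc[symmetric] E.signed_mult_left[symmetric])
  \<comment> \<open>The corner entry of \<open>F x\<close> applied twice. It must vanish because
    \<open>x \<and> x\<close> does, and this is the purpose of the hypothesis
    \<open>D1_gn\<close>.\<close>
  have c3: "D1 x \<cdot> (gn (\<alpha> x) \<cdot> p) \<^bold>+ signed E k (gn (\<alpha> x) \<cdot> (D1 x \<cdot> p)) = \<^bold>0"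
    if "x \<in> carrier L" "p \<in> carrier E" for x p
  proof -
    have "(D1 x \<cdot> gn (\<alpha> x) \<^bold>+ signed E k (gn (\<alpha> x) \<cdot> D1 x)) \<cdot> p = \<^bold>0"
      using that by (simp add: D1_gn)
    then show ?thesis using that D1_closed by (simp add: E.l_distr E.signed_mult_left E.m_assoc)
  qed
  have c4: "gn x \<cdot> (gn x \<cdot> u) = \<^bold>0" if "x \<in> carrier L" "u \<in> carrier E" for x u
    using that by (simp add: E.m_assoc[symmetric] gn_square)
  interpret N: abelian_group "prod_group E E"
    by (intro prod_group E.abelian_group_axioms)
  interpret act: exterior_action A L "prod_group E E" G F
  proof (intro exterior_action.intro exterior_action_axioms.intro exterior_module_axioms N.abelian_group_axioms)
    fix x n assume x: "x \<in> carrier L" and "n \<in> carrier (prod_group E E)"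
    then obtain p d where n: "n = (p, d)" "p \<in> carrier E" "d \<in> carrier E"
      by (auto simp: prod_group_def)
    show "F x (F x n) = \<zero>\<^bsub>prod_group E E\<^esub>"
      using x n D1_closed by (simp add: F_def prod_group_def c4 E.r_distr E.signed_add E.signed_mult_right
          E.signed_signed E.a_assoc[symmetric] c3)
    fix a assume a: "a \<in> carrier A"
    show "F x (G a n) = G a (F x n)" 
      using x n a D1_closed D0_closed 
      by (simp add: F_def G_def c1 gn_sc E.r_distr E.signed_add E.signed_mult_right c2 E.a_ac)
    show "F (a \<odot>\<^bsub>L\<^esub> x) n = G a (F x n)" 
      using x n a D1_closed D0_closed 
      by (simp add: F_def G_def D1_smult alpha_smult gn_smult gn_sc E.r_distr E.l_distr
          E.signed_add E.signed_mult_right E.m_assoc E.a_ac)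
  qed (use D0_closed D1_closed in \<open>auto simp: prod_group_def G_def F_def E.r_distr E.l_distr E.m_assoc E.a_ac
      E.signed_add gn_add alpha_add D0_add D1_add D0_mult sc_add sc_mult phi_add phi_mult phi_one sc_one D0_one c0\<close>)
  \<comment> \<open>The start vector \<open>(1, 0)\<close> expresses \<open>tw 1 = 1\<close> and
    \<open>D 1 = 0\<close>; the latter agrees with \<open>D0_one\<close>.\<close>
  define D where "D v = (if v \<in> carrier E then snd (act.rec v (\<one>\<^bsub>E\<^esub>, \<^bold>0)) else \<^bold>0)" for v
  have n: "(\<one>\<^bsub>E\<^esub>, \<^bold>0) \<in> carrier (prod_group E E)" by (simp add: prod_group_def)
  have rc: "fst (act.rec v (\<one>\<^bsub>E\<^esub>, \<^bold>0)) \<in> carrier E" "snd (act.rec v (\<one>\<^bsub>E\<^esub>, \<^bold>0)) \<in> carrier E"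
    if "v \<in> carrier E" for v
    using act.rec_closed[OF that n] by (auto simp: prod_group_def)
  have fst: "fst (act.rec v (\<one>\<^bsub>E\<^esub>, \<^bold>0)) = tw v" if "v \<in> carrier E" for v
    using that
  proof (induction rule: E_induct)
    case (sc a)
    then have "fst (G a (\<one>\<^bsub>E\<^esub>, \<^bold>0)) = tw (sc a)" by (simp add: G_def tw.lift_sc)
    then show ?case using act.rec_sc[OF _ n, of a] sc by simp
  next
    case (gn x v)
    have "fst (F x q) = gn (\<alpha> x) \<cdot> fst q" for q by (simp add: F_def)
    then show ?case using act.rec_gn_mult[OF _ _ n, of x v] gn by (simp add: tw.lift_gn_mult)
  next
    case (add u v)
    then show ?case using act.rec_add[OF _ _ n, of u v] by (simp add: prod_group_def tw.lift_add split: prod.splits)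
  qed
  have "D v \<in> carrier E" for v using rc by (simp add: D_def)
  moreover have "D v = \<^bold>0" if "v \<notin> carrier E" for v using that by (simp add: D_def)
  moreover have "D (u \<^bold>+ v) = D u \<^bold>+ D v" if "u \<in> carrier E" "v \<in> carrier E" for u v
    using act.rec_add[OF that n] that by (simp add: D_def prod_group_def split: prod.splits)
  moreover have "D (sc a) = D0 a" if "a \<in> carrier A" for a
  proof -
    have "snd (G a (\<one>\<^bsub>E\<^esub>, \<^bold>0)) = D0 a" using that D0_closed by (simp add: G_def)
    then show ?thesis using act.rec_sc[OF that n] that by (simp add: D_def)
  qed
  moreover have "D (gn x \<cdot> v) = D1 x \<cdot> tw v \<^bold>+ signed E k (gn (\<alpha> x) \<cdot> D v)"
    if "x \<in> carrier L" "v \<in> carrier E" for x v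
  proof -
    have "snd (F x q) = D1 x \<cdot> fst q \<^bold>+ signed E k (gn (\<alpha> x) \<cdot> snd q)" for q
      by (simp add: F_def)
    then show ?thesis using act.rec_gn_mult[OF that n] that fst[OF that(2)] by (simp add: D_def)
  qed
  ultimately show ?thesis
    unfolding twisted_derivation_def by (intro exI[of _ D] conjI ballI allI impI)
qed

section \<open>The derivations given by bracketing with one generator\<close>

lemma rho_zero: "x \<in> carrier L \<Longrightarrow> \<rho> x \<zero> = \<zero>"
  by (rule R.additive_zero[OF rho_add_right rho_closed R.abelian_group_axioms])

text \<open>\<open>dx x\<close> and \<open>da c\<close> are \<open>[x, -]\<close> and \<open>[c, -]\<close>, of degrees \<open>0\<close> and \<open>-1\<close>. As total functions they
  vanish off the carrier, so that they lie in \<^const>\<open>fun_group\<close>.\<close>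

definition dx :: "'l \<Rightarrow> ('l list \<Rightarrow> 'a) set \<Rightarrow> ('l list \<Rightarrow> 'a) set" where
  "dx x = (SOME D. twisted_derivation 0 (\<lambda>a. sc (\<rho> x a)) (\<lambda>y. gn (br x y)) D)"

definition da :: "'a \<Rightarrow> ('l list \<Rightarrow> 'a) set \<Rightarrow> ('l list \<Rightarrow> 'a) set" where
  "da c = (SOME D. twisted_derivation 1 (\<lambda>a. \<^bold>0) (\<lambda>y. \<ominus>\<^bsub>E\<^esub> sc (\<rho> y c)) D)"

lemma dx_facts:
  assumes x: "x \<in> carrier L"
  shows dx_closed [simp]: "dx x v \<in> carrier E"
    and dx_outside: "v \<notin> carrier E \<Longrightarrow> dx x v = \<^bold>0"
    and dx_add: "u \<in> carrier E \<Longrightarrow> v \<in> carrier E \<Longrightarrow> dx x (u \<^bold>+ v) = dx x u \<^bold>+ dx x v"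
    and dx_sc: "a \<in> carrier A \<Longrightarrow> dx x (sc a) = sc (\<rho> x a)"
    and dx_gn_mult: "y \<in> carrier L \<Longrightarrow> v \<in> carrier E \<Longrightarrow>
      dx x (gn y \<cdot> v) = gn (br x y) \<cdot> tw v \<^bold>+ gn (\<alpha> y) \<cdot> dx x v"
proof -
  \<comment> \<open>With \<open>D1 y = gn (br x y)\<close> and \<open>k = 0\<close>, the condition
    \<open>D1_gn\<close> says that \<open>[x, y]\<close> and \<open>\<alpha>(y)\<close>
    anticommute.\<close>
  have "gn u \<cdot> gn v \<^bold>+ gn v \<cdot> gn u = \<^bold>0" if "u \<in> carrier L" "v \<in> carrier L" for u v
    using that gn_anticomm[of u v] by (simp add: E.l_neg)
  then have "\<exists>D. twisted_derivation 0 (\<lambda>a. sc (\<rho> x a)) (\<lambda>y. gn (br x y)) D"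
    by (intro derivation_exists)
      (use x in \<open>simp_all add: rho_add_right rho_mult br_add_right br_leibniz sc_add sc_mult
        gn_add gn_smult signed_def gn_sc_comm\<close>)
  from someI_ex[OF this, folded dx_def, unfolded twisted_derivation_def] x
  show "dx x v \<in> carrier E" "v \<notin> carrier E \<Longrightarrow> dx x v = \<^bold>0"
    "u \<in> carrier E \<Longrightarrow> v \<in> carrier E \<Longrightarrow> dx x (u \<^bold>+ v) = dx x u \<^bold>+ dx x v"
    "a \<in> carrier A \<Longrightarrow> dx x (sc a) = sc (\<rho> x a)"
    "y \<in> carrier L \<Longrightarrow> v \<in> carrier E \<Longrightarrow>
      dx x (gn y \<cdot> v) = gn (br x y) \<cdot> tw v \<^bold>+ gn (\<alpha> y) \<cdot> dx x v"
    by (simp_all add: signed_def)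
qed

lemma da_facts:
  assumes c: "c \<in> carrier A"
  shows da_closed [simp]: "da c v \<in> carrier E"
    and da_outside: "v \<notin> carrier E \<Longrightarrow> da c v = \<^bold>0"
    and da_add: "u \<in> carrier E \<Longrightarrow> v \<in> carrier E \<Longrightarrow> da c (u \<^bold>+ v) = da c u \<^bold>+ da c v"
    and da_sc: "a \<in> carrier A \<Longrightarrow> da c (sc a) = \<^bold>0"
    and da_gn_mult: "y \<in> carrier L \<Longrightarrow> v \<in> carrier E \<Longrightarrow>
      da c (gn y \<cdot> v) = \<ominus>\<^bsub>E\<^esub> (sc (\<rho> y c) \<cdot> tw v \<^bold>+ gn (\<alpha> y) \<cdot> da c v)"
proof -
  \<comment> \<open>Here \<open>D1_gn\<close> holds because \<open>\<rho>(y)(c)\<close> is central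
    and \<open>k = 1\<close> is odd. The value zero on scalars reflects that \<open>[c, a]\<close>
    would have degree -1.\<close>
  have "\<exists>D. twisted_derivation 1 (\<lambda>a. \<^bold>0) (\<lambda>y. \<ominus>\<^bsub>E\<^esub> sc (\<rho> y c)) D"
    by (intro derivation_exists)
      (use c in \<open>simp_all add: rho_add_left rho_smult sc_add sc_mult E.l_minus E.r_minus E.minus_add
         signed_def gn_sc_comm E.l_neg E.r_neg E.a_ac\<close>)
  from someI_ex[OF this, folded da_def, unfolded twisted_derivation_def] c
  show "da c v \<in> carrier E" "v \<notin> carrier E \<Longrightarrow> da c v = \<^bold>0"
    "u \<in> carrier E \<Longrightarrow> v \<in> carrier E \<Longrightarrow> da c (u \<^bold>+ v) = da c u \<^bold>+ da c v"
    "a \<in> carrier A \<Longrightarrow> da c (sc a) = \<^bold>0"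
    "y \<in> carrier L \<Longrightarrow> v \<in> carrier E \<Longrightarrow>
      da c (gn y \<cdot> v) = \<ominus>\<^bsub>E\<^esub> (sc (\<rho> y c) \<cdot> tw v \<^bold>+ gn (\<alpha> y) \<cdot> da c v)"
    by (simp_all add: signed_def E.minus_add E.l_minus)
qed

text \<open>Scalar factors were not part of the recursion. In \<open>a y v\<close> the scalar can be
  absorbed into the letter \<open>y\<close>, and \<open>br_leibniz\<close> for
  \<open>[x, a y]\<close> then supplies both terms.\<close>

lemma dx_sc_mult:
  assumes "x \<in> carrier L" "a \<in> carrier A" "v \<in> carrier E"
  shows "dx x (sc a \<cdot> v) = sc (\<rho> x a) \<cdot> tw v \<^bold>+ sc (\<phi> a) \<cdot> dx x v"
  using assms(3)
proof (induction rule: E_induct)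
  case (sc b)
  have "sc (\<phi> b) \<cdot> sc (\<rho> x a) = sc (\<rho> x a) \<cdot> sc (\<phi> b)"
    using sc assms by (intro sc_central) auto
  then show ?case using sc assms
    by (simp add: sc_mult[symmetric] dx_sc rho_mult sc_add tw.lift_sc E.a_comm)
next
  case (gn y v)
  have "sc a \<cdot> (gn y \<cdot> v) = gn (a \<odot>\<^bsub>L\<^esub> y) \<cdot> v"
    using gn assms by (simp add: gn_smult E.m_assoc)
  then show ?case using gn assms dx_gn_mult[of x "a \<odot>\<^bsub>L\<^esub> y" v]
    by (simp add: dx_gn_mult br_leibniz gn_add gn_smult alpha_smult tw.lift_gn_mult E.l_distr E.r_distr
        E.m_assoc E.a_ac)
next
  case (add u v)
  then show ?case using assms by (simp add: E.r_distr dx_add tw.lift_add E.a_ac)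
qed

lemma da_sc_mult:
  assumes "c \<in> carrier A" "a \<in> carrier A" "v \<in> carrier E"
  shows "da c (sc a \<cdot> v) = sc (\<phi> a) \<cdot> da c v"
  using assms(3)
proof (induction rule: E_induct)
  case (sc b)
  then show ?case using assms by (simp add: sc_mult[symmetric] da_sc)
next
  case (gn y v)
  have "sc a \<cdot> (gn y \<cdot> v) = gn (a \<odot>\<^bsub>L\<^esub> y) \<cdot> v"
    using gn assms by (simp add: gn_smult E.m_assoc)
  then show ?case using gn assms da_gn_mult[of c "a \<odot>\<^bsub>L\<^esub> y" v]
    by (simp add: da_gn_mult rho_smult sc_mult gn_smult alpha_smult E.r_distr E.r_minus E.m_assoc)
next
  case (add u v)
  then show ?case using assms by (simp add: E.r_distr da_add)
qed

section \<open>Dependence of these derivations on the generator\<close>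

lemma dx_add_left:
  assumes x: "x \<in> carrier L" "y \<in> carrier L"
  shows "dx (x \<oplus>\<^bsub>L\<^esub> y) v = dx x v \<^bold>+ dx y v"
proof (cases "v \<in> carrier E")
  case True
  then show ?thesis
  proof (induction rule: E_induct)
    case (sc a)
    then show ?case using x by (simp add: dx_sc rho_add_left sc_add)
  next
    case (gn z v)
    then show ?case using x
      by (simp add: dx_gn_mult br_add_left gn_add E.l_distr E.r_distr E.a_ac)
  next
    case (add u v)
    then show ?case using x by (simp add: dx_add E.a_ac)
  qed
qed (use x in \<open>simp add: dx_outside\<close>)

lemma da_add_left:
  assumes x: "b \<in> carrier A" "c \<in> carrier A"
  shows "da (b \<oplus> c) v = da b v \<^bold>+ da c v"
proof (cases "v \<in> carrier E")
  case True
  then show ?thesis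
  proof (induction rule: E_induct)
    case (sc a)
    then show ?case using x by (simp add: da_sc)
  next
    case (gn z v)
    then show ?case using x
      by (simp add: da_gn_mult rho_add_right sc_add E.l_distr E.r_distr E.minus_add E.a_ac)
  next
    case (add u v)
    then show ?case using x by (simp add: da_add E.a_ac)
  qed
qed (use x in \<open>simp add: da_outside\<close>)

text \<open>Scalars act on the first argument of the bracket as twisted derivations, because
  \<open>\<rho>(y)\<close> is one. This is the multiplicativity that \<open>brG\<close>
  requires.\<close>

lemma da_mult:
  assumes x: "b \<in> carrier A" "c \<in> carrier A"
  shows "da (b \<otimes> c) v = sc (\<phi> b) \<cdot> da c v \<^bold>+ sc (\<phi> c) \<cdot> da b v"
proof (cases "v \<in> carrier E")
  case True
  then show ?thesis
  proof (induction rule: E_induct)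
    case (sc a)
    then show ?case using x by (simp add: da_sc)
  next
    case (gn z v)
    then show ?case using x
      by (simp add: da_gn_mult rho_mult sc_add sc_mult E.l_distr E.r_distr E.minus_add E.r_minus
          gn_sc E.m_assoc E.a_ac)
  next
    case (add u v)
    then show ?case using x by (simp add: da_add E.r_distr E.a_ac)
  qed
qed (use x in \<open>simp add: da_outside\<close>)

text \<open>The identity that ties \<open>[x, -]\<close> to \<open>[a, -]\<close> and makes the
  bracket respect the relation between \<open>a \<odot> x\<close> and \<open>a x\<close> in its
  first argument. On a generator it is \<open>br_smult_left\<close>; to carry it past a further
  letter, \<open>\<alpha>(x)\<close> and \<open>\<alpha>(z)\<close> are interchanged.\<close>

lemma dx_smult:
  assumes x: "x \<in> carrier L" "a \<in> carrier A"
  shows "dx (a \<odot>\<^bsub>L\<^esub> x) v = sc (\<phi> a) \<cdot> dx x v \<^bold>+ gn (\<alpha> x) \<cdot> da a v"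
proof (cases "v \<in> carrier E")
  case True
  then show ?thesis
  proof (induction rule: E_induct)
    case (sc b)
    then show ?case using x by (simp add: dx_sc da_sc rho_smult sc_mult)
  next
    case (gn z v)
    have ac: "gn (\<alpha> z) \<cdot> (gn (\<alpha> x) \<cdot> da a v) = \<ominus>\<^bsub>E\<^esub> (gn (\<alpha> x) \<cdot> (gn (\<alpha> z) \<cdot> da a v))"
      using x gn gn_anticomm[of "\<alpha> z" "\<alpha> x"] by (simp add: E.m_assoc[symmetric] E.l_minus)
    show ?case using x gn
      by (simp add: dx_gn_mult da_gn_mult br_smult_left a_minus_def E.l_minus E.r_minus E.minus_add
          E.l_distr E.r_distr gn_sc ac E.m_assoc E.a_ac)
  next
    case (add u v)
    then show ?case using x by (simp add: dx_add da_add E.r_distr E.a_ac)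
  qed
qed (use x in \<open>simp add: dx_outside da_outside\<close>)

lemma da_one: "da \<one> v = \<^bold>0"
  using da_mult[of \<one> \<one> v] by (simp add: phi_one sc_one)

text \<open>\<open>inv.lift\<close> is the grading involution \<open>u \<mapsto> (-1)^|u| u\<close>.\<close>

sublocale inv: exterior_lift A L E sc "\<lambda>x. \<ominus>\<^bsub>E\<^esub> gn x"
  by (unfold_locales)
    (simp_all add: sc_add sc_mult sc_one gn_add gn_smult E.minus_add E.l_minus E.r_minus
      gn_sc_comm gn_square)

abbreviation sg where "sg \<equiv> inv.lift"

text \<open>For homogeneous \<open>u\<close> this says that \<open>(-1)^|u| u x\<close> equals
  \<open>x u\<close>. In terms of \<open>sg\<close> it holds for all \<open>u\<close>, so that the
  action defining the bracket can be written without degrees.\<close>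

lemma sg_gn:
  assumes "x \<in> carrier L" "u \<in> carrier E"
  shows "sg u \<cdot> gn x = gn x \<cdot> u"
  using assms(2)
proof (induction rule: E_induct)
  case (sc a)
  then show ?case using assms by (simp add: inv.lift_sc gn_sc_comm)
next
  case (gn y u)
  have "gn y \<cdot> (gn x \<cdot> u) = \<ominus>\<^bsub>E\<^esub> (gn x \<cdot> (gn y \<cdot> u))"
    using assms gn(1,2) gn_anticomm[of y x] by (simp add: E.m_assoc[symmetric] E.l_minus)
  then show ?case using assms gn by (simp add: inv.lift_gn_mult E.m_assoc E.l_minus)
next
  case (add u v)
  then show ?case using assms by (simp add: inv.lift_add E.l_distr E.r_distr)
qed

lemma sg_dg: "u \<in> dg n \<Longrightarrow> sg u = signed E (int n) u"
proof (induction rule: dg_induct)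
  case (gn n x v)
  then show ?case by (simp add: inv.lift_gn_mult E.l_minus E.signed_mult_right) (simp add: signed_def)
next
  case (add n u v)
  then show ?case by (simp add: inv.lift_add E.signed_add)
qed (simp_all add: inv.lift_sc inv.lift_zero, simp add: signed_def)

lemma tw_dg [simp]: "u \<in> dg n \<Longrightarrow> tw u \<in> dg n"
  by (induction rule: dg_induct) (simp_all add: tw.lift_sc tw.lift_gn_mult tw.lift_add tw.lift_zero)

text \<open>For this action the orbit of \<open>(1, 0)\<close> consists of the pairs \<open>(tw u, [u, -])\<close>.\<close>

definition brG :: "'a \<Rightarrow> ('l list \<Rightarrow> 'a) set \<times> (('l list \<Rightarrow> 'a) set \<Rightarrow> ('l list \<Rightarrow> 'a) set) \<Rightarrow>
    ('l list \<Rightarrow> 'a) set \<times> (('l list \<Rightarrow> 'a) set \<Rightarrow> ('l list \<Rightarrow> 'a) set)" where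
  "brG a q = (sc (\<phi> a) \<cdot> fst q, \<lambda>v. sc (\<phi> a) \<cdot> snd q v \<^bold>+ fst q \<cdot> da a v)"

text \<open>The left Leibniz rule: \<open>[x \<and> u, v]\<close> is
  \<open>\<alpha>(x) \<and> [u, v]\<close> plus \<open>(-1)^|u| \<alpha>_G(u) \<and> [x, v]\<close>,
  where \<open>sg\<close> provides the sign.\<close>

definition brF :: "'l \<Rightarrow> ('l list \<Rightarrow> 'a) set \<times> (('l list \<Rightarrow> 'a) set \<Rightarrow> ('l list \<Rightarrow> 'a) set) \<Rightarrow>
    ('l list \<Rightarrow> 'a) set \<times> (('l list \<Rightarrow> 'a) set \<Rightarrow> ('l list \<Rightarrow> 'a) set)" where
  "brF x q = (gn (\<alpha> x) \<cdot> fst q, \<lambda>v. gn (\<alpha> x) \<cdot> snd q v \<^bold>+ sg (fst q) \<cdot> dx x v)"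

abbreviation brN where "brN \<equiv> prod_group E (fun_group E :: (('l list \<Rightarrow> 'a) set \<Rightarrow> ('l list \<Rightarrow> 'a) set) ring)"

lemma bracket_action: "exterior_action A L brN brG brF"
proof -
  interpret N: abelian_group brN
    by (intro prod_group fun_group E.abelian_group_axioms)
  have c4: "gn x \<cdot> (gn x \<cdot> u) = \<^bold>0" if "x \<in> carrier L" "u \<in> carrier E" for x u
    using that by (simp add: E.m_assoc[symmetric] gn_square)
  have car: "q \<in> carrier brN \<longleftrightarrow> fst q \<in> carrier E \<and> (\<forall>v. snd q v \<in> carrier E)" for q
    by (cases q) (auto simp: prod_group_def fun_group_def)
  have add: "q \<oplus>\<^bsub>brN\<^esub> q' = (fst q \<^bold>+ fst q', \<lambda>v. snd q v \<^bold>+ snd q' v)" for q q'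
    by (cases q; cases q') (auto simp: prod_group_def fun_group_def)
  have zero: "\<zero>\<^bsub>brN\<^esub> = (\<^bold>0, \<lambda>v. \<^bold>0)"
    by (auto simp: prod_group_def fun_group_def)
  show ?thesis
  proof (intro exterior_action.intro exterior_action_axioms.intro exterior_module_axioms N.abelian_group_axioms)
    fix n assume "n \<in> carrier brN"
    then obtain p D where n: "n = (p, D)" "p \<in> carrier E" "\<And>v. D v \<in> carrier E"
      unfolding car by (metis prod.collapse)
    have pc: "p \<cdot> (sc b \<cdot> u) = sc b \<cdot> (p \<cdot> u)"
      "sg p \<cdot> (sc b \<cdot> u) = sc b \<cdot> (sg p \<cdot> u)"
      if "b \<in> carrier A" "u \<in> carrier E" for b u
      using that n by (simp_all add: sc_left_comm)
    have pg: "sg p \<cdot> (gn y \<cdot> u) = gn y \<cdot> (p \<cdot> u)" if "y \<in> carrier L" "u \<in> carrier E" for y u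
      using that n by (simp add: E.m_assoc[symmetric] sg_gn)
    show "brG \<one> n = n"
      using n by (simp add: brG_def phi_one sc_one da_one)
    \<comment> \<open>Multiplying the first component by \<open>gn (\<alpha> x)\<close> changes the
      sign of its image under \<open>sg\<close>, so the two terms containing \<open>dx x v\<close>
      cancel.\<close>
    show "brF x (brF x n) = \<zero>\<^bsub>brN\<^esub>" if x: "x \<in> carrier L" for x
      using x n by (simp add: brF_def zero c4 inv.lift_gn_mult tw.lift_mult E.r_distr E.l_minus E.m_assoc
          E.r_neg)
    fix a assume a: "a \<in> carrier A"
    show "brG (a \<otimes> b) n = brG a (brG b n)" if b: "b \<in> carrier A" for b
    proof -
      have "sc (\<phi> b) \<cdot> (sc (\<phi> a) \<cdot> D v) = sc (\<phi> a) \<cdot> (sc (\<phi> b) \<cdot> D v)" for v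
        using a b n by (intro sc_left_comm) auto
      then show ?thesis
        using n a b by (simp add: brG_def da_mult phi_mult sc_mult E.r_distr E.m_assoc pc E.a_ac)
    qed
    show "brG (a \<oplus> b) n = brG a n \<oplus>\<^bsub>brN\<^esub> brG b n" if "b \<in> carrier A" for b
      using n a that by (simp add: brG_def add da_add_left phi_add sc_add E.r_distr E.l_distr E.a_ac)
    fix x assume x: "x \<in> carrier L"
    show "brF x (brG a n) = brG a (brF x n)" 
      using x n a by (simp add: brF_def brG_def gn_sc E.r_distr inv.lift_sc_mult E.m_assoc E.a_ac)
    \<comment> \<open>The term with \<open>da a v\<close> in \<open>dx_smult\<close> is carried past
      \<open>sg p\<close> by \<open>sg_gn\<close>, and becomes the term with \<open>da a v\<close>
      in \<open>brG\<close>.\<close>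
    show "brF (a \<odot>\<^bsub>L\<^esub> x) n = brG a (brF x n)" 
      using x n a by (simp add: brF_def brG_def dx_smult alpha_smult gn_smult E.r_distr E.l_distr
          E.m_assoc pc pg E.a_ac)
  next
    fix n x y assume "n \<in> carrier brN" and xy: "x \<in> carrier L" "y \<in> carrier L"
    then have n: "fst n \<in> carrier E" "\<And>v. snd n v \<in> carrier E"
      unfolding car by auto
    show "brF (x \<oplus>\<^bsub>L\<^esub> y) n = brF x n \<oplus>\<^bsub>brN\<^esub> brF y n"
      using n xy by (simp add: brF_def add dx_add_left alpha_add gn_add E.r_distr E.l_distr E.a_ac)
  qed (auto simp: car add brG_def brF_def E.r_distr E.l_distr E.a_ac inv.lift_add)
qed

definition b0 :: "('l list \<Rightarrow> 'a) set \<Rightarrow> ('l list \<Rightarrow> 'a) set \<Rightarrow> ('l list \<Rightarrow> 'a) set" where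
  "b0 u = snd (exterior_action.rec A L brN brG brF u (\<one>\<^bsub>E\<^esub>, \<lambda>v. \<^bold>0))"

lemma b0_facts:
  assumes u: "u \<in> carrier E"
  shows b0_closed [simp]: "b0 u v \<in> carrier E"
    and b0_add_left: "u' \<in> carrier E \<Longrightarrow> b0 (u \<^bold>+ u') v = b0 u v \<^bold>+ b0 u' v"
    and b0_sc_aux: "a \<in> carrier A \<Longrightarrow> b0 (sc a) v = da a v"
    and b0_sc_mult: "a \<in> carrier A \<Longrightarrow> b0 (sc a \<cdot> u) v = sc (\<phi> a) \<cdot> b0 u v \<^bold>+ tw u \<cdot> da a v"
    and b0_gn_mult: "x \<in> carrier L \<Longrightarrow> b0 (gn x \<cdot> u) v = gn (\<alpha> x) \<cdot> b0 u v \<^bold>+ sg (tw u) \<cdot> dx x v"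
proof -
  interpret act: exterior_action A L brN brG brF by (rule bracket_action)
  let ?n = "(\<one>\<^bsub>E\<^esub>, \<lambda>v. \<^bold>0)"
  have n: "?n \<in> carrier brN" by (simp add: prod_group_def fun_group_def)
  have car: "q \<in> carrier brN \<longleftrightarrow> fst q \<in> carrier E \<and> (\<forall>v. snd q v \<in> carrier E)" for q
    by (cases q) (auto simp: prod_group_def fun_group_def)
  have add: "q \<oplus>\<^bsub>brN\<^esub> q' = (fst q \<^bold>+ fst q', \<lambda>v. snd q v \<^bold>+ snd q' v)" for q q'
    by (cases q; cases q') (auto simp: prod_group_def fun_group_def)
  have fst: "fst (act.rec v ?n) = tw v" if "v \<in> carrier E" for v
    using that
  proof (induction rule: E_induct)
    case (sc a)
    then have "fst (brG a ?n) = tw (sc a)" by (simp add: brG_def tw.lift_sc)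
    then show ?case using act.rec_sc[OF _ n, of a] sc by simp
  next
    case (gn x v)
    have "fst (brF x q) = gn (\<alpha> x) \<cdot> fst q" for q by (simp add: brF_def)
    then show ?case using act.rec_gn_mult[OF _ _ n, of x v] gn by (simp add: tw.lift_gn_mult)
  next
    case (add u v)
    have "fst (q \<oplus>\<^bsub>brN\<^esub> q') = fst q \<^bold>+ fst q'" for q q'
      by (cases q; cases q') (auto simp: prod_group_def)
    then show ?case using act.rec_add[OF _ _ n, of u v] add by (simp add: tw.lift_add)
  qed
  show "b0 u v \<in> carrier E"
    using act.rec_closed[OF u n] by (simp add: b0_def car)
  show "u' \<in> carrier E \<Longrightarrow> b0 (u \<^bold>+ u') v = b0 u v \<^bold>+ b0 u' v"
    using act.rec_add[OF u _ n, of u'] by (simp add: b0_def add)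
  show "a \<in> carrier A \<Longrightarrow> b0 (sc a) v = da a v"
  proof -
    assume a: "a \<in> carrier A"
    have "snd (brG a ?n) v = da a v" using a by (simp add: brG_def)
    then show ?thesis using act.rec_sc[OF a n] by (simp add: b0_def)
  qed
  show "a \<in> carrier A \<Longrightarrow> b0 (sc a \<cdot> u) v = sc (\<phi> a) \<cdot> b0 u v \<^bold>+ tw u \<cdot> da a v"
  proof -
    assume a: "a \<in> carrier A"
    have "snd (brG a q) v = sc (\<phi> a) \<cdot> snd q v \<^bold>+ fst q \<cdot> da a v" for q by (simp add: brG_def)
    then show ?thesis using act.rec_sc_mult[OF a u n] fst[OF u] by (simp add: b0_def)
  qed
  show "x \<in> carrier L \<Longrightarrow> b0 (gn x \<cdot> u) v = gn (\<alpha> x) \<cdot> b0 u v \<^bold>+ sg (tw u) \<cdot> dx x v"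
  proof -
    assume x: "x \<in> carrier L"
    have "snd (brF x q) v = gn (\<alpha> x) \<cdot> snd q v \<^bold>+ sg (fst q) \<cdot> dx x v" for q by (simp add: brF_def)
    then show ?thesis using act.rec_gn_mult[OF x u n] fst[OF u] by (simp add: b0_def)
  qed
qed

lemmas b0_sc = b0_sc_aux[OF E.one_closed]

lemma b0_gn: "x \<in> carrier L \<Longrightarrow> b0 (gn x) v = dx x v"
  using b0_gn_mult[of "\<one>\<^bsub>E\<^esub>" x v] b0_sc[of \<one> v]
  by (simp add: sc_one da_one tw.lift_one inv.lift_one)

lemma b0_zero_left [simp]: "b0 \<^bold>0 v = \<^bold>0"
  by (rule E.additive_zero[of E "\<lambda>u. b0 u v"]) (simp_all add: b0_add_left E.abelian_group_axioms)

text \<open>\<open>fun_group\<close> admits arbitrary functions, so additivity in the second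
  argument is not inherited from the construction; it comes by induction from \<open>dx\<close> and
  \<open>da\<close>.\<close>

lemma b0_add_right:
  assumes "u \<in> carrier E" "v \<in> carrier E" "w \<in> carrier E"
  shows "b0 u (v \<^bold>+ w) = b0 u v \<^bold>+ b0 u w"
  using assms(1)
proof (induction rule: E_induct)
  case (sc a)
  then show ?case using assms by (simp add: b0_sc da_add)
next
  case (gn x u)
  then show ?case using assms by (simp add: b0_gn_mult dx_add E.r_distr E.a_ac)
next
  case (add u u')
  then show ?case using assms by (simp add: b0_add_left E.a_ac)
qed

lemma b0_zero_right [simp]: "u \<in> carrier E \<Longrightarrow> b0 u \<^bold>0 = \<^bold>0"
  by (rule E.additive_zero[of E "b0 u"]) (simp_all add: b0_add_right E.abelian_group_axioms)

end

section \<open>Graded brackets twisted by an endomorphism\<close>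

text \<open>Common ground of exterior algebras and hom-Gerstenhaber algebras. The Jacobi identity
  and the compatibility of \<open>t\<close> with the bracket are left out, because they are to be
  derived for the exterior algebra from the rest.\<close>

locale twisted_bracket = ring E
  for E :: "('r, 'g, 'x) module_scheme" (structure) +
  fixes d :: "nat \<Rightarrow> 'g set" and b :: "'g \<Rightarrow> 'g \<Rightarrow> 'g" and t :: "'g \<Rightarrow> 'g"
  assumes d_closed: "u \<in> d n \<Longrightarrow> u \<in> carrier E"
    and d_zero [simp]: "\<zero> \<in> d n"
    and d_add [simp]: "u \<in> d n \<Longrightarrow> v \<in> d n \<Longrightarrow> u \<oplus> v \<in> d n"
    and d_mult: "u \<in> d n \<Longrightarrow> v \<in> d m \<Longrightarrow> u \<otimes> v \<in> d (n + m)"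
    and d_comm: "u \<in> d n \<Longrightarrow> v \<in> d m \<Longrightarrow> u \<otimes> v = signed E (int n * int m) (v \<otimes> u)"
    and t_d [simp]: "u \<in> d n \<Longrightarrow> t u \<in> d n"
    and t_add: "u \<in> carrier E \<Longrightarrow> v \<in> carrier E \<Longrightarrow> t (u \<oplus> v) = t u \<oplus> t v"
    and t_mult: "u \<in> carrier E \<Longrightarrow> v \<in> carrier E \<Longrightarrow> t (u \<otimes> v) = t u \<otimes> t v"
    and t_closed [simp]: "u \<in> carrier E \<Longrightarrow> t u \<in> carrier E"
    and b_closed [simp]: "u \<in> carrier E \<Longrightarrow> v \<in> carrier E \<Longrightarrow> b u v \<in> carrier E"
    and b_add_left: "u \<in> carrier E \<Longrightarrow> v \<in> carrier E \<Longrightarrow> w \<in> carrier E \<Longrightarrow> b (u \<oplus> v) w = b u w \<oplus> b v w"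
    and b_add_right: "u \<in> carrier E \<Longrightarrow> v \<in> carrier E \<Longrightarrow> w \<in> carrier E \<Longrightarrow> b u (v \<oplus> w) = b u v \<oplus> b u w"
    and b_degree: "degree_minus_one E d b"
    and b_skew: "graded_skew E d b"
    and b_leibniz: "u \<in> d i \<Longrightarrow> v \<in> d j \<Longrightarrow> w \<in> d k \<Longrightarrow>
      b u (v \<otimes> w) = b u v \<otimes> t w \<oplus> signed E ((int i - 1) * int j) (t v \<otimes> b u w)"
begin

declare d_closed [simp]

lemma b_zero_left [simp]: "v \<in> carrier E \<Longrightarrow> b \<zero> v = \<zero>"
  by (rule additive_zero[of E "\<lambda>u. b u v"]) (simp_all add: b_add_left abelian_group_axioms)

lemma b_zero_right [simp]: "u \<in> carrier E \<Longrightarrow> b u \<zero> = \<zero>"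
  by (rule additive_zero[of E "b u"]) (simp_all add: b_add_right abelian_group_axioms)

lemma t_zero [simp]: "t \<zero> = \<zero>"
  by (rule additive_zero[of E t]) (simp_all add: t_add abelian_group_axioms)

lemma b_minus_right: "u \<in> carrier E \<Longrightarrow> v \<in> carrier E \<Longrightarrow> b u (\<ominus> v) = \<ominus> b u v"
  by (rule additive_minus[of E "b u"]) (simp_all add: b_add_right abelian_group_axioms)

lemma b_signed_right: "u \<in> carrier E \<Longrightarrow> v \<in> carrier E \<Longrightarrow> b u (signed E k v) = signed E k (b u v)"
  by (simp add: signed_def b_minus_right)

lemma b_dg: "u \<in> d i \<Longrightarrow> v \<in> d j \<Longrightarrow> i + j = Suc k \<Longrightarrow> b u v \<in> d k"
  using b_degree unfolding degree_minus_one_def by fastforce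

lemma b_dg_0: "u \<in> d 0 \<Longrightarrow> v \<in> d 0 \<Longrightarrow> b u v = \<zero>"
  using b_degree unfolding degree_minus_one_def by fastforce

lemma skew: "u \<in> d i \<Longrightarrow> v \<in> d j \<Longrightarrow> b u v = \<ominus> signed E ((int i - 1) * (int j - 1)) (b v u)"
  using b_skew unfolding graded_skew_def by blast

text \<open>The degree \<open>i + j - 1\<close> of a bracket may be \<open>-1\<close>, in which case the bracket is zero.\<close>

lemma skew_bracket:
  assumes "u \<in> d i" "v \<in> d j" "w \<in> d k"
  shows "b w (b u v) = \<ominus> signed E ((int k - 1) * (int i + int j - 2)) (b (b u v) w)"
proof (cases "i + j")
  case 0
  then show ?thesis using assms b_dg_0[of u v] by simp
next
  case (Suc l)
  then have e: "int i + int j - 2 = int l - 1" by linarith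
  show ?thesis unfolding e using skew[OF assms(3) b_dg[OF assms(1,2) Suc]] .
qed

lemma leibniz_bracket:
  assumes "u \<in> d i" "v \<in> d j" "w \<in> d k" "w' \<in> d l"
  shows "b (b u v) (w \<otimes> w') = b (b u v) w \<otimes> t w' \<oplus>
    signed E ((int i + int j - 2) * int k) (t w \<otimes> b (b u v) w')"
proof (cases "i + j")
  case 0
  then show ?thesis using assms b_dg_0[of u v] by simp
next
  case (Suc n)
  then have e: "int i + int j - 2 = int n - 1" by linarith
  show ?thesis unfolding e using b_leibniz[OF b_dg[OF assms(1,2) Suc] assms(3,4)] .
qed

lemma leibniz_mult_bracket:
  assumes "u \<in> d i" "v \<in> d j" "w \<in> d k" "w' \<in> d l"
  shows "b u (v \<otimes> b w w') = b u v \<otimes> t (b w w') \<oplus>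
    signed E ((int i - 1) * int j) (t v \<otimes> b u (b w w'))"
proof (cases "k + l")
  case 0
  then show ?thesis using assms b_dg_0[of w w'] by simp
next
  case (Suc n)
  then show ?thesis using b_leibniz[OF assms(1,2) b_dg[OF assms(3,4) Suc]] by simp
qed

end

text \<open>Generation in degrees 0 and 1 is assumed as an induction principle. The degree is a
  parameter of \<open>P\<close> because the statements proved by it carry signs depending on the
  degree.\<close>

locale generated_bracket = twisted_bracket E d b t
  for E :: "('r, 'g, 'x) module_scheme" (structure) and d b t +
  assumes generated: "\<lbrakk>u \<in> d n; \<And>a. a \<in> d 0 \<Longrightarrow> P 0 a;
      \<And>n x v. \<lbrakk>x \<in> d 1; v \<in> d n; P n v\<rbrakk> \<Longrightarrow> P (Suc n) (x \<otimes> v);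
      \<And>n u v. \<lbrakk>u \<in> d n; v \<in> d n; P n u; P n v\<rbrakk> \<Longrightarrow> P n (u \<oplus> v);
      \<And>n. P n \<zero>\<rbrakk> \<Longrightarrow> P n u"

lemmas (in generated_bracket) d_induct [consumes 1, case_names deg0 mult add zero] = generated

text \<open>Only the source is generated in low degrees. Brackets are compared on the degrees (1,1)
  and (1,0): skew-symmetry gives (0,1), and brackets of degree (0,0) vanish.\<close>

locale bracket_map = generated_bracket E d b t + E': twisted_bracket E' d' b' t'
  for E :: "('r, 'g, 'x) module_scheme" (structure) and d b t
    and E' :: "('r, 'h, 'y) module_scheme" and d' b' t' +
  fixes h :: "'g \<Rightarrow> 'h"
  assumes h_closed [simp]: "u \<in> carrier E \<Longrightarrow> h u \<in> carrier E'"
    and h_add: "u \<in> carrier E \<Longrightarrow> v \<in> carrier E \<Longrightarrow> h (u \<oplus> v) = h u \<oplus>\<^bsub>E'\<^esub> h v"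
    and h_mult: "u \<in> carrier E \<Longrightarrow> v \<in> carrier E \<Longrightarrow> h (u \<otimes> v) = h u \<otimes>\<^bsub>E'\<^esub> h v"
    and h_d [simp]: "u \<in> d n \<Longrightarrow> h u \<in> d' n"
    and h_t: "u \<in> carrier E \<Longrightarrow> h (t u) = t' (h u)"
    and h_b_1_1: "x \<in> d 1 \<Longrightarrow> y \<in> d 1 \<Longrightarrow> h (b x y) = b' (h x) (h y)"
    and h_b_1_0: "x \<in> d 1 \<Longrightarrow> a \<in> d 0 \<Longrightarrow> h (b x a) = b' (h x) (h a)"
begin

lemma h_zero [simp]: "h \<zero> = \<zero>\<^bsub>E'\<^esub>"
  by (rule E'.additive_zero[of E h]) (simp_all add: h_add abelian_group_axioms)

lemma h_minus: "u \<in> carrier E \<Longrightarrow> h (\<ominus> u) = \<ominus>\<^bsub>E'\<^esub> h u"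
  by (rule E'.additive_minus[of E h]) (simp_all add: h_add abelian_group_axioms)

lemma h_signed: "u \<in> carrier E \<Longrightarrow> h (signed E k u) = signed E' k (h u)"
  by (simp add: signed_def h_minus)

text \<open>For fixed \<open>u\<close> both sides are derivations in \<open>v\<close> along
  \<open>h\<close>, with the same twist by \<open>h_t\<close>; so they agree once they agree on
  generators.\<close>

lemma h_b_extend:
  assumes u: "u \<in> d i" and v: "v \<in> d j"
    and 0: "\<And>a. a \<in> d 0 \<Longrightarrow> h (b u a) = b' (h u) (h a)"
    and 1: "\<And>x. x \<in> d 1 \<Longrightarrow> h (b u x) = b' (h u) (h x)"
  shows "h (b u v) = b' (h u) (h v)"
  using v
proof (induction rule: d_induct)
  case mult: (mult n x v)
  note 2 = mult
  have "h (b u (x \<otimes> v)) = h (b u x) \<otimes>\<^bsub>E'\<^esub> h (t v) \<oplus>\<^bsub>E'\<^esub> signed E' (int i - 1) (h (t x) \<otimes>\<^bsub>E'\<^esub> h (b u v))"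
    using b_leibniz[OF u 2(1,2)] u 2 by (simp add: h_add h_mult h_signed)
  also have "\<dots> = b' (h u) (h x \<otimes>\<^bsub>E'\<^esub> h v)"
    using E'.b_leibniz[OF h_d[OF u] h_d[OF 2(1)] h_d[OF 2(2)]] 1[OF 2(1)] u 2 by (simp add: h_t)
  finally show ?case using 2 by (simp add: h_mult)
qed (use u 0 in \<open>simp_all add: b_add_right E'.b_add_right h_add\<close>)

lemma h_b_swap:
  assumes "u \<in> d i" "v \<in> d j" "h (b u v) = b' (h u) (h v)"
  shows "h (b v u) = b' (h v) (h u)"
  using assms skew[OF assms(2,1)] E'.skew[OF h_d[OF assms(2)] h_d[OF assms(1)]]
  by (simp add: h_minus h_signed)

text \<open>\<open>h_b_extend\<close> frees only the second argument. It is applied with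
  \<open>u\<close> of degree 1 and of degree 0; after an exchange by \<open>h_b_swap\<close> these
  results are its hypotheses for arbitrary \<open>u\<close>.\<close>

lemma h_b:
  assumes u: "u \<in> d i" and v: "v \<in> d j"
  shows "h (b u v) = b' (h u) (h v)"
proof -
  have x: "h (b x w) = b' (h x) (h w)" if "x \<in> d 1" "w \<in> d k" for x w k
    using that by (rule h_b_extend) (use that in \<open>simp_all only: h_b_1_0 h_b_1_1\<close>)
  have a: "h (b a w) = b' (h a) (h w)" if a: "a \<in> d 0" and "w \<in> d k" for a w k
    using that
  proof (rule h_b_extend)
    show "h (b a c) = b' (h a) (h c)" if "c \<in> d 0" for c
      using that a by (simp add: b_dg_0 E'.b_dg_0[of "h a" "h c"])
    show "h (b a x) = b' (h a) (h x)" if "x \<in> d 1" for x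
      using that a h_b_1_0 by (intro h_b_swap[of x 1 a 0])
  qed
  show ?thesis using u v
    by (rule h_b_extend) (use u x a in \<open>auto intro: h_b_swap\<close>)
qed

end

section \<open>The graded Jacobi identity\<close>

context generated_bracket
begin

text \<open>The graded Jacobi identity in Leibniz form: both sides are derivations in \<open>w\<close>, twisted by
  \<open>t \<circ> t\<close>.\<close>

definition jacobi_leibniz :: "nat \<Rightarrow> nat \<Rightarrow> 'g \<Rightarrow> 'g \<Rightarrow> 'g \<Rightarrow> bool" where
  "jacobi_leibniz i j u v w \<longleftrightarrow> b (t u) (b v w) =
     b (b u v) (t w) \<oplus> signed E ((int i - 1) * (int j - 1)) (b (t v) (b u w))"

definition jacobi :: "nat \<Rightarrow> nat \<Rightarrow> nat \<Rightarrow> 'g \<Rightarrow> 'g \<Rightarrow> 'g \<Rightarrow> bool" where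
  "jacobi i j k u v w \<longleftrightarrow>
     signed E ((int i - 1) * (int k - 1)) (b (t u) (b v w)) \<oplus>
     signed E ((int j - 1) * (int i - 1)) (b (t v) (b w u)) \<oplus>
     signed E ((int k - 1) * (int j - 1)) (b (t w) (b u v)) = \<zero>"

lemma jacobi_rotate:
  "u \<in> d i \<Longrightarrow> v \<in> d j \<Longrightarrow> w \<in> d k \<Longrightarrow> jacobi i j k u v w \<Longrightarrow> jacobi j k i v w u"
  by (simp add: jacobi_def a_ac)

lemma minus_eq_zero_iff: "x \<in> carrier E \<Longrightarrow> y \<in> carrier E \<Longrightarrow> x \<ominus> y = \<zero> \<longleftrightarrow> x = y"
  by (metis a_inv_closed a_minus_def minus_equality minus_minus r_neg)

lemma signed_eq_zero: "x \<in> carrier E \<Longrightarrow> signed E k x = \<zero> \<longleftrightarrow> x = \<zero>"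
  by (auto simp: signed_def)

text \<open>The cyclic form is invariant under rotation, the Leibniz form suits induction on the
  last argument. Skew-symmetry, applied to the inner bracket of one term and the outer bracket of
  another, turns one into the other up to the factor of sign \<open>?s\<close>.\<close>

lemma jacobi_iff:
  assumes u: "u \<in> d i" and v: "v \<in> d j" and w: "w \<in> d k"
  shows "jacobi i j k u v w \<longleftrightarrow> jacobi_leibniz i j u v w"
proof -
  let ?X = "b (t u) (b v w)" and ?Y = "b (t v) (b u w)" and ?Z = "b (b u v) (t w)"
  let ?s = "(int i - 1) * (int k - 1)"
  have c: "?X \<in> carrier E" "?Y \<in> carrier E" "?Z \<in> carrier E" using u v w by simp_all
  have 1: "b (t v) (b w u) = \<ominus> signed E ((int k - 1) * (int i - 1)) ?Y"
    using skew[OF w u] u v w by (simp add: b_minus_right b_signed_right)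
  have 2: "b (t w) (b u v) = \<ominus> signed E ((int k - 1) * (int i + int j - 2)) ?Z"
    using skew_bracket[OF u v t_d[OF w]] by simp
  have "jacobi i j k u v w \<longleftrightarrow>
      signed E ?s (?X \<ominus> (?Z \<oplus> signed E ((int i - 1) * (int j - 1)) ?Y)) = \<zero>"
    using c unfolding jacobi_def 1 2
    by (cases "even i"; cases "even j"; cases "even k")
      (simp_all add: signed_def a_minus_def minus_add a_ac)
  also have "\<dots> \<longleftrightarrow> jacobi_leibniz i j u v w"
    using c unfolding jacobi_leibniz_def
    by (subst signed_eq_zero) (simp_all only: minus_eq_zero_iff a_closed signed_closed minus_closed)
  finally show ?thesis .
qed

lemma jacobi_extend:
  assumes t_b: "\<And>i j u v. u \<in> d i \<Longrightarrow> v \<in> d j \<Longrightarrow> t (b u v) = b (t u) (t v)"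
    and u: "u \<in> d i" and v: "v \<in> d j" and w: "w \<in> d k"
    and 0: "\<And>a. a \<in> d 0 \<Longrightarrow> jacobi i j 0 u v a"
    and 1: "\<And>x. x \<in> d 1 \<Longrightarrow> jacobi i j 1 u v x"
  shows "jacobi i j k u v w"
proof -
  have "jacobi_leibniz i j u v w" using w
  proof (induction rule: d_induct)
    case (deg0 a)
    then show ?case using 0[OF deg0] jacobi_iff[OF u v] by simp
  next
    case mult: (mult n x w)
    note 2 = mult
    have IH: "b (t u) (b v w) = b (b u v) (t w) \<oplus> signed E ((int i - 1) * (int j - 1)) (b (t v) (b u w))"
      and X: "b (t u) (b v x) = b (b u v) (t x) \<oplus> signed E ((int i - 1) * (int j - 1)) (b (t v) (b u x))"
      using 2(3) jacobi_iff[OF u v 2(1)] assms(6)[OF 2(1)] by (simp_all add: jacobi_leibniz_def)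
    \<comment> \<open>In the Leibniz expansion of the three brackets \<open>?P\<close> and
      \<open>?Q\<close> are the mixed terms, which occur on both sides with equal signs. The
      remaining terms are governed by the identity for \<open>x\<close> and by the one for
      \<open>w\<close>.\<close>
    let ?P = "t (b v x) \<otimes> t (b u w)" and ?Q = "t (b u x) \<otimes> t (b v w)"
    let ?A = "b (b u v) (t x) \<otimes> t (t w)" and ?B = "b (t v) (b u x) \<otimes> t (t w)"
    let ?C = "t (t x) \<otimes> b (b u v) (t w)" and ?D = "t (t x) \<otimes> b (t v) (b u w)"
    have c: "?P \<in> carrier E" "?Q \<in> carrier E" "?A \<in> carrier E" "?B \<in> carrier E" "?C \<in> carrier E"
      "?D \<in> carrier E" "b u v \<in> carrier E" "b v x \<in> carrier E" "b u x \<in> carrier E"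
      "b v w \<in> carrier E" "b u w \<in> carrier E" "b (t v) (b u x) \<in> carrier E" "b (b u v) (t x) \<in> carrier E"
      "b (b u v) (t w) \<in> carrier E" "b (t v) (b u w) \<in> carrier E"
      using u v 2 by simp_all
    \<comment> \<open>Here the multiplicativity of the twist enters: it turns the mixed products of
      both iterated brackets into the same \<open>?P\<close> and \<open>?Q\<close>.\<close>
    have tb: "b (t u) (t x) = t (b u x)" "b (t v) (t x) = t (b v x)"
      "b (t u) (t w) = t (b u w)" "b (t v) (t w) = t (b v w)"
      using t_b[OF u 2(1)] t_b[OF v 2(1)] t_b[OF u 2(2)] t_b[OF v 2(2)] by simp_all
    have dv: "b v x \<in> d j" and du: "b u x \<in> d i"
      using u v 2 by (auto intro: b_dg)
    have L: "b (t u) (b v (x \<otimes> w)) = b (t u) (b v x) \<otimes> t (t w) \<oplus> signed E ((int i - 1) * int j) ?P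
        \<oplus> signed E (int j - 1) (?Q \<oplus> signed E (int i - 1) (t (t x) \<otimes> b (t u) (b v w)))"
      using b_leibniz[OF v 2(1,2)] b_leibniz[OF t_d[OF u] dv t_d[OF 2(2)]]
        leibniz_mult_bracket[OF t_d[OF u] t_d[OF 2(1)] v 2(2)] u v 2 c
      by (simp add: b_add_right b_signed_right tb)
    have R: "b (t v) (b u (x \<otimes> w)) = ?B \<oplus> signed E ((int j - 1) * int i) ?Q
        \<oplus> signed E (int i - 1) (?P \<oplus> signed E (int j - 1) ?D)"
      using b_leibniz[OF u 2(1,2)] b_leibniz[OF t_d[OF v] du t_d[OF 2(2)]]
        leibniz_mult_bracket[OF t_d[OF v] t_d[OF 2(1)] u 2(2)] u v 2 c
      by (simp add: b_add_right b_signed_right tb)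
    have M: "b (b u v) (t (x \<otimes> w)) = ?A \<oplus> signed E (int i + int j - 2) ?C"
      using leibniz_bracket[OF u v t_d[OF 2(1)] t_d[OF 2(2)]] 2 by (simp add: t_mult)
    have XX: "b (t u) (b v x) \<otimes> t (t w) = ?A \<oplus> signed E ((int i - 1) * (int j - 1)) ?B"
      using X 2 c by (simp add: l_distr signed_mult_left)
    have YY: "t (t x) \<otimes> b (t u) (b v w) = ?C \<oplus> signed E ((int i - 1) * (int j - 1)) ?D"
      using IH 2 c by (simp add: r_distr signed_mult_right)
    show ?case unfolding jacobi_leibniz_def L R M XX YY using c(1-6)
      by (cases "even i"; cases "even j") (simp_all add: signed_def minus_add a_ac)
  next
    case (add n w w')
    then show ?case using u v
      by (simp add: jacobi_leibniz_def b_add_right t_add signed_add a_ac)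
  qed (use u v in \<open>simp add: jacobi_leibniz_def\<close>)
  then show ?thesis using jacobi_iff[OF u v w] by simp
qed

text \<open>\<open>jacobi_extend\<close> frees the last argument only. Three uses of it, separated
  by rotations, free all three: \<open>G\<close> has every degree at most 1, \<open>G1\<close> one
  free argument, \<open>G2\<close> two.\<close>

lemma jacobi:
  assumes t_b: "\<And>i j u v. u \<in> d i \<Longrightarrow> v \<in> d j \<Longrightarrow> t (b u v) = b (t u) (t v)"
    and xyz: "\<And>x y z. x \<in> d 1 \<Longrightarrow> y \<in> d 1 \<Longrightarrow> z \<in> d 1 \<Longrightarrow> jacobi 1 1 1 x y z"
    and xya: "\<And>x y a. x \<in> d 1 \<Longrightarrow> y \<in> d 1 \<Longrightarrow> a \<in> d 0 \<Longrightarrow> jacobi 1 1 0 x y a"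
    and u: "u \<in> d i" and v: "v \<in> d j" and w: "w \<in> d k"
  shows "jacobi i j k u v w"
proof -
  note rot = jacobi_rotate
  \<comment> \<open>Each inner bracket is zero or has degree 0, so each outer bracket is one of two
    elements of degree 0 and vanishes.\<close>
  have xaa: "jacobi 1 0 0 x a c" if "x \<in> d 1" "a \<in> d 0" "c \<in> d 0" for x a c
  proof -
    have "b c x \<in> d 0" "b x a \<in> d 0" using that by (auto intro: b_dg)
    then show ?thesis using that by (simp add: jacobi_def b_dg_0)
  qed
  have aaa: "jacobi 0 0 0 a c e" if "a \<in> d 0" "c \<in> d 0" "e \<in> d 0" for a c e
    using that by (simp add: jacobi_def b_dg_0)
  \<comment> \<open>Of the eight patterns of degrees, 111, 110, 100 and 000 are at hand; the other
    four are rotations of 110 and 100.\<close>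
  have G: "jacobi i j k u v w"
    if "i \<le> 1" "j \<le> 1" "k \<le> 1" "u \<in> d i" "v \<in> d j" "w \<in> d k" for i j k u v w
  proof -
    have "i = 0 \<or> i = 1" "j = 0 \<or> j = 1" "k = 0 \<or> k = 1" using that by auto
    moreover have "jacobi 1 0 1 u v w" if "u \<in> d 1" "v \<in> d 0" "w \<in> d 1" for u v w
      using rot[OF that(3) that(1) that(2) xya[OF that(3) that(1) that(2)]] .
    moreover have "jacobi 0 1 1 u v w" if "u \<in> d 0" "v \<in> d 1" "w \<in> d 1" for u v w
      using rot[OF that(3) that(1) that(2) calculation(4)[OF that(3) that(1) that(2)]] .
    moreover have "jacobi 0 0 1 u v w" if "u \<in> d 0" "v \<in> d 0" "w \<in> d 1" for u v w
      using rot[OF that(3) that(1) that(2) xaa[OF that(3) that(1) that(2)]] .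
    moreover have "jacobi 0 1 0 u v w" if "u \<in> d 0" "v \<in> d 1" "w \<in> d 0" for u v w
      using rot[OF that(3) that(1) that(2) calculation(6)[OF that(3) that(1) that(2)]] .
    ultimately show ?thesis using that(4-6) xyz xya xaa aaa by (elim disjE) simp_all
  qed
  have G1: "jacobi i j k u v w"
    if "i \<le> 1" "j \<le> 1" "u \<in> d i" "v \<in> d j" "w \<in> d k" for i j k u v w
    by (rule jacobi_extend[OF t_b that(3-5)]) (use that in \<open>auto intro: G\<close>)
  have G2: "jacobi k i j w u v"
    if "i \<le> 1" "u \<in> d i" "v \<in> d j" "w \<in> d k" for i j k u v w
  proof (rule jacobi_extend[OF t_b that(4,2,3)])
    show "jacobi k i 0 w u a" if "a \<in> d 0" for a
      using that \<open>i \<le> 1\<close> \<open>u \<in> d i\<close> \<open>w \<in> d k\<close> G1[of i 0 u a w k] rot[of u i a 0 w k] rot[of a 0 w k u i]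
      by simp
    show "jacobi k i 1 w u a" if "a \<in> d 1" for a
      using that \<open>i \<le> 1\<close> \<open>u \<in> d i\<close> \<open>w \<in> d k\<close> G1[of i 1 u a w k] rot[of u i a 1 w k] rot[of a 1 w k u i]
      by simp
  qed
  show ?thesis
  proof (rule jacobi_extend[OF t_b u v w])
    show "jacobi i j 0 u v a" if "a \<in> d 0" for a
      using G2[of 0 a u i v j] that u v rot[of v j a 0 u i] rot[of a 0 u i v j] by simp
    show "jacobi i j 1 u v a" if "a \<in> d 1" for a
      using G2[of 1 a u i v j] that u v rot[of v j a 1 u i] rot[of a 1 u i v j] by simp
  qed
qed

end

section \<open>Leibniz rule, skew-symmetry and Jacobi identity for the constructed bracket\<close>

context hlr
begin

lemma rho_one: "x \<in> carrier L \<Longrightarrow> \<rho> x \<one> = \<zero>"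
  using rho_mult[of x \<one> \<one>] by (simp add: phi_one)

lemma dx_gn: "x \<in> carrier L \<Longrightarrow> y \<in> carrier L \<Longrightarrow> dx x (gn y) = gn (br x y)"
  using dx_gn_mult[of x y "\<one>\<^bsub>E\<^esub>"] dx_sc[of x \<one>] by (simp add: sc_one tw.lift_one rho_one sc_zero)

lemma da_gn: "c \<in> carrier A \<Longrightarrow> y \<in> carrier L \<Longrightarrow> da c (gn y) = \<ominus>\<^bsub>E\<^esub> sc (\<rho> y c)"
  using da_gn_mult[of c y "\<one>\<^bsub>E\<^esub>"] da_sc[of c \<one>] by (simp add: sc_one tw.lift_one)

lemma dx_zero [simp]: "x \<in> carrier L \<Longrightarrow> dx x \<^bold>0 = \<^bold>0"
  using dx_sc[of x \<zero>] by (simp add: sc_zero rho_zero)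

lemma da_zero [simp]: "c \<in> carrier A \<Longrightarrow> da c \<^bold>0 = \<^bold>0"
  using da_sc[of c \<zero>] by (simp add: sc_zero)

lemma dx_dg [simp]: "x \<in> carrier L \<Longrightarrow> v \<in> dg m \<Longrightarrow> dx x v \<in> dg m"
proof (rotate_tac, induction rule: dg_induct)
  case (gn n y v)
  then show ?case by (simp add: dx_gn_mult)
qed (simp_all add: dx_sc dx_add)

lemma da_dg: "c \<in> carrier A \<Longrightarrow> v \<in> dg m \<Longrightarrow> (m = 0 \<longrightarrow> da c v = \<^bold>0) \<and> (\<forall>k. m = Suc k \<longrightarrow> da c v \<in> dg k)"
proof (rotate_tac, induction rule: dg_induct)
  case (gn n y v)
  then have "gn (\<alpha> y) \<cdot> da c v \<in> dg n" by (cases n) simp_all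
  then show ?case using gn by (simp add: da_gn_mult)
qed (simp_all add: da_sc da_add)

lemma b0_dg:
  assumes "u \<in> dg n" "v \<in> dg m"
  shows "(n + m = 0 \<longrightarrow> b0 u v = \<^bold>0) \<and> (\<forall>k. n + m = Suc k \<longrightarrow> b0 u v \<in> dg k)"
  using assms(1)
proof (induction rule: dg_induct)
  case (sc a)
  then show ?case using assms da_dg[of a v m] by (simp add: b0_sc)
next
  case (gn n x u)
  have "gn (\<alpha> x) \<cdot> b0 u v \<in> dg (n + m)"
    using gn by (cases "n + m") simp_all
  moreover have "sg (tw u) \<cdot> dx x v \<in> dg (n + m)"
    using gn assms by (simp add: sg_dg[OF tw_dg] dg_mult)
  ultimately show ?case using gn by (simp add: b0_gn_mult)
qed (simp_all add: b0_add_left)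

lemma b0_sc_right:
  assumes u: "u \<in> dg n" and a: "a \<in> carrier A" and w: "w \<in> carrier E"
  shows "b0 u (sc a \<cdot> w) = b0 u (sc a) \<cdot> tw w \<^bold>+ sc (\<phi> a) \<cdot> b0 u w"
  using u
proof (induction rule: dg_induct)
  case (sc c)
  then show ?case using a w by (simp add: b0_sc da_sc_mult da_sc)
next
  case (gn n x u)
  have "sg (tw u) \<cdot> (sc (\<phi> a) \<cdot> dx x w) = sc (\<phi> a) \<cdot> (sg (tw u) \<cdot> dx x w)"
    using gn a w by (intro sc_left_comm) auto
  then show ?case using gn a w
    by (simp add: b0_gn_mult dx_sc_mult dx_sc E.r_distr E.l_distr E.m_assoc gn_sc E.a_ac)
next
  case (add n u v)
  then show ?case using a w by (simp add: b0_add_left E.r_distr E.l_distr E.a_ac)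
qed (use a w in simp)

text \<open>The sign arises from bringing \<open>\<alpha>(y)\<close> to the front: past
  \<open>sg (tw u)\<close> it costs \<open>(-1)^n\<close>, and past the new letter
  \<open>\<alpha>(x)\<close> one more sign.\<close>

lemma b0_gn_right:
  assumes u: "u \<in> dg n" and y: "y \<in> carrier L" and w: "w \<in> carrier E"
  shows "b0 u (gn y \<cdot> w) = b0 u (gn y) \<cdot> tw w \<^bold>+ signed E (int n - 1) (gn (\<alpha> y) \<cdot> b0 u w)"
  using u
proof (induction rule: dg_induct)
  case (sc c)
  then show ?case using y w by (simp add: b0_sc da_gn_mult da_gn E.minus_add E.l_minus signed_def)
next
  case (gn n x u)
  let ?S = "sg (tw u)"
  have S: "?S \<cdot> (gn (\<alpha> y) \<cdot> v) = signed E (int n) (gn (\<alpha> y) \<cdot> (?S \<cdot> v))" if "v \<in> carrier E" for v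
  proof -
    have "?S \<cdot> gn (\<alpha> y) = gn (\<alpha> y) \<cdot> tw u" using gn y by (simp add: sg_gn)
    moreover have "tw u = signed E (int n) ?S"
      using gn by (simp add: sg_dg[OF tw_dg] E.signed_signed) (simp add: signed_def)
    ultimately have "?S \<cdot> gn (\<alpha> y) = signed E (int n) (gn (\<alpha> y) \<cdot> ?S)"
      using gn y by (metis E.signed_mult_right alpha_closed dg_closed gn_closed inv.lift_closed tw.lift_closed)
    then show ?thesis
      using gn y that by (simp add: E.m_assoc[symmetric] E.signed_mult_left)
  qed
  have xy: "gn (\<alpha> x) \<cdot> (gn (\<alpha> y) \<cdot> v) = \<ominus>\<^bsub>E\<^esub> (gn (\<alpha> y) \<cdot> (gn (\<alpha> x) \<cdot> v))" if "v \<in> carrier E" for v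
    using gn(1) y that gn_anticomm[of "\<alpha> x" "\<alpha> y"] by (simp add: E.m_assoc[symmetric] E.l_minus)
  show ?case using gn y w
    by (cases "even n")
      (simp_all add: b0_gn_mult dx_gn_mult dx_gn S xy E.r_distr E.l_distr E.m_assoc E.a_ac signed_def
        E.r_minus E.l_minus E.minus_add)
next
  case (add n u v)
  then show ?case using y w by (simp add: b0_add_left E.r_distr E.l_distr E.signed_add E.a_ac)
qed (use y w in simp)

lemma b0_leibniz:
  assumes u: "u \<in> dg i" and v: "v \<in> dg j" and w: "w \<in> carrier E"
  shows "b0 u (v \<cdot> w) = b0 u v \<cdot> tw w \<^bold>+ signed E ((int i - 1) * int j) (tw v \<cdot> b0 u w)"
  using v
proof (induction rule: dg_induct)
  case (sc a)
  then show ?case using u w by (simp add: b0_sc_right tw.lift_sc) (simp add: signed_def)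
next
  case (gn n y v)
  then show ?case using u w
    by (cases "even i"; cases "even n")
      (simp_all add: b0_gn_right[OF u] tw.lift_gn tw.lift_gn_mult tw.lift_mult E.m_assoc E.r_distr E.l_distr
        E.a_ac signed_def E.r_minus E.l_minus E.minus_add)
next
  case (add n v v')
  then show ?case using u w
    by (simp add: b0_add_right tw.lift_add E.r_distr E.l_distr E.signed_add E.a_ac)
qed (use u w in \<open>simp add: tw.lift_zero\<close>)

lemma b0_sc_skew:
  assumes a: "a \<in> carrier A" and v: "v \<in> dg m"
  shows "b0 v (sc a) = signed E (int m) (da a v)"
  using v
proof (induction rule: dg_induct)
  case (sc c)
  then show ?case using a by (simp add: b0_sc da_sc)
next
  case (gn n y v)
  have "sg (tw v) = signed E (int n) (tw v)" using gn by (intro sg_dg tw_dg)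
  moreover have "tw v \<cdot> sc (\<rho> y a) = sc (\<rho> y a) \<cdot> tw v" using gn a by (intro sc_central) auto
  ultimately show ?case using gn a
    by (cases "even n")
      (simp_all add: b0_gn_mult dx_sc da_gn_mult E.signed_mult_left signed_def E.minus_add E.r_minus
        E.l_minus E.a_comm)
next
  case (add n u v)
  then show ?case using a by (simp add: b0_add_left da_add E.signed_add)
qed (use a in simp)

lemma b0_gn_skew:
  assumes x: "x \<in> carrier L" and v: "v \<in> dg m"
  shows "b0 v (gn x) = \<ominus>\<^bsub>E\<^esub> dx x v"
  using v
proof (induction rule: dg_induct)
  case (sc c)
  then show ?case using x by (simp add: b0_sc da_gn dx_sc)
next
  case (gn n y v)
  have "gn (br y x) = \<ominus>\<^bsub>E\<^esub> gn (br x y)"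
    using gn x br_skew[of y x] by (simp add: gn_minus)
  moreover have "sg (tw v) \<cdot> gn (br x y) = gn (br x y) \<cdot> tw v"
    using gn x by (intro sg_gn) auto
  ultimately show ?case using gn x
    by (simp add: b0_gn_mult dx_gn dx_gn_mult E.minus_add E.r_minus E.a_comm)
next
  case (add n u v)
  then show ?case using x by (simp add: b0_add_left dx_add E.minus_add)
qed (use x in simp)

text \<open>Hidden in the construction, which treats the two arguments by different recursions. The
  left recursion for \<open>[x u, v]\<close> is matched with the right Leibniz rule for
  \<open>[v, x u]\<close>, whose first term is known from \<open>b0_gn_skew\<close>.\<close>

lemma b0_skew:
  assumes u: "u \<in> dg i" and v: "v \<in> dg j"
  shows "b0 u v = \<ominus>\<^bsub>E\<^esub> signed E ((int i - 1) * (int j - 1)) (b0 v u)"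
  using u
proof (induction rule: dg_induct)
  case (sc a)
  then show ?case using v by (simp add: b0_sc b0_sc_skew[OF sc v] E.signed_signed) (simp add: signed_def)
next
  case (gn n x u)
  \<comment> \<open>The two expansions place the factor \<open>[x, v]\<close> on opposite sides of
    \<open>tw u\<close>; graded commutativity accounts for the exchange.\<close>
  have 1: "sg (tw u) \<cdot> dx x v = signed E (int n + int n * int j) (dx x v \<cdot> tw u)"
    using gn v dg_comm[of "tw u" n "dx x v" j]
    by (simp add: sg_dg[OF tw_dg] E.signed_mult_left E.signed_signed)
  have 2: "b0 u v = \<ominus>\<^bsub>E\<^esub> signed E ((int n - 1) * (int j - 1)) (b0 v u)" by (rule gn)
  show ?case using gn(1,2) v
    by (cases "even n"; cases "even j")
      (simp_all add: b0_gn_mult 1 2 b0_gn_right[OF v] b0_gn_skew[OF _ v] signed_def E.minus_add E.r_minus E.l_minus E.a_comm)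
next
  case (add n u w)
  then show ?case using v by (simp add: b0_add_left b0_add_right E.signed_add E.minus_add E.a_ac)
qed (use v in simp)

text \<open>The bracket \<^const>\<open>b0\<close>, with the junk value that \<^const>\<open>is_exterior_bracket\<close> prescribes.\<close>

definition bb :: "('l list \<Rightarrow> 'a) set \<Rightarrow> ('l list \<Rightarrow> 'a) set \<Rightarrow> ('l list \<Rightarrow> 'a) set" where
  "bb u v = (if u \<in> carrier E \<and> v \<in> carrier E then b0 u v else undefined)"

lemma bb_b0 [simp]: "u \<in> carrier E \<Longrightarrow> v \<in> carrier E \<Longrightarrow> bb u v = b0 u v"
  by (simp add: bb_def)

sublocale gb: generated_bracket E dg bb tw
proof (intro generated_bracket.intro twisted_bracket.intro twisted_bracket_axioms.intro E.ring_axioms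
    generated_bracket_axioms.intro)
  show "degree_minus_one E dg bb"
    unfolding degree_minus_one_def
  proof (intro allI ballI)
    fix i j u v assume "u \<in> dg i" "v \<in> dg j"
    then show "if i + j = 0 then bb u v = \<^bold>0 else bb u v \<in> dg (i + j - 1)"
      using b0_dg[of u i v j] by (cases "i + j") auto
  qed
  show "graded_skew E dg bb"
    unfolding graded_skew_def
  proof (intro allI ballI)
    fix i j u v assume uv: "u \<in> dg i" "v \<in> dg j"
    then show "bb u v = \<ominus>\<^bsub>E\<^esub> signed E ((int i - 1) * (int j - 1)) (bb v u)"
      using b0_skew[OF uv] dg_closed[OF uv(1)] dg_closed[OF uv(2)] by (simp only: bb_b0)
  qed
  show "u \<in> dg n \<Longrightarrow> v \<in> dg m \<Longrightarrow> u \<cdot> v = signed E (int n * int m) (v \<cdot> u)" for u n v m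
    by (rule dg_comm)
  show "bb u (v \<cdot> w) = bb u v \<cdot> tw w \<^bold>+ signed E ((int i - 1) * int j) (tw v \<cdot> bb u w)"
    if "u \<in> dg i" "v \<in> dg j" "w \<in> dg k" for u v w i j k
    using that by (simp add: b0_leibniz)
  show "P n u" if u: "u \<in> dg n" and P: "\<And>a. a \<in> dg 0 \<Longrightarrow> P 0 a"
    "\<And>n x v. x \<in> dg 1 \<Longrightarrow> v \<in> dg n \<Longrightarrow> P n v \<Longrightarrow> P (Suc n) (x \<cdot> v)"
    "\<And>n u v. u \<in> dg n \<Longrightarrow> v \<in> dg n \<Longrightarrow> P n u \<Longrightarrow> P n v \<Longrightarrow> P n (u \<^bold>+ v)"
    "\<And>n. P n \<^bold>0" for u n and P :: "nat \<Rightarrow> _ \<Rightarrow> bool"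
    using u by (induction rule: dg_induct) (use P in \<open>auto intro: sc_dg gn_dg\<close>)
qed (simp_all add: tw.lift_add tw.lift_mult b0_add_left b0_add_right)

text \<open>The twist is itself a \<open>bracket_map\<close> from the algebra to itself. On
  generators the claim is the multiplicativity of \<open>\<alpha>\<close> and the compatibility of
  \<open>\<rho>\<close> with \<open>\<phi>\<close>.\<close>

lemma tw_bb: "u \<in> dg i \<Longrightarrow> v \<in> dg j \<Longrightarrow> tw (bb u v) = bb (tw u) (tw v)"
proof -
  interpret tb: bracket_map E dg bb tw E dg bb tw tw
  proof unfold_locales
    show "tw (bb u v) = bb (tw u) (tw v)" if uv: "u \<in> dg 1" "v \<in> dg 1" for u v
    proof -
      obtain x y where "u = gn x" "v = gn y" "x \<in> carrier L" "y \<in> carrier L"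
        using gn_in_dg_1[OF uv(1)] gn_in_dg_1[OF uv(2)] by blast
      then show ?thesis by (simp add: b0_gn dx_gn tw.lift_gn alpha_br)
    qed
    show "tw (bb u v) = bb (tw u) (tw v)" if uv: "u \<in> dg 1" "v \<in> dg 0" for u v
    proof -
      obtain x a where "u = gn x" "v = sc a" "x \<in> carrier L" "a \<in> carrier A"
        using gn_in_dg_1[OF uv(1)] sc_in_dg_0[OF uv(2)] by blast
      then show ?thesis by (simp add: b0_gn dx_sc tw.lift_gn tw.lift_sc rho_alpha)
    qed
  qed (simp_all add: tw.lift_add tw.lift_mult)
  show "u \<in> dg i \<Longrightarrow> v \<in> dg j \<Longrightarrow> tw (bb u v) = bb (tw u) (tw v)" by (rule tb.h_b)
qed

text \<open>On three elements of \<open>L\<close> this is the hom-Jacobi identity of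
  \<open>L\<close>; on two of them and a scalar it is the condition that \<open>\<rho>\<close> be a
  representation.\<close>

lemma bb_jacobi: "u \<in> dg i \<Longrightarrow> v \<in> dg j \<Longrightarrow> w \<in> dg k \<Longrightarrow> gb.jacobi i j k u v w"
proof (rule gb.jacobi[OF tw_bb])
  show "gb.jacobi 1 1 1 u v w" if uvw: "u \<in> dg 1" "v \<in> dg 1" "w \<in> dg 1" for u v w
  proof -
    obtain x y z where xyz: "u = gn x" "v = gn y" "w = gn z" "x \<in> carrier L" "y \<in> carrier L" "z \<in> carrier L"
      using gn_in_dg_1[OF uvw(1)] gn_in_dg_1[OF uvw(2)] gn_in_dg_1[OF uvw(3)] by blast
    have "gn (br (\<alpha> x) (br y z) \<oplus>\<^bsub>L\<^esub> br (\<alpha> y) (br z x) \<oplus>\<^bsub>L\<^esub> br (\<alpha> z) (br x y)) = \<^bold>0"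
      using hom_jacobi[OF xyz(4-6)] by simp
    then show ?thesis using xyz
      by (simp add: gb.jacobi_def b0_gn dx_gn tw.lift_gn gn_add signed_def)
  qed
  show "gb.jacobi 1 1 0 u v w" if uvw: "u \<in> dg 1" "v \<in> dg 1" "w \<in> dg 0" for u v w
  proof -
    obtain x y where xy: "u = gn x" "v = gn y" "x \<in> carrier L" "y \<in> carrier L"
      using gn_in_dg_1[OF uvw(1)] gn_in_dg_1[OF uvw(2)] by blast
    obtain a where a: "w = sc a" "a \<in> carrier A" using sc_in_dg_0[OF uvw(3)] by blast
    have "sc (\<rho> (br x y) (\<phi> a)) = sc (\<rho> (\<alpha> x) (\<rho> y a)) \<^bold>+ \<ominus>\<^bsub>E\<^esub> sc (\<rho> (\<alpha> y) (\<rho> x a))"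
      using rho_br[of x y a] xy a by (simp add: a_minus_def sc_add sc_minus)
    then have "gb.jacobi_leibniz 1 1 u v w" using xy a
      by (simp add: gb.jacobi_leibniz_def b0_gn dx_gn dx_sc tw.lift_gn tw.lift_sc signed_def E.a_assoc E.l_neg)
    then show ?thesis using gb.jacobi_iff[OF uvw] by simp
  qed
qed

end

section \<open>The bracket formulas on words\<close>

lemma omit_Cons: "1 \<le> i \<Longrightarrow> omit (Suc i) (x # xs) = x # omit i xs"
  by (cases i) (simp_all add: omit_def)

lemma omit_1 [simp]: "omit (Suc 0) (x # xs) = xs"
  by (simp add: omit_def)

lemma set_omit: "set (omit i xs) \<subseteq> set xs"
  using set_take_subset[of "i - 1" xs] set_drop_subset[of i xs] by (auto simp: omit_def)

context abelian_group
begin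

lemma finsum_1_Suc:
  assumes "\<And>i. i \<in> {1..Suc n} \<Longrightarrow> f i \<in> carrier G"
  shows "(\<Oplus>i \<in> {1..Suc n}. f i) = f 1 \<oplus> (\<Oplus>i \<in> {1..n}. f (Suc i))"
proof -
  have s: "{1..Suc n} = insert 1 (Suc ` {1..n})"
    by (auto simp: image_iff gr0_conv_Suc dest: Suc_lessD)
  have "(\<Oplus>i \<in> {1..Suc n}. f i) = f 1 \<oplus> (\<Oplus>i \<in> Suc ` {1..n}. f i)"
    unfolding s using assms by (subst finsum_insert) auto
  also have "(\<Oplus>i \<in> Suc ` {1..n}. f i) = (\<Oplus>i \<in> {1..n}. f (Suc i))"
    using assms by (intro finsum_reindex) auto
  finally show ?thesis .
qed

end

context hlr
begin

lemma in_carrier_omit: "set xs \<subseteq> carrier L \<Longrightarrow> set (omit i xs) \<subseteq> carrier L"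
  using set_omit by fast

lemma in_carrier_nth: "set xs \<subseteq> carrier L \<Longrightarrow> i \<in> {1..length xs} \<Longrightarrow> xs ! (i - 1) \<in> carrier L"
  by (metis One_nat_def Suc_le_lessD Suc_pred' atLeastAtMost_iff nth_mem subsetD)

text \<open>The recursion \<open>b0_gn_mult\<close> unrolled. The first letter contributes the term
  \<open>i = 1\<close>, signed by \<open>sg\<close> of the remaining word; prepending a letter
  raises both \<open>n\<close> and \<open>i\<close> by one and so preserves the parity of
  \<open>n + i\<close>.\<close>

lemma bracket_word_scalar:
  assumes xs: "set xs \<subseteq> carrier L" and a: "a \<in> carrier A"
  shows "b0 (wdg \<one> xs) (sc a) = (\<Oplus>\<^bsub>E\<^esub> i \<in> {1..length xs}.
    signed E (int (length xs + i)) (sc (\<rho> (xs ! (i - 1)) a) \<cdot> tw (wdg \<one> (omit i xs))))"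
  using xs
proof (induction xs)
  case Nil
  \<comment> \<open>The empty word is the scalar 1, whose bracket with everything is zero, in
    agreement with the empty sum.\<close>
  have "b0 (wdg \<one> []) (sc a) = da \<one> (sc a)" using a by (simp add: sc_def[symmetric] b0_sc)
  then show ?case by (simp add: da_one)
next
  case (Cons x xs)
  let ?n = "length xs"
  define f where "f i = signed E (int (Suc ?n + i)) (sc (\<rho> ((x # xs) ! (i - 1)) a) \<cdot>
      tw (wdg \<one> (omit i (x # xs))))" for i
  have fc: "f i \<in> carrier E" if "i \<in> {1..Suc ?n}" for i
    unfolding f_def
    using that Cons.prems a in_carrier_nth[of "x # xs" i] in_carrier_omit[of "x # xs" i] by simp
  have "wdg \<one> xs \<in> dg ?n" using Cons.prems by (simp add: wdg_dg)
  then have "sg (tw (wdg \<one> xs)) \<cdot> sc (\<rho> x a) = f 1"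
    using Cons.prems a sc_central[of "\<rho> x a" "tw (wdg \<one> xs)"]
    by (simp add: f_def sg_dg[OF tw_dg] E.signed_mult_left) (simp add: signed_def)
  moreover have "gn (\<alpha> x) \<cdot> b0 (wdg \<one> xs) (sc a) = (\<Oplus>\<^bsub>E\<^esub> i \<in> {1..?n}. f (Suc i))"
  proof -
    have "gn (\<alpha> x) \<cdot> b0 (wdg \<one> xs) (sc a) = (\<Oplus>\<^bsub>E\<^esub> i \<in> {1..?n}. gn (\<alpha> x) \<cdot>
      signed E (int (?n + i)) (sc (\<rho> (xs ! (i - 1)) a) \<cdot> tw (wdg \<one> (omit i xs))))"
      using Cons a in_carrier_nth[of xs] in_carrier_omit[of xs]
      by (simp add: Cons.IH) (subst E.finsum_rdistr, auto)
    also have "\<dots> = (\<Oplus>\<^bsub>E\<^esub> i \<in> {1..?n}. f (Suc i))"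
    proof (rule E.finsum_cong')
      fix i assume i: "i \<in> {1..?n}"
      have "set (omit i xs) \<subseteq> carrier L" "xs ! (i - 1) \<in> carrier L"
        using Cons.prems i in_carrier_omit[of xs i] in_carrier_nth[of xs i] by auto
      then show "gn (\<alpha> x) \<cdot> signed E (int (?n + i)) (sc (\<rho> (xs ! (i - 1)) a) \<cdot> tw (wdg \<one> (omit i xs)))
          = f (Suc i)"
        using Cons.prems a i
        by (simp add: f_def omit_Cons wdg_Cons tw.lift_gn_mult E.signed_mult_right gn_sc)
          (simp add: signed_def)
    qed (use fc in auto)
    finally show ?thesis .
  qed
  ultimately have "b0 (wdg \<one> (x # xs)) (sc a) = (\<Oplus>\<^bsub>E\<^esub> i \<in> {1..?n}. f (Suc i)) \<^bold>+ f 1"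
    using Cons.prems a by (simp add: wdg_Cons b0_gn_mult dx_sc)
  also have "\<dots> = (\<Oplus>\<^bsub>E\<^esub> i \<in> {1..Suc ?n}. f i)"
    using fc by (subst E.finsum_1_Suc) (auto intro!: E.a_comm E.finsum_closed)
  finally show ?case by (simp add: f_def)
qed

text \<open>The row \<open>i = 1\<close> of the double sum. A letter put in front of the word
  contributes \<open>\<alpha>(y)\<close>, which has to pass the bracket standing first; this sign is
  the step from \<open>j\<close> to \<open>j + 1\<close>.\<close>

lemma dx_word:
  assumes x: "x \<in> carrier L" and ys: "set ys \<subseteq> carrier L"
  shows "dx x (wdg \<one> ys) = (\<Oplus>\<^bsub>E\<^esub> j \<in> {1..length ys}.
    signed E (1 + int j) (gn (br x (ys ! (j - 1))) \<cdot> tw (wdg \<one> (omit j ys))))"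
  using ys
proof (induction ys)
  case Nil
  then show ?case using x dx_sc[of x \<one>] by (simp add: sc_def rho_one wdg_zero)
next
  case (Cons y ys)
  let ?n = "length ys"
  define f where "f j = signed E (1 + int j) (gn (br x ((y # ys) ! (j - 1))) \<cdot>
      tw (wdg \<one> (omit j (y # ys))))" for j
  have fc: "f i \<in> carrier E" if "i \<in> {1..Suc ?n}" for i
    unfolding f_def
    using that Cons.prems x in_carrier_nth[of "y # ys" i] in_carrier_omit[of "y # ys" i] by simp
  have 1: "gn (br x y) \<cdot> tw (wdg \<one> ys) = f 1"
    using Cons.prems x by (simp add: f_def) (simp add: signed_def)
  have "gn (\<alpha> y) \<cdot> dx x (wdg \<one> ys) = (\<Oplus>\<^bsub>E\<^esub> j \<in> {1..?n}. gn (\<alpha> y) \<cdot>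
      signed E (1 + int j) (gn (br x (ys ! (j - 1))) \<cdot> tw (wdg \<one> (omit j ys))))"
    using Cons x in_carrier_nth[of ys] in_carrier_omit[of ys]
    by (simp add: Cons.IH) (subst E.finsum_rdistr, auto)
  also have "\<dots> = (\<Oplus>\<^bsub>E\<^esub> j \<in> {1..?n}. f (Suc j))"
  proof (rule E.finsum_cong')
    fix j assume j: "j \<in> {1..?n}"
    let ?z = "br x (ys ! (j - 1))" and ?w = "tw (wdg \<one> (omit j ys))"
    have c: "set (omit j ys) \<subseteq> carrier L" "ys ! (j - 1) \<in> carrier L"
      using Cons.prems j in_carrier_omit[of ys j] in_carrier_nth[of ys j] by auto
    have "gn (\<alpha> y) \<cdot> (gn ?z \<cdot> ?w) = \<ominus>\<^bsub>E\<^esub> (gn ?z \<cdot> (gn (\<alpha> y) \<cdot> ?w))"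
      using Cons.prems x c gn_anticomm[of "\<alpha> y" ?z] by (simp add: E.m_assoc[symmetric] E.l_minus)
    then show "gn (\<alpha> y) \<cdot> signed E (1 + int j) (gn ?z \<cdot> ?w) = f (Suc j)"
      using Cons.prems x j c
      by (simp add: f_def omit_Cons wdg_Cons tw.lift_gn_mult E.signed_mult_right)
        (simp add: signed_def)
  qed (use fc in auto)
  finally have "dx x (wdg \<one> (y # ys)) = f 1 \<^bold>+ (\<Oplus>\<^bsub>E\<^esub> j \<in> {1..?n}. f (Suc j))"
    using Cons.prems x by (simp add: wdg_Cons dx_gn_mult 1)
  also have "\<dots> = (\<Oplus>\<^bsub>E\<^esub> i \<in> {1..Suc ?n}. f i)"
    using fc by (subst E.finsum_1_Suc) auto
  finally show ?case by (simp add: f_def)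
qed

text \<open>In the row of the first letter, the sign of \<open>sg\<close> is used up in moving the
  bracket past the rest of \<open>xs\<close>, so the length of \<open>xs\<close> leaves no trace. In
  the other rows \<open>\<alpha>(x)\<close> passes the bracket in front, which is the step from
  \<open>i\<close> to \<open>i + 1\<close>.\<close>

lemma bracket_word_word:
  assumes xs: "set xs \<subseteq> carrier L" and ys: "set ys \<subseteq> carrier L"
  shows "b0 (wdg \<one> xs) (wdg \<one> ys) = (\<Oplus>\<^bsub>E\<^esub> i \<in> {1..length xs}. \<Oplus>\<^bsub>E\<^esub> j \<in> {1..length ys}.
    signed E (int (i + j)) (gn (br (xs ! (i - 1)) (ys ! (j - 1))) \<cdot> tw (wdg \<one> (omit i xs @ omit j ys))))"
  using xs
proof (induction xs)
  case Nil
  have "b0 (wdg \<one> []) (wdg \<one> ys) = da \<one> (wdg \<one> ys)" using ys by (simp add: sc_def[symmetric] b0_sc)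
  then show ?case by (simp add: da_one)
next
  case (Cons x xs)
  let ?n = "length xs" and ?m = "length ys"
  define g where "g i j = signed E (int (i + j)) (gn (br ((x # xs) ! (i - 1)) (ys ! (j - 1))) \<cdot>
      tw (wdg \<one> (omit i (x # xs) @ omit j ys)))" for i j
  have gc: "g i j \<in> carrier E" if "i \<in> {1..Suc ?n}" "j \<in> {1..?m}" for i j
    unfolding g_def
    using that Cons.prems ys in_carrier_nth[of "x # xs" i] in_carrier_omit[of "x # xs" i]
      in_carrier_nth[of ys j] in_carrier_omit[of ys j] by simp
  have "sg (tw (wdg \<one> xs)) \<cdot> dx x (wdg \<one> ys) = (\<Oplus>\<^bsub>E\<^esub> j \<in> {1..?m}. sg (tw (wdg \<one> xs)) \<cdot>
      signed E (1 + int j) (gn (br x (ys ! (j - 1))) \<cdot> tw (wdg \<one> (omit j ys))))"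
    using Cons.prems ys in_carrier_nth[of ys] in_carrier_omit[of ys]
    by (simp add: dx_word) (subst E.finsum_rdistr, auto)
  also have "\<dots> = (\<Oplus>\<^bsub>E\<^esub> j \<in> {1..?m}. g 1 j)"
  proof (rule E.finsum_cong')
    fix j assume j: "j \<in> {1..?m}"
    let ?z = "br x (ys ! (j - 1))" and ?w = "tw (wdg \<one> (omit j ys))" and ?u = "tw (wdg \<one> xs)"
    have c: "set (omit j ys) \<subseteq> carrier L" "ys ! (j - 1) \<in> carrier L"
      using ys j in_carrier_omit[of ys j] in_carrier_nth[of ys j] by auto
    have "sg ?u \<cdot> (gn ?z \<cdot> ?w) = gn ?z \<cdot> (?u \<cdot> ?w)"
      using Cons.prems c sg_gn[of ?z ?u] by (simp add: E.m_assoc[symmetric])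
    moreover have "?u \<cdot> ?w = tw (wdg \<one> (xs @ omit j ys))"
      using Cons.prems c by (simp add: tw.lift_mult[symmetric] wdg_mult)
    ultimately show "sg ?u \<cdot> signed E (1 + int j) (gn ?z \<cdot> ?w) = g 1 j"
      using Cons.prems c by (simp add: g_def E.signed_mult_right)
  qed (use gc in auto)
  finally have 1: "sg (tw (wdg \<one> xs)) \<cdot> dx x (wdg \<one> ys) = (\<Oplus>\<^bsub>E\<^esub> j \<in> {1..?m}. g 1 j)" .
  define g' where "g' i j = signed E (int (i + j)) (gn (br (xs ! (i - 1)) (ys ! (j - 1))) \<cdot>
      tw (wdg \<one> (omit i xs @ omit j ys)))" for i j
  have gc': "g' i j \<in> carrier E" if "i \<in> {1..?n}" "j \<in> {1..?m}" for i j
    unfolding g'_def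
    using that Cons.prems ys in_carrier_nth[of xs i] in_carrier_omit[of xs i]
      in_carrier_nth[of ys j] in_carrier_omit[of ys j] by simp
  have x: "gn (\<alpha> x) \<in> carrier E" using Cons.prems by simp
  have "gn (\<alpha> x) \<cdot> b0 (wdg \<one> xs) (wdg \<one> ys) = gn (\<alpha> x) \<cdot> (\<Oplus>\<^bsub>E\<^esub> i \<in> {1..?n}. \<Oplus>\<^bsub>E\<^esub> j \<in> {1..?m}. g' i j)"
    using Cons by (simp add: g'_def)
  also have "\<dots> = (\<Oplus>\<^bsub>E\<^esub> i \<in> {1..?n}. gn (\<alpha> x) \<cdot> (\<Oplus>\<^bsub>E\<^esub> j \<in> {1..?m}. g' i j))"
    using gc' x by (intro E.finsum_rdistr) auto
  also have "\<dots> = (\<Oplus>\<^bsub>E\<^esub> i \<in> {1..?n}. \<Oplus>\<^bsub>E\<^esub> j \<in> {1..?m}. g (Suc i) j)"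
  proof (rule E.finsum_cong')
    fix i assume i: "i \<in> {1..?n}"
    have "gn (\<alpha> x) \<cdot> (\<Oplus>\<^bsub>E\<^esub> j \<in> {1..?m}. g' i j) = (\<Oplus>\<^bsub>E\<^esub> j \<in> {1..?m}. gn (\<alpha> x) \<cdot> g' i j)"
      using gc' x i by (intro E.finsum_rdistr) auto
    also have "\<dots> = (\<Oplus>\<^bsub>E\<^esub> j \<in> {1..?m}. g (Suc i) j)"
    proof (rule E.finsum_cong')
      fix j assume j: "j \<in> {1..?m}"
      let ?z = "br (xs ! (i - 1)) (ys ! (j - 1))" and ?w = "tw (wdg \<one> (omit i xs @ omit j ys))"
      have c: "set (omit j ys) \<subseteq> carrier L" "ys ! (j - 1) \<in> carrier L"
        "set (omit i xs) \<subseteq> carrier L" "xs ! (i - 1) \<in> carrier L"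
        using Cons.prems ys i j in_carrier_omit[of ys j] in_carrier_nth[of ys j]
          in_carrier_omit[of xs i] in_carrier_nth[of xs i] by auto
      have "gn (\<alpha> x) \<cdot> (gn ?z \<cdot> ?w) = \<ominus>\<^bsub>E\<^esub> (gn ?z \<cdot> (gn (\<alpha> x) \<cdot> ?w))"
        using Cons.prems c gn_anticomm[of "\<alpha> x" ?z] by (simp add: E.m_assoc[symmetric] E.l_minus)
      then show "gn (\<alpha> x) \<cdot> g' i j = g (Suc i) j"
        using Cons.prems i c
        by (simp add: g_def g'_def omit_Cons wdg_Cons tw.lift_gn_mult E.signed_mult_right)
          (simp add: signed_def)
    qed (use gc i in auto)
    finally show "gn (\<alpha> x) \<cdot> (\<Oplus>\<^bsub>E\<^esub> j \<in> {1..?m}. g' i j) = (\<Oplus>\<^bsub>E\<^esub> j \<in> {1..?m}. g (Suc i) j)" .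
  qed (use gc in \<open>auto intro!: E.finsum_closed\<close>)
  finally have "b0 (wdg \<one> (x # xs)) (wdg \<one> ys) =
      (\<Oplus>\<^bsub>E\<^esub> i \<in> {1..?n}. \<Oplus>\<^bsub>E\<^esub> j \<in> {1..?m}. g (Suc i) j) \<^bold>+ (\<Oplus>\<^bsub>E\<^esub> j \<in> {1..?m}. g 1 j)"
    using Cons.prems ys by (simp add: wdg_Cons b0_gn_mult 1)
  also have "\<dots> = (\<Oplus>\<^bsub>E\<^esub> i \<in> {1..Suc ?n}. \<Oplus>\<^bsub>E\<^esub> j \<in> {1..?m}. g i j)"
    using gc by (subst E.finsum_1_Suc) (auto intro!: E.a_comm E.finsum_closed)
  finally show ?case by (simp add: g_def)
qed

end

section \<open>The exterior algebra as a hom-Gerstenhaber algebra\<close>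

lemma restrict_scalars_simps [simp]:
  "carrier (restrict_scalars A L) = carrier L" "add (restrict_scalars A L) = add L"
  "zero (restrict_scalars A L) = zero L"
  "smult (restrict_scalars A L) r x = smult L (smult A r (one A)) x"
  by (simp_all add: restrict_scalars_def)

lemma a_inv_restrict_scalars [simp]: "a_inv (restrict_scalars A L) = a_inv L"
  by (simp add: fun_eq_iff a_inv_def m_inv_def restrict_scalars_def)

lemma algebra_homD:
  assumes "algebra_hom R A B g"
  shows "\<And>a. a \<in> carrier A \<Longrightarrow> g a \<in> carrier B"
    and "\<And>a b. a \<in> carrier A \<Longrightarrow> b \<in> carrier A \<Longrightarrow> g (a \<oplus>\<^bsub>A\<^esub> b) = g a \<oplus>\<^bsub>B\<^esub> g b"
    and "\<And>a b. a \<in> carrier A \<Longrightarrow> b \<in> carrier A \<Longrightarrow> g (a \<otimes>\<^bsub>A\<^esub> b) = g a \<otimes>\<^bsub>B\<^esub> g b"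
    and "g \<one>\<^bsub>A\<^esub> = \<one>\<^bsub>B\<^esub>"
    and "\<And>r a. r \<in> carrier R \<Longrightarrow> a \<in> carrier A \<Longrightarrow> g (r \<odot>\<^bsub>A\<^esub> a) = r \<odot>\<^bsub>B\<^esub> g a"
  using assms by (auto simp: algebra_hom_def linear_map_def ring_hom_def)

lemma algebra_homI:
  assumes "\<And>a. a \<in> carrier A \<Longrightarrow> g a \<in> carrier B"
    and "\<And>a b. a \<in> carrier A \<Longrightarrow> b \<in> carrier A \<Longrightarrow> g (a \<oplus>\<^bsub>A\<^esub> b) = g a \<oplus>\<^bsub>B\<^esub> g b"
    and "\<And>a b. a \<in> carrier A \<Longrightarrow> b \<in> carrier A \<Longrightarrow> g (a \<otimes>\<^bsub>A\<^esub> b) = g a \<otimes>\<^bsub>B\<^esub> g b"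
    and "g \<one>\<^bsub>A\<^esub> = \<one>\<^bsub>B\<^esub>"
    and "\<And>r a. r \<in> carrier R \<Longrightarrow> a \<in> carrier A \<Longrightarrow> g (r \<odot>\<^bsub>A\<^esub> a) = r \<odot>\<^bsub>B\<^esub> g a"
  shows "algebra_hom R A B g"
  using assms by (auto simp: algebra_hom_def linear_map_def ring_hom_def)

lemma (in algebra) smult_one_mult: "r \<in> carrier R \<Longrightarrow> a \<in> carrier M \<Longrightarrow> (r \<odot>\<^bsub>M\<^esub> \<one>\<^bsub>M\<^esub>) \<otimes>\<^bsub>M\<^esub> a = r \<odot>\<^bsub>M\<^esub> a"
  by (simp add: smult_assoc2)

locale hlr_over = hlr A L br \<phi> \<alpha> \<rho> + RA: algebra R A
  for R :: "'r ring" and A :: "('r, 'a) module" (structure) and L :: "('a, 'l) module" (structure)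
    and br \<phi> \<alpha> \<rho> +
  assumes phi_R: "r \<in> carrier R \<Longrightarrow> a \<in> carrier A \<Longrightarrow> \<phi> (r \<odot>\<^bsub>A\<^esub> a) = r \<odot>\<^bsub>A\<^esub> \<phi> a"
    and rho_R: "r \<in> carrier R \<Longrightarrow> x \<in> carrier L \<Longrightarrow> a \<in> carrier A \<Longrightarrow> \<rho> x (r \<odot>\<^bsub>A\<^esub> a) = r \<odot>\<^bsub>A\<^esub> \<rho> x a"

lemma hlr_over_of_hom_lie_rinehart:
  assumes "hom_lie_rinehart R X"
  shows "hlr_over R (base X) (space X) (lie X) (phi X) (alpha X) (anchor X)"
proof -
  let ?A = "base X" and ?L = "space X" and ?LR = "restrict_scalars (base X) (space X)"
  note X = assms[unfolded hom_lie_rinehart_def Let_def]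
  interpret RA: algebra R ?A using X by blast
  interpret L: module ?A ?L using X by blast
  interpret H: hom_lie_algebra R ?LR "lie X" "alpha X" using X by blast
  interpret V: hom_lie_representation R ?LR "lie X" "alpha X" ?A "anchor X" "phi X" using X by blast
  have phi: "algebra_hom R ?A ?A (phi X)" using X by blast
  have der: "anchor X x \<in> twisted_derivations R ?A (phi X)" if "x \<in> carrier ?L" for x
    using X that by blast
  have rho: "linear_map R ?LR ?A (\<lambda>x. anchor X x a)" if "a \<in> carrier ?A" for a
    using X that by blast
  show ?thesis
  proof (intro hlr_over.intro hlr.intro exterior_module.intro L.module_axioms hlr_axioms.intro
      RA.algebra_axioms hlr_over_axioms.intro)
    show "anchor X x (a \<oplus>\<^bsub>?A\<^esub> b) = anchor X x a \<oplus>\<^bsub>?A\<^esub> anchor X x b"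
      if "x \<in> carrier ?L" "a \<in> carrier ?A" "b \<in> carrier ?A" for x a b
      using der[OF that(1)] that by (simp add: twisted_derivations_def linear_map_def)
    show "anchor X x (r \<odot>\<^bsub>?A\<^esub> b) = r \<odot>\<^bsub>?A\<^esub> anchor X x b"
      if "r \<in> carrier R" "x \<in> carrier ?L" "b \<in> carrier ?A" for x r b
      using der[OF that(2)] that by (simp add: twisted_derivations_def linear_map_def)
    show "anchor X x a \<in> carrier ?A" if "x \<in> carrier ?L" "a \<in> carrier ?A" for x a
      using der[OF that(1)] that by (auto simp: twisted_derivations_def linear_map_def)
    show "anchor X x (a \<otimes>\<^bsub>?A\<^esub> b) = phi X a \<otimes>\<^bsub>?A\<^esub> anchor X x b \<oplus>\<^bsub>?A\<^esub> phi X b \<otimes>\<^bsub>?A\<^esub> anchor X x a"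
      if "x \<in> carrier ?L" "a \<in> carrier ?A" "b \<in> carrier ?A" for x a b
      using der[OF that(1)] that by (simp add: twisted_derivations_def)
    show "anchor X (x \<oplus>\<^bsub>?L\<^esub> y) a = anchor X x a \<oplus>\<^bsub>?A\<^esub> anchor X y a"
      if "x \<in> carrier ?L" "y \<in> carrier ?L" "a \<in> carrier ?A" for x y a
      using rho[OF that(3)] that by (simp add: linear_map_def)
    show "lie X x y \<in> carrier ?L" if "x \<in> carrier ?L" "y \<in> carrier ?L" for x y
      using H.br_bilinear that by (auto simp: bilinear_map_def linear_map_def)
    show "lie X x (y \<oplus>\<^bsub>?L\<^esub> z) = lie X x y \<oplus>\<^bsub>?L\<^esub> lie X x z"
      if "x \<in> carrier ?L" "y \<in> carrier ?L" "z \<in> carrier ?L" for x y z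
      using H.br_bilinear that by (simp add: bilinear_map_def linear_map_def)
    show "alpha X x \<in> carrier ?L" if "x \<in> carrier ?L" for x
      using H.alpha_linear that by (auto simp: linear_map_def)
    show "alpha X (x \<oplus>\<^bsub>?L\<^esub> y) = alpha X x \<oplus>\<^bsub>?L\<^esub> alpha X y"
      if "x \<in> carrier ?L" "y \<in> carrier ?L" for x y
      using H.alpha_linear that by (simp add: linear_map_def)
    show "lie X x y = \<ominus>\<^bsub>?L\<^esub> lie X y x" if "x \<in> carrier ?L" "y \<in> carrier ?L" for x y
      using H.br_skew[of x y] that by simp
    show "alpha X (lie X x y) = lie X (alpha X x) (alpha X y)"
      if "x \<in> carrier ?L" "y \<in> carrier ?L" for x y
      using H.alpha_br[of x y] that by simp
    show "lie X (alpha X x) (lie X y z) \<oplus>\<^bsub>?L\<^esub> lie X (alpha X y) (lie X z x) \<oplus>\<^bsub>?L\<^esub> lie X (alpha X z) (lie X x y) = \<zero>\<^bsub>?L\<^esub>"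
      if "x \<in> carrier ?L" "y \<in> carrier ?L" "z \<in> carrier ?L" for x y z
      using H.hom_jacobi[of x y z] that by simp
    show "anchor X (alpha X x) (phi X a) = phi X (anchor X x a)"
      if "x \<in> carrier ?L" "a \<in> carrier ?A" for x a
      using V.theta_beta[of x a] that by simp
    show "anchor X (lie X x y) (phi X a) = anchor X (alpha X x) (anchor X y a) \<ominus>\<^bsub>?A\<^esub> anchor X (alpha X y) (anchor X x a)"
      if "x \<in> carrier ?L" "y \<in> carrier ?L" "a \<in> carrier ?A" for x y a
      using V.theta_br[of x y a] that by simp
  qed (use X algebra_homD[OF phi] in auto)
qed

text \<open>The predicate \<^const>\<open>hom_gerstenhaber\<close> with the grading, bracket and twist detached from the record,
  so that a plain module can carry them.\<close>

definition hom_gerstenhaber_on ::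
  "'r ring \<Rightarrow> ('r, 'g, 'x) module_scheme \<Rightarrow> (nat \<Rightarrow> 'g set) \<Rightarrow> ('g \<Rightarrow> 'g \<Rightarrow> 'g) \<Rightarrow> ('g \<Rightarrow> 'g) \<Rightarrow> bool" where
  "hom_gerstenhaber_on R E d b \<alpha> \<longleftrightarrow>
     graded_algebra R E d \<and> graded_commutative E d \<and>
     algebra_hom R E E \<alpha> \<and> (\<forall>i. \<alpha> ` d i \<subseteq> d i) \<and>
     bilinear_map R E E E b \<and> degree_minus_one E d b \<and> graded_skew E d b \<and>
     (\<forall>x \<in> carrier E. \<forall>y \<in> carrier E. \<alpha> (b x y) = b (\<alpha> x) (\<alpha> y)) \<and>
     (\<forall>i j k. \<forall>x \<in> d i. \<forall>y \<in> d j. \<forall>z \<in> d k.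
        signed E ((int i - 1) * (int k - 1)) (b (\<alpha> x) (b y z)) \<oplus>\<^bsub>E\<^esub>
        signed E ((int j - 1) * (int i - 1)) (b (\<alpha> y) (b z x)) \<oplus>\<^bsub>E\<^esub>
        signed E ((int k - 1) * (int j - 1)) (b (\<alpha> z) (b x y)) = \<zero>\<^bsub>E\<^esub>) \<and>
     (\<forall>i j k. \<forall>x \<in> d i. \<forall>y \<in> d j. \<forall>z \<in> d k.
        b x (y \<otimes>\<^bsub>E\<^esub> z) =
        b x y \<otimes>\<^bsub>E\<^esub> \<alpha> z \<oplus>\<^bsub>E\<^esub>
        signed E ((int i - 1) * int j) (\<alpha> y \<otimes>\<^bsub>E\<^esub> b x z))"

lemma hom_gerstenhaber_iff:
  "hom_gerstenhaber R E \<longleftrightarrow> hom_gerstenhaber_on R E (part E) (bracket E) (twist E)"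
  by (simp add: hom_gerstenhaber_def hom_gerstenhaber_on_def Let_def)

locale exterior_functoriality = X: exterior_module A L + Y: exterior_module B K + RA: algebra R A + RB: algebra R B
  for R :: "'r ring" and A :: "('r, 'a) module" and L :: "('a, 'l) module"
    and B :: "('r, 'b) module" and K :: "('b, 'k) module" and g :: "'a \<Rightarrow> 'b" and f :: "'l \<Rightarrow> 'k" +
  assumes g: "algebra_hom R A B g"
    and f_closed: "x \<in> carrier L \<Longrightarrow> f x \<in> carrier K"
    and f_add: "x \<in> carrier L \<Longrightarrow> y \<in> carrier L \<Longrightarrow> f (x \<oplus>\<^bsub>L\<^esub> y) = f x \<oplus>\<^bsub>K\<^esub> f y"
    and f_smult: "a \<in> carrier A \<Longrightarrow> x \<in> carrier L \<Longrightarrow> f (a \<odot>\<^bsub>L\<^esub> x) = g a \<odot>\<^bsub>K\<^esub> f x"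
begin

sublocale lf: exterior_lift A L "exterior B K" "\<lambda>a. Y.sc (g a)" "\<lambda>x. Y.gn (f x)"
  by unfold_locales
    (simp_all add: algebra_homD[OF g] f_closed f_add f_smult Y.sc_add Y.sc_mult Y.sc_one Y.gn_add
      Y.gn_smult Y.gn_sc_comm Y.gn_square)

lemma lift_wdg: "a \<in> carrier A \<Longrightarrow> set xs \<subseteq> carrier L \<Longrightarrow> lf.lift (wedge A L a xs) = wedge B K (g a) (map f xs)"
proof (induction xs)
  case Nil
  then show ?case using lf.lift_sc[of a] by (simp add: X.sc_def Y.sc_def)
next
  case (Cons x xs)
  then have "set (map f xs) \<subseteq> carrier K" using f_closed by auto
  then show ?case using Cons f_closed
    by (simp add: lf.lift_wdg_Cons Y.wdg_Cons algebra_homD[OF g])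
qed

text \<open>Resolves the description by \<open>THE\<close>: the lift satisfies it, and every element
  is a sum of wedges, on which the value is prescribed.\<close>

lemma exterior_map_eq: "exterior_map R A L B K g f = restrict lf.lift (carrier (exterior A L))"
  unfolding exterior_map_def
proof (rule the_equality)
  show "restrict lf.lift (carrier (exterior A L)) \<in> extensional (carrier (exterior A L)) \<and>
    linear_map R (exterior A L) (exterior B K) (restrict lf.lift (carrier (exterior A L))) \<and>
    (\<forall>a\<in>carrier A. \<forall>xs. set xs \<subseteq> carrier L \<longrightarrow>
       restrict lf.lift (carrier (exterior A L)) (wedge A L a xs) = wedge B K (g a) (map f xs))"
    by (auto simp: linear_map_def lf.lift_add X.E_smult Y.E_smult lf.lift_sc_mult algebra_homD[OF g] lift_wdg)
next
  fix h assume h: "h \<in> extensional (carrier (exterior A L)) \<and>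
    linear_map R (exterior A L) (exterior B K) h \<and>
    (\<forall>a\<in>carrier A. \<forall>xs. set xs \<subseteq> carrier L \<longrightarrow> h (wedge A L a xs) = wedge B K (g a) (map f xs))"
  have "h u = lf.lift u" if "u \<in> carrier (exterior A L)" for u
    using that
  proof (induction rule: X.E_induct_wdg)
    case (wdg a xs)
    then show ?case using h by (simp add: lift_wdg)
  next
    case (add u v)
    then show ?case using h by (simp add: linear_map_def lf.lift_add)
  qed
  then show "h = restrict lf.lift (carrier (exterior A L))"
    using h by (intro extensionalityI[of h "carrier (exterior A L)"]) auto
qed

lemma exterior_map_apply: "u \<in> carrier (exterior A L) \<Longrightarrow> exterior_map R A L B K g f u = lf.lift u"
  by (simp add: exterior_map_eq)

end

section \<open>Linearity over the ground ring and the hom-Gerstenhaber axioms\<close>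

context hlr_over
begin

lemma phi_scR: "r \<in> carrier R \<Longrightarrow> \<phi> (r \<odot>\<^bsub>A\<^esub> \<one>) = r \<odot>\<^bsub>A\<^esub> \<one>"
  by (simp add: phi_R phi_one)

lemma rho_scR: "r \<in> carrier R \<Longrightarrow> x \<in> carrier L \<Longrightarrow> \<rho> x (r \<odot>\<^bsub>A\<^esub> \<one>) = \<zero>"
  by (simp add: rho_R rho_one)

lemma scR_mult: "r \<in> carrier R \<Longrightarrow> s \<in> carrier R \<Longrightarrow> (r \<otimes>\<^bsub>R\<^esub> s) \<odot>\<^bsub>A\<^esub> \<one> = (r \<odot>\<^bsub>A\<^esub> \<one>) \<otimes> (s \<odot>\<^bsub>A\<^esub> \<one>)"
  by (simp add: RA.smult_assoc1 RA.smult_one_mult)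

lemma E_module: "module R E"
  by (rule moduleI)
    (simp_all add: E_smult RA.R.is_cring E.is_abelian_group RA.smult_l_distr sc_add E.l_distr E.r_distr
      scR_mult sc_mult E.m_assoc sc_one)

text \<open>Multiples of 1 by elements of \<open>R\<close> are constants for the bracket, since
  \<open>\<rho>(x)(1) = 0\<close>. This makes the bracket linear over \<open>R\<close>, although
  over \<open>A\<close> it is only a twisted derivation.\<close>

lemma da_scR: 
  assumes "r \<in> carrier R"
  shows "da (r \<odot>\<^bsub>A\<^esub> \<one>) v = \<^bold>0"
proof (cases "v \<in> carrier E")
  case True
  then show ?thesis
    by (induction rule: E_induct) (use assms in \<open>simp_all add: da_sc da_gn_mult rho_scR sc_zero da_add\<close>)
qed (use assms in \<open>simp add: da_outside\<close>)

lemma b0_smult_left: "r \<in> carrier R \<Longrightarrow> u \<in> carrier E \<Longrightarrow> v \<in> carrier E \<Longrightarrow>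
    b0 (r \<odot>\<^bsub>E\<^esub> u) v = r \<odot>\<^bsub>E\<^esub> b0 u v"
  by (simp add: E_smult b0_sc_mult phi_scR da_scR)

lemma b0_smult_right:
  assumes "r \<in> carrier R" "u \<in> carrier E" "v \<in> carrier E"
  shows "b0 u (r \<odot>\<^bsub>E\<^esub> v) = r \<odot>\<^bsub>E\<^esub> b0 u v"
  using assms(2)
proof (induction rule: E_induct)
  case (sc a)
  then show ?case using assms by (simp add: E_smult b0_sc da_sc_mult phi_scR)
next
  case (gn x u)
  have "sg (tw u) \<cdot> (sc (r \<odot>\<^bsub>A\<^esub> \<one>) \<cdot> dx x v) = sc (r \<odot>\<^bsub>A\<^esub> \<one>) \<cdot> (sg (tw u) \<cdot> dx x v)"
    using gn assms by (intro sc_left_comm) auto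
  then show ?case using gn assms
    by (simp add: E_smult b0_gn_mult dx_sc_mult phi_scR rho_scR sc_zero E.r_distr gn_sc)
next
  case (add u w)
  then show ?case using assms by (simp add: b0_add_left E_smult E.r_distr)
qed

lemma smult_mult_left: "r \<in> carrier R \<Longrightarrow> u \<in> carrier E \<Longrightarrow> v \<in> carrier E \<Longrightarrow>
    (r \<odot>\<^bsub>E\<^esub> u) \<cdot> v = r \<odot>\<^bsub>E\<^esub> (u \<cdot> v)"
  by (simp add: E_smult E.m_assoc)

lemma smult_mult_right: "r \<in> carrier R \<Longrightarrow> u \<in> carrier E \<Longrightarrow> v \<in> carrier E \<Longrightarrow>
    u \<cdot> (r \<odot>\<^bsub>E\<^esub> v) = r \<odot>\<^bsub>E\<^esub> (u \<cdot> v)"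
  by (simp add: E_smult sc_left_comm)

lemma E_graded_algebra: "graded_algebra R E dg"
  unfolding graded_algebra_def
proof (intro conjI ballI allI)
  interpret EM: module R E by (rule E_module)
  show "submodule (dg i) R E" for i
    by (rule EM.submoduleI) (auto simp: E_smult)
  show "\<one>\<^bsub>E\<^esub> \<in> dg 0" using sc_dg[of \<one>] by (simp add: sc_one)
qed (simp_all add: E_module E.ring_axioms smult_mult_left smult_mult_right decomposition dg_mult)

lemma E_graded_commutative: "graded_commutative E dg"
  unfolding graded_commutative_def using dg_comm dg_odd_square by blast

lemma tw_algebra_hom: "algebra_hom R E E tw"
  by (rule algebra_homI)
    (simp_all add: tw.lift_add tw.lift_mult tw.lift_one E_smult tw.lift_sc phi_scR)

lemma bb_bilinear: "bilinear_map R E E E bb"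
  unfolding bilinear_map_def linear_map_def
proof (intro conjI ballI)
  have "r \<odot>\<^bsub>E\<^esub> u \<in> carrier E" if "r \<in> carrier R" "u \<in> carrier E" for r u
    using that by (simp add: E_smult)
  note [simp] = this
  show "bb u (r \<odot>\<^bsub>E\<^esub> v) = r \<odot>\<^bsub>E\<^esub> bb u v" if "r \<in> carrier R" "u \<in> carrier E" "v \<in> carrier E" for u r v
    using that by (simp add: b0_smult_right)
  show "bb (r \<odot>\<^bsub>E\<^esub> u) v = r \<odot>\<^bsub>E\<^esub> bb u v" if "r \<in> carrier R" "u \<in> carrier E" "v \<in> carrier E" for u r v
    using that by (simp add: b0_smult_left)
qed (auto simp: b0_add_left b0_add_right)

lemma tw_bb_all:
  assumes "u \<in> carrier E" "v \<in> carrier E"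
  shows "tw (bb u v) = bb (tw u) (tw v)"
  using assms(1)
proof (induction rule: E_induct_wdg)
  case (wdg a xs)
  show ?case using assms(2)
  proof (induction rule: E_induct_wdg)
    case (wdg c ys)
    show ?case by (rule tw_bb[OF wdg_dg wdg_dg]) (use wdg \<open>a \<in> _\<close> \<open>set xs \<subseteq> _\<close> in auto)
  next
    case (add v w)
    then show ?case using wdg by (simp add: b0_add_right tw.lift_add)
  qed
next
  case (add u w)
  then show ?case using assms by (simp add: b0_add_left tw.lift_add)
qed

lemma E_hom_gerstenhaber: "hom_gerstenhaber_on R E dg bb tw"
  unfolding hom_gerstenhaber_on_def
proof (intro conjI allI ballI)
  show "signed E ((int i - 1) * (int k - 1)) (bb (tw x) (bb y z)) \<^bold>+
      signed E ((int j - 1) * (int i - 1)) (bb (tw y) (bb z x)) \<^bold>+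
      signed E ((int k - 1) * (int j - 1)) (bb (tw z) (bb x y)) = \<^bold>0"
    if "x \<in> dg i" "y \<in> dg j" "z \<in> dg k" for i j k x y z
    using bb_jacobi[OF that] unfolding gb.jacobi_def .
  show "bb x (y \<cdot> z) = bb x y \<cdot> tw z \<^bold>+ signed E ((int i - 1) * int j) (tw y \<cdot> bb x z)"
    if "x \<in> dg i" "y \<in> dg j" "z \<in> dg k" for i j k x y z
    by (rule gb.b_leibniz[OF that])
qed (auto simp: E_graded_algebra E_graded_commutative tw_algebra_hom bb_bilinear gb.b_degree gb.b_skew
    tw_bb_all simp del: bb_b0)

end

section \<open>Identification with the prescribed twist and bracket\<close>

locale hlr_data =
  fixes R :: "'r ring" and X :: "('r, 'a, 'l) hom_lie_rinehart_data"
  assumes hom_lie_rinehart: "hom_lie_rinehart R X"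

sublocale hlr_data \<subseteq> hlr_over R "base X" "space X" "lie X" "phi X" "alpha X" "anchor X"
  by (rule hlr_over_of_hom_lie_rinehart[OF hom_lie_rinehart])

context hlr_data
begin

abbreviation "A \<equiv> base X"
abbreviation "L \<equiv> space X"

lemma phi_algebra_hom: "algebra_hom R A A (phi X)"
  by (rule algebra_homI) (simp_all add: phi_add phi_mult phi_one phi_R)

sublocale tw': exterior_functoriality R A L A L "phi X" "alpha X"
  by (intro exterior_functoriality.intro exterior_module_axioms RA.algebra_axioms
      exterior_functoriality_axioms.intro phi_algebra_hom) (simp_all add: alpha_add alpha_smult)

lemma exterior_twist_eq: "u \<in> carrier E \<Longrightarrow> exterior_twist R X u = tw u"
  by (simp add: exterior_twist_def tw'.exterior_map_apply)

lemma tw_omit_closed: "set xs \<subseteq> carrier L \<Longrightarrow> set ys \<subseteq> carrier L \<Longrightarrow>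
   exterior_twist R X (wdg \<one>\<^bsub>A\<^esub> (omit i xs @ omit j ys)) = tw (wdg \<one>\<^bsub>A\<^esub> (omit i xs @ omit j ys))"
  using in_carrier_omit[of xs i] in_carrier_omit[of ys j] by (intro exterior_twist_eq wdg_closed) auto

lemma bb_is_exterior_bracket: "is_exterior_bracket R X bb"
  unfolding is_exterior_bracket_def Let_def
proof (intro conjI allI ballI impI)
  show "bb u v = undefined" if "u \<notin> carrier E \<or> v \<notin> carrier E" for u v
    using that by (auto simp: bb_def)
  show "bilinear_map R E E E bb" by (rule bb_bilinear)
  show "degree_minus_one E dg bb" by (rule gb.b_degree)
  show "graded_skew E dg bb" by (rule gb.b_skew)
  show "bb (wdg \<one>\<^bsub>A\<^esub> xs) (wdg a []) = (\<Oplus>\<^bsub>E\<^esub>i\<in>{1..length xs}. signed E (int (length xs + i))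
      (wdg (anchor X (xs ! (i - 1)) a) [] \<otimes>\<^bsub>E\<^esub> exterior_twist R X (wdg \<one>\<^bsub>A\<^esub> (omit i xs))))"
    if a: "a \<in> carrier A" and xs: "xs \<noteq> [] \<and> set xs \<subseteq> carrier L" for xs a
  proof -
    have "bb (wdg \<one>\<^bsub>A\<^esub> xs) (wdg a []) = (\<Oplus>\<^bsub>E\<^esub> i \<in> {1..length xs}.
      signed E (int (length xs + i)) (sc (anchor X (xs ! (i - 1)) a) \<otimes>\<^bsub>E\<^esub> tw (wdg \<one>\<^bsub>A\<^esub> (omit i xs))))"
      using bracket_word_scalar[of xs a] a xs by (simp add: sc_def)
    also have "\<dots> = (\<Oplus>\<^bsub>E\<^esub>i\<in>{1..length xs}. signed E (int (length xs + i))
      (wdg (anchor X (xs ! (i - 1)) a) [] \<otimes>\<^bsub>E\<^esub> exterior_twist R X (wdg \<one>\<^bsub>A\<^esub> (omit i xs))))"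
    proof (rule E.finsum_cong')
      fix i assume i: "i \<in> {1..length xs}"
      have c: "set (omit i xs) \<subseteq> carrier L" "xs ! (i - 1) \<in> carrier L"
        using xs i in_carrier_omit[of xs i] in_carrier_nth[of xs i] by auto
      then show "signed E (int (length xs + i)) (sc (anchor X (xs ! (i - 1)) a) \<otimes>\<^bsub>E\<^esub> tw (wdg \<one>\<^bsub>A\<^esub> (omit i xs))) =
        signed E (int (length xs + i))
          (wdg (anchor X (xs ! (i - 1)) a) [] \<otimes>\<^bsub>E\<^esub> exterior_twist R X (wdg \<one>\<^bsub>A\<^esub> (omit i xs)))"
        by (simp add: exterior_twist_eq sc_def)
    qed (use a xs in_carrier_omit[of xs] in_carrier_nth[of xs] in \<open>auto simp: exterior_twist_eq\<close>)
    finally show ?thesis .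
  qed
  show "bb (wdg \<one>\<^bsub>A\<^esub> xs) (wdg \<one>\<^bsub>A\<^esub> ys) = (\<Oplus>\<^bsub>E\<^esub>i\<in>{1..length xs}. \<Oplus>\<^bsub>E\<^esub>j\<in>{1..length ys}. signed E (int (i + j))
      (wdg \<one>\<^bsub>A\<^esub> [lie X (xs ! (i - 1)) (ys ! (j - 1))] \<otimes>\<^bsub>E\<^esub> exterior_twist R X (wdg \<one>\<^bsub>A\<^esub> (omit i xs @ omit j ys))))"
    if xs: "xs \<noteq> [] \<and> ys \<noteq> [] \<and> set xs \<subseteq> carrier L \<and> set ys \<subseteq> carrier L" for xs ys
    using bracket_word_word[of xs ys] xs by (simp add: tw_omit_closed gn_def)
qed

text \<open>The formulas cover a word against a scalar and a word against a word, with coefficient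
  1. A scalar against a word follows by skew-symmetry, two scalars by degree, and sums by
  bilinearity.\<close>

lemma exterior_bracket_unique:
  assumes b: "is_exterior_bracket R X b" and c: "is_exterior_bracket R X c"
  shows "b = c"
proof -
  note B = b[unfolded is_exterior_bracket_def Let_def]
  note C = c[unfolded is_exterior_bracket_def Let_def]
  have lin: "b (u \<oplus>\<^bsub>E\<^esub> v) w = b u w \<oplus>\<^bsub>E\<^esub> b v w" "b w (u \<oplus>\<^bsub>E\<^esub> v) = b w u \<oplus>\<^bsub>E\<^esub> b w v"
    "c (u \<oplus>\<^bsub>E\<^esub> v) w = c u w \<oplus>\<^bsub>E\<^esub> c v w" "c w (u \<oplus>\<^bsub>E\<^esub> v) = c w u \<oplus>\<^bsub>E\<^esub> c w v"
    if "u \<in> carrier E" "v \<in> carrier E" "w \<in> carrier E" for u v w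
    using B C that by (simp_all add: bilinear_map_def linear_map_def)
  \<comment> \<open>The coefficient of a nonempty word is absorbed into its first letter.\<close>
  have norm: "\<exists>ys. wdg a xs = wdg \<one>\<^bsub>A\<^esub> ys \<and> ys \<noteq> [] \<and> set ys \<subseteq> carrier L"
    if a: "a \<in> carrier A" and xs: "set xs \<subseteq> carrier L" "xs \<noteq> []" for a xs
  proof -
    obtain x zs where z: "xs = x # zs" using xs by (cases xs) auto
    have "wdg a xs = wdg \<one>\<^bsub>A\<^esub> ((a \<odot>\<^bsub>L\<^esub> x) # zs)"
      using a xs z wdg_eq_sc_mult[of a xs] by (simp add: wdg_Cons gn_smult E.m_assoc)
    then show ?thesis using a xs z by (intro exI[of _ "(a \<odot>\<^bsub>L\<^esub> x) # zs"]) auto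
  qed
  have 1: "b (wdg \<one>\<^bsub>A\<^esub> xs) (wdg a []) = c (wdg \<one>\<^bsub>A\<^esub> xs) (wdg a [])"
    if "a \<in> carrier A" "xs \<noteq> []" "set xs \<subseteq> carrier L" for a xs
    using B C that by (metis (no_types, lifting))
  have 2: "b (wdg \<one>\<^bsub>A\<^esub> xs) (wdg \<one>\<^bsub>A\<^esub> ys) = c (wdg \<one>\<^bsub>A\<^esub> xs) (wdg \<one>\<^bsub>A\<^esub> ys)"
    if "ys \<noteq> []" "set ys \<subseteq> carrier L" "xs \<noteq> []" "set xs \<subseteq> carrier L" for ys xs
    using B C that by (metis (no_types, lifting))
  have 3: "b (wdg a []) (wdg \<one>\<^bsub>A\<^esub> xs) = c (wdg a []) (wdg \<one>\<^bsub>A\<^esub> xs)"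
    if "a \<in> carrier A" "xs \<noteq> []" "set xs \<subseteq> carrier L" for a xs
  proof -
    have d: "wdg a [] \<in> dg 0" "wdg \<one>\<^bsub>A\<^esub> xs \<in> dg (length xs)" using that by (simp_all add: wdg_dg)
    have "graded_skew E dg b" "graded_skew E dg c" using B C by blast+
    then show ?thesis using d 1[OF that] unfolding graded_skew_def by metis
  qed
  have 4: "b (wdg a []) (wdg a' []) = c (wdg a []) (wdg a' [])"
    if "a \<in> carrier A" "a' \<in> carrier A" for a a'
  proof -
    have d: "wdg a [] \<in> dg 0" "wdg a' [] \<in> dg 0" using that by (simp_all add: wdg_dg)
    have "degree_minus_one E dg b" "degree_minus_one E dg c" using B C by blast+
    then show ?thesis using d unfolding degree_minus_one_def by fastforce
  qed
  have W: "b (wdg a xs) (wdg a' ys) = c (wdg a xs) (wdg a' ys)"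
    if a: "a \<in> carrier A" "a' \<in> carrier A" "set xs \<subseteq> carrier L" "set ys \<subseteq> carrier L" for a a' xs ys
  proof (cases "xs = []")
    case True
    show ?thesis
    proof (cases "ys = []")
      case False
      then obtain zs where "wdg a' ys = wdg \<one>\<^bsub>A\<^esub> zs" "zs \<noteq> []" "set zs \<subseteq> carrier L"
        using norm[OF a(2,4)] by auto
      then show ?thesis using True a 3 by simp
    qed (use True a 4 in simp)
  next
    case False
    then obtain zs where z: "wdg a xs = wdg \<one>\<^bsub>A\<^esub> zs" "zs \<noteq> []" "set zs \<subseteq> carrier L"
      using norm[OF a(1,3)] by auto
    show ?thesis
    proof (cases "ys = []")
      case False
      then obtain zs' where "wdg a' ys = wdg \<one>\<^bsub>A\<^esub> zs'" "zs' \<noteq> []" "set zs' \<subseteq> carrier L"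
        using norm[OF a(2,4)] by auto
      then show ?thesis using z 2 by simp
    qed (use z a 1 in simp)
  qed
  have "b u v = c u v" if u: "u \<in> carrier E" and v: "v \<in> carrier E" for u v
    using u
  proof (induction rule: E_induct_wdg)
    case (wdg a xs)
    show ?case using v
    proof (induction rule: E_induct_wdg)
      case (wdg c ys)
      then show ?case using W \<open>a \<in> _\<close> \<open>set xs \<subseteq> _\<close> by simp
    next
      case (add v w)
      then show ?case using wdg by (simp add: lin)
    qed
  next
    case (add u w)
    then show ?case using v by (simp add: lin)
  qed
  moreover have "b u v = c u v" if "u \<notin> carrier E \<or> v \<notin> carrier E" for u v
  proof -
    have "b u v = undefined" "c u v = undefined"
      using B C that by simp_all
    then show ?thesis by simp
  qed
  ultimately show ?thesis by (intro ext) blast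
qed

lemma the_exterior_bracket: "(THE b. is_exterior_bracket R X b) = bb"
  using bb_is_exterior_bracket exterior_bracket_unique by blast

abbreviation "EG \<equiv> exterior_gerstenhaber R X"

lemma EG_simps [simp]:
  "carrier EG = carrier E" "mult EG = mult E" "one EG = one E" "zero EG = zero E" "add EG = add E"
  "smult EG = smult E" "part EG = dg" "bracket EG = bb"
  by (simp_all add: exterior_gerstenhaber_def Let_def the_exterior_bracket)

lemma EG_twist: "u \<in> carrier E \<Longrightarrow> twist EG u = tw u"
  by (simp add: exterior_gerstenhaber_def Let_def exterior_twist_eq)

end

section \<open>Transport along a bijection\<close>

context
  fixes R :: "'r ring" and E :: "('r, 'g, 'x) module_scheme" (structure) and d b t
  assumes on: "hom_gerstenhaber_on R E d b t"
begin

lemma on_graded: "graded_algebra R E d"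
  using on by (simp add: hom_gerstenhaber_on_def)

lemma on_module: "module R E"
  and on_ring: "ring E"
  using on_graded by (simp_all add: graded_algebra_def)

lemma on_submodule: "submodule (d i) R E"
  and on_one: "\<one> \<in> d 0"
  and on_mult: "u \<in> d i \<Longrightarrow> v \<in> d j \<Longrightarrow> u \<otimes> v \<in> d (i + j)"
  and on_smult_left: "r \<in> carrier R \<Longrightarrow> u \<in> carrier E \<Longrightarrow> v \<in> carrier E \<Longrightarrow> (r \<odot> u) \<otimes> v = r \<odot> (u \<otimes> v)"
  and on_smult_right: "r \<in> carrier R \<Longrightarrow> u \<in> carrier E \<Longrightarrow> v \<in> carrier E \<Longrightarrow> u \<otimes> (r \<odot> v) = r \<odot> (u \<otimes> v)"
  using on_graded by (simp_all add: graded_algebra_def)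

lemma on_d_closed: "u \<in> d i \<Longrightarrow> u \<in> carrier E"
  using module.submoduleE(1)[OF on_module on_submodule] by blast

lemma on_graded_commutative: "graded_commutative E d"
  using on unfolding hom_gerstenhaber_on_def by (elim conjE)

lemma on_comm: "u \<in> d i \<Longrightarrow> v \<in> d j \<Longrightarrow> u \<otimes> v = signed E (int i * int j) (v \<otimes> u)"
  and on_odd_square: "odd i \<Longrightarrow> u \<in> d i \<Longrightarrow> u \<otimes> u = \<zero>"
  using on_graded_commutative unfolding graded_commutative_def by blast+

lemma on_twist_hom: "algebra_hom R E E t"
  and on_twist_d: "u \<in> d i \<Longrightarrow> t u \<in> d i"
  and on_bilinear: "bilinear_map R E E E b"
  and on_twist_bracket: "u \<in> carrier E \<Longrightarrow> v \<in> carrier E \<Longrightarrow> t (b u v) = b (t u) (t v)"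
  and on_degree: "degree_minus_one E d b"
  and on_skew: "graded_skew E d b"
  using on by (auto simp: hom_gerstenhaber_on_def)

lemma on_jacobi: "u \<in> d i \<Longrightarrow> v \<in> d j \<Longrightarrow> w \<in> d k \<Longrightarrow>
    signed E ((int i - 1) * (int k - 1)) (b (t u) (b v w)) \<oplus>
    signed E ((int j - 1) * (int i - 1)) (b (t v) (b w u)) \<oplus>
    signed E ((int k - 1) * (int j - 1)) (b (t w) (b u v)) = \<zero>"
  and on_leibniz: "u \<in> d i \<Longrightarrow> v \<in> d j \<Longrightarrow> w \<in> d k \<Longrightarrow>
    b u (v \<otimes> w) = b u v \<otimes> t w \<oplus> signed E ((int i - 1) * int j) (t v \<otimes> b u w)"
  using on by (simp_all add: hom_gerstenhaber_on_def)

lemma on_bracket: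
  "u \<in> carrier E \<Longrightarrow> v \<in> carrier E \<Longrightarrow> b u v \<in> carrier E"
  "u \<in> carrier E \<Longrightarrow> v \<in> carrier E \<Longrightarrow> w \<in> carrier E \<Longrightarrow> b (u \<oplus> v) w = b u w \<oplus> b v w"
  "u \<in> carrier E \<Longrightarrow> v \<in> carrier E \<Longrightarrow> w \<in> carrier E \<Longrightarrow> b u (v \<oplus> w) = b u v \<oplus> b u w"
  "r \<in> carrier R \<Longrightarrow> u \<in> carrier E \<Longrightarrow> v \<in> carrier E \<Longrightarrow> b (r \<odot> u) v = r \<odot> b u v"
  "r \<in> carrier R \<Longrightarrow> u \<in> carrier E \<Longrightarrow> v \<in> carrier E \<Longrightarrow> b u (r \<odot> v) = r \<odot> b u v"
  using on_bilinear by (auto simp: bilinear_map_def linear_map_def)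

lemma on_twisted_bracket: "twisted_bracket E d b t"
proof (intro twisted_bracket.intro twisted_bracket_axioms.intro on_ring on_comm on_degree on_skew on_leibniz)
  interpret E: ring E by (rule on_ring)
  show "\<zero> \<in> d n" for n
    using module.submoduleE(2,4)[OF on_module on_submodule[of n]] on_d_closed[of _ n] on_module
    by (metis cring.cring_simprules(2) equals0I module.axioms(1) module.smult_l_null)
  show "u \<oplus> v \<in> d n" if "u \<in> d n" "v \<in> d n" for u v n
    using module.submoduleE(5)[OF on_module on_submodule[of n]] that by blast
qed (use on_d_closed on_mult on_twist_d algebra_homD[OF on_twist_hom] on_bracket in auto)

end

text \<open>The equational axioms pass along any surjection compatible with the operations.
  Injectivity is needed for the unique decomposition into components, where a decomposition in the
  image has to be pulled back.\<close>

lemma hom_gerstenhaber_transfer: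
  fixes E' :: "('r, 'h) hom_gerstenhaber_data"
  assumes on: "hom_gerstenhaber_on R E d b t"
    and inj: "inj_on e (carrier E)"
    and carrier: "carrier E' = e ` carrier E"
    and mult: "\<And>u v. u \<in> carrier E \<Longrightarrow> v \<in> carrier E \<Longrightarrow> e u \<otimes>\<^bsub>E'\<^esub> e v = e (u \<otimes>\<^bsub>E\<^esub> v)"
    and one: "\<one>\<^bsub>E'\<^esub> = e \<one>\<^bsub>E\<^esub>"
    and zero: "\<zero>\<^bsub>E'\<^esub> = e \<zero>\<^bsub>E\<^esub>"
    and add: "\<And>u v. u \<in> carrier E \<Longrightarrow> v \<in> carrier E \<Longrightarrow> e u \<oplus>\<^bsub>E'\<^esub> e v = e (u \<oplus>\<^bsub>E\<^esub> v)"
    and smult: "\<And>r u. r \<in> carrier R \<Longrightarrow> u \<in> carrier E \<Longrightarrow> r \<odot>\<^bsub>E'\<^esub> e u = e (r \<odot>\<^bsub>E\<^esub> u)"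
    and part: "\<And>i. part E' i = e ` d i"
    and bracket: "\<And>u v. u \<in> carrier E \<Longrightarrow> v \<in> carrier E \<Longrightarrow> bracket E' (e u) (e v) = e (b u v)"
    and twist: "\<And>u. u \<in> carrier E \<Longrightarrow> twist E' (e u) = e (t u)"
  shows "hom_gerstenhaber R E'"
proof -
  note C = on_d_closed[OF on]
  interpret E: ring E by (rule on_ring[OF on])
  interpret M: module R E by (rule on_module[OF on])
  note tD = algebra_homD[OF on_twist_hom[OF on]]
  note bD = on_bracket[OF on]
  have R': "ring E'"
  proof (rule ringI)
    show "abelian_group E'"
    proof (rule abelian_groupI)
      show "\<exists>y\<in>carrier E'. y \<oplus>\<^bsub>E'\<^esub> x = \<zero>\<^bsub>E'\<^esub>" if x: "x \<in> carrier E'" for x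
      proof -
        obtain u where u: "u \<in> carrier E" "x = e u" using x by (auto simp: carrier)
        show ?thesis by (rule bexI[of _ "e (\<ominus>\<^bsub>E\<^esub> u)"]) (use u in \<open>auto simp: carrier add zero E.l_neg\<close>)
      qed
    qed (auto simp: carrier add zero E.a_ac)
    show "monoid E'"
      by (rule monoidI) (auto simp: carrier mult one E.m_assoc)
  qed (auto simp: carrier add mult E.l_distr E.r_distr)
  interpret E': ring E' by (rule R')
  have M': "module R E'"
    by (rule moduleI)
      (auto simp: M.R.is_cring E'.is_abelian_group carrier add smult M.smult_l_distr M.smult_r_distr M.smult_assoc1)
  interpret M': module R E' by (rule M')
  have minus: "\<ominus>\<^bsub>E'\<^esub> e u = e (\<ominus>\<^bsub>E\<^esub> u)" if "u \<in> carrier E" for u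
    using that by (intro E'.minus_equality) (auto simp: carrier add zero E.l_neg)
  have signed: "signed E' k (e u) = e (signed E k u)" if "u \<in> carrier E" for k u
    using that by (simp add: signed_def minus)
  have sub: "submodule (part E' i) R E'" for i
  proof (rule M'.submoduleI)
    note s = M.submoduleE[OF on_submodule[OF on, of i]]
    interpret T: twisted_bracket E d b t by (rule on_twisted_bracket[OF on])
    show "\<zero>\<^bsub>E'\<^esub> \<in> part E' i" by (auto simp: zero part)
    show "\<ominus>\<^bsub>E'\<^esub> a \<in> part E' i" if "a \<in> part E' i" for a
      using that s(3) C[of _ i] by (auto simp: part minus)
  qed (use C[of _ i] M.submoduleE[OF on_submodule[OF on, of i]] in \<open>auto simp: carrier part add smult\<close>)
  have decomp: "\<exists>!c. (\<forall>i. c i \<in> part E' i) \<and> finite {i. c i \<noteq> \<zero>\<^bsub>E'\<^esub>} \<and>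
        x = (\<Oplus>\<^bsub>E'\<^esub> i \<in> {i. c i \<noteq> \<zero>\<^bsub>E'\<^esub>}. c i)" if x: "x \<in> carrier E'" for x
  proof -
    obtain u where u: "u \<in> carrier E" "x = e u" using x by (auto simp: carrier)
    have ex1: "\<exists>!c. (\<forall>i. c i \<in> d i) \<and> finite {i. c i \<noteq> \<zero>\<^bsub>E\<^esub>} \<and> u = (\<Oplus>\<^bsub>E\<^esub> i \<in> {i. c i \<noteq> \<zero>\<^bsub>E\<^esub>}. c i)"
      using on_graded[OF on] u(1) by (simp add: graded_algebra_def)
    \<comment> \<open>Decompositions of \<open>e u\<close> with components \<open>e (c i)\<close>
      correspond to decompositions of \<open>u\<close>, because \<open>e\<close> reflects both
      equality and being zero.\<close>
    have iff: "((\<forall>i. e (c i) \<in> part E' i) \<and> finite {i. e (c i) \<noteq> \<zero>\<^bsub>E'\<^esub>} \<and>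
        x = (\<Oplus>\<^bsub>E'\<^esub> i \<in> {i. e (c i) \<noteq> \<zero>\<^bsub>E'\<^esub>}. e (c i))) \<longleftrightarrow>
      finite {i. c i \<noteq> \<zero>\<^bsub>E\<^esub>} \<and> u = (\<Oplus>\<^bsub>E\<^esub> i \<in> {i. c i \<noteq> \<zero>\<^bsub>E\<^esub>}. c i)"
      if c: "\<And>i. c i \<in> d i" for c
    proof -
      have cc: "c i \<in> carrier E" for i using C[OF c] .
      have z: "e (c i) = \<zero>\<^bsub>E'\<^esub> \<longleftrightarrow> c i = \<zero>\<^bsub>E\<^esub>" for i
        unfolding zero using inj_on_eq_iff[OF inj cc E.zero_closed] .
      let ?S = "{i. c i \<noteq> \<zero>\<^bsub>E\<^esub>}"
      have s: "(\<Oplus>\<^bsub>E'\<^esub> i \<in> ?S. e (c i)) = e (\<Oplus>\<^bsub>E\<^esub> i \<in> ?S. c i)" if "finite ?S"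
        by (rule E'.additive_finsum[symmetric]) (use that cc in \<open>auto simp: add carrier E.is_abelian_group\<close>)
      have "e u = e (\<Oplus>\<^bsub>E\<^esub> i \<in> ?S. c i) \<longleftrightarrow> u = (\<Oplus>\<^bsub>E\<^esub> i \<in> ?S. c i)"
        using inj_on_eq_iff[OF inj u(1)] cc by (simp add: Pi_def)
      then show ?thesis using c s by (auto simp: z part u(2))
    qed
    from ex1 obtain c where c: "\<And>i. c i \<in> d i" "finite {i. c i \<noteq> \<zero>\<^bsub>E\<^esub>} \<and> u = (\<Oplus>\<^bsub>E\<^esub> i \<in> {i. c i \<noteq> \<zero>\<^bsub>E\<^esub>}. c i)"
      by blast
    show ?thesis
    proof (rule ex1I)
      show "(\<forall>i. e (c i) \<in> part E' i) \<and> finite {i. e (c i) \<noteq> \<zero>\<^bsub>E'\<^esub>} \<and>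
          x = (\<Oplus>\<^bsub>E'\<^esub> i \<in> {i. e (c i) \<noteq> \<zero>\<^bsub>E'\<^esub>}. e (c i))"
        using c(2) unfolding iff[OF c(1)] .
      fix c' assume c': "(\<forall>i. c' i \<in> part E' i) \<and> finite {i. c' i \<noteq> \<zero>\<^bsub>E'\<^esub>} \<and>
          x = (\<Oplus>\<^bsub>E'\<^esub> i \<in> {i. c' i \<noteq> \<zero>\<^bsub>E'\<^esub>}. c' i)"
      then have "\<forall>i. \<exists>y. y \<in> d i \<and> c' i = e y" by (auto simp: part)
      then obtain c'' where c'': "\<And>i. c'' i \<in> d i" "\<And>i. c' i = e (c'' i)" by metis
      have "finite {i. c'' i \<noteq> \<zero>\<^bsub>E\<^esub>} \<and> u = (\<Oplus>\<^bsub>E\<^esub> i \<in> {i. c'' i \<noteq> \<zero>\<^bsub>E\<^esub>}. c'' i)"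
        using c' unfolding c''(2) using iff[of c'', OF c''(1)] by blast
      then have "c'' = c" using ex1 c c''(1) by blast
      then show "c' = (\<lambda>i. e (c i))" using c''(2) by auto
    qed
  qed
  have b_d: "b u v \<in> carrier E" if "u \<in> d i" "v \<in> d j" for u v i j
    using that C by (simp add: bD)
  show ?thesis
    unfolding hom_gerstenhaber_iff hom_gerstenhaber_on_def
  proof (intro conjI)
    show "graded_algebra R E' (part E')"
      unfolding graded_algebra_def
    proof (intro conjI allI ballI M' R' sub decomp)
      show "\<one>\<^bsub>E'\<^esub> \<in> part E' 0" using on_one[OF on] by (auto simp: one part)
      show "x \<otimes>\<^bsub>E'\<^esub> y \<in> part E' (i + j)" if "x \<in> part E' i" "y \<in> part E' j" for i j x y
        using that on_mult[OF on, of _ i _ j] C by (auto simp: part mult)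
    qed (auto simp: carrier mult smult on_smult_left[OF on] on_smult_right[OF on])
    show "graded_commutative E' (part E')"
      unfolding graded_commutative_def part ball_simps
    proof (intro conjI allI ballI impI)
      show "e u \<otimes>\<^bsub>E'\<^esub> e v = signed E' (int i * int j) (e v \<otimes>\<^bsub>E'\<^esub> e u)"
        if "u \<in> d i" "v \<in> d j" for u v i j
        using on_comm[OF on that] C[OF that(1)] C[OF that(2)] by (simp only: mult signed E.m_closed)
      show "e u \<otimes>\<^bsub>E'\<^esub> e u = \<zero>\<^bsub>E'\<^esub>" if "odd i" "u \<in> d i" for i u
        using on_odd_square[OF on that] C[OF that(2)] by (simp add: mult zero)
    qed
    show "algebra_hom R E' E' (twist E')"
      by (rule algebra_homI) (auto simp: carrier mult one add smult twist tD)
    show "\<forall>i. twist E' ` part E' i \<subseteq> part E' i"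
      using on_twist_d[OF on] C by (auto simp: part twist)
    show "bilinear_map R E' E' E' (bracket E')"
      by (auto simp: bilinear_map_def linear_map_def carrier bracket add smult bD)
    show "degree_minus_one E' (part E') (bracket E')"
      unfolding degree_minus_one_def part ball_simps
    proof (intro allI ballI)
      fix i j u v assume uv: "u \<in> d i" "v \<in> d j"
      then have "if i + j = 0 then b u v = \<zero>\<^bsub>E\<^esub> else b u v \<in> d (i + j - 1)"
        using on_degree[OF on] unfolding degree_minus_one_def by blast
      then show "if i + j = 0 then bracket E' (e u) (e v) = \<zero>\<^bsub>E'\<^esub>
          else bracket E' (e u) (e v) \<in> e ` d (i + j - 1)"
        using C[OF uv(1)] C[OF uv(2)] by (simp only: bracket zero split: if_splits) auto
    qed
    show "graded_skew E' (part E') (bracket E')"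
      unfolding graded_skew_def part ball_simps
    proof (intro allI ballI)
      fix i j u v assume uv: "u \<in> d i" "v \<in> d j"
      then have "b u v = \<ominus>\<^bsub>E\<^esub> signed E ((int i - 1) * (int j - 1)) (b v u)"
        using on_skew[OF on] unfolding graded_skew_def by blast
      moreover have "bracket E' (e u) (e v) = e (b u v)" "bracket E' (e v) (e u) = e (b v u)"
        using uv C by (simp_all add: bracket)
      ultimately show "bracket E' (e u) (e v) = \<ominus>\<^bsub>E'\<^esub> signed E' ((int i - 1) * (int j - 1)) (bracket E' (e v) (e u))"
        using uv C bD by (simp add: signed minus)
    qed
    show "\<forall>x\<in>carrier E'. \<forall>y\<in>carrier E'. twist E' (bracket E' x y) = bracket E' (twist E' x) (twist E' y)"
      by (auto simp: carrier bracket twist bD tD on_twist_bracket[OF on])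
    show "\<forall>i j k. \<forall>x\<in>part E' i. \<forall>y\<in>part E' j. \<forall>z\<in>part E' k.
       signed E' ((int i - 1) * (int k - 1)) (bracket E' (twist E' x) (bracket E' y z)) \<oplus>\<^bsub>E'\<^esub>
       signed E' ((int j - 1) * (int i - 1)) (bracket E' (twist E' y) (bracket E' z x)) \<oplus>\<^bsub>E'\<^esub>
       signed E' ((int k - 1) * (int j - 1)) (bracket E' (twist E' z) (bracket E' x y)) = \<zero>\<^bsub>E'\<^esub>"
      unfolding part ball_simps
      using on_jacobi[OF on] C by (simp add: bracket twist bD tD signed add zero)
    show "\<forall>i j k. \<forall>x\<in>part E' i. \<forall>y\<in>part E' j. \<forall>z\<in>part E' k.
       bracket E' x (y \<otimes>\<^bsub>E'\<^esub> z) = bracket E' x y \<otimes>\<^bsub>E'\<^esub> twist E' z \<oplus>\<^bsub>E'\<^esub>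
       signed E' ((int i - 1) * int j) (twist E' y \<otimes>\<^bsub>E'\<^esub> bracket E' x z)"
      unfolding part ball_simps
      using on_leibniz[OF on] C by (simp add: bracket twist bD tD signed add mult)
  qed
qed

section \<open>An injection of the exterior algebra into the universe\<close>

text \<open>Iterated pairing is shown to be injective among lists of equal length. The length is
  therefore recorded beside it, through an injection \<open>k\<close> of the natural
  numbers.\<close>

lemma inj_lists:
  assumes "infinite (UNIV :: 'u set)"
  shows "\<exists>(p :: 'u \<times> 'u \<Rightarrow> 'u) (l :: 'u list \<Rightarrow> 'u). inj p \<and> inj l"
proof -
  obtain p :: "'u \<times> 'u \<Rightarrow> 'u" where "bij_betw p (UNIV \<times> UNIV) UNIV"
    using card_of_Times_same_infinite[OF assms] unfolding card_of_ordIso[symmetric] by blast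
  then have p: "inj p" by (simp add: bij_betw_def)
  obtain k :: "nat \<Rightarrow> 'u" where k: "inj k"
    using infinite_countable_subset[OF assms] by blast
  define m where "m xs = foldr (\<lambda>x y. p (x, y)) xs (k 0)" for xs
  have m: "m xs = m ys \<Longrightarrow> xs = ys" if "length xs = length ys" for xs ys
    using that by (induction xs ys rule: list_induct2) (auto simp: m_def dest: injD[OF p])
  have "inj (\<lambda>xs. p (k (length xs), m xs))"
  proof (rule injI)
    fix xs ys assume "p (k (length xs), m xs) = p (k (length ys), m ys)"
    then have "k (length xs) = k (length ys)" "m xs = m ys"
      using injD[OF p] by blast+
    then show "xs = ys" using m injD[OF k] by blast
  qed
  then show ?thesis using p by blast
qed

text \<open>A class is replaced by a representative, this by its finite graph, the graph by a list
  of pairs of a word and a coefficient, and the list by its code. The chain merely witnesses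
  existence; \<open>exterior_code\<close> remains some unspecified injection.\<close>

lemma exterior_code_inj:
  fixes X :: "('r, 'u, 'u) hom_lie_rinehart_data"
  assumes inf: "infinite (UNIV :: 'u set)" and X: "exterior_module (base X) (space X)"
  shows "inj_on (exterior_code X) (carrier (exterior (base X) (space X)))"
proof -
  interpret exterior_module "base X" "space X" by (rule X)
  obtain p :: "'u \<times> 'u \<Rightarrow> 'u" and l :: "'u list \<Rightarrow> 'u" where p: "inj p" and l: "inj l"
    using inj_lists[OF inf] by blast
  define rep where "rep u = (SOME q. q \<in> carrier T \<and> u = cls q)" for u
  have rep: "rep u \<in> carrier T" "u = cls (rep u)" if "u \<in> carrier E" for u
  proof -
    have "\<exists>q. q \<in> carrier T \<and> u = cls q" using that by (auto simp: E_carrier)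
    then have "rep u \<in> carrier T \<and> u = cls (rep u)" unfolding rep_def by (rule someI_ex)
    then show "rep u \<in> carrier T" "u = cls (rep u)" by auto
  qed
  define graph where "graph q = {(w, q w) | w. q w \<noteq> \<zero>\<^bsub>base X\<^esub>}" for q :: "'u list \<Rightarrow> 'u"
  define li where "li q = (SOME zs. set zs = graph q)" for q
  have li: "set (li q) = graph q" if "q \<in> carrier T" for q
  proof -
    have "graph q = (\<lambda>w. (w, q w)) ` {w. q w \<noteq> \<zero>\<^bsub>base X\<^esub>}" by (auto simp: graph_def)
    then have "finite (graph q)" using that by (simp add: T_carrier)
    then have "\<exists>zs. set zs = graph q" by (rule finite_list)
    then show ?thesis unfolding li_def by (rule someI_ex)
  qed
  have graph_inj: "q = q'" if "graph q = graph q'" for q q'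
  proof
    fix w
    have "(w, a) \<in> graph q \<longleftrightarrow> q w = a \<and> a \<noteq> \<zero>\<^bsub>base X\<^esub>"
      "(w, a) \<in> graph q' \<longleftrightarrow> q' w = a \<and> a \<noteq> \<zero>\<^bsub>base X\<^esub>" for a
      by (auto simp: graph_def)
    then show "q w = q' w" using that by metis
  qed
  define enc where "enc = (\<lambda>(w, a). p (l w, a))"
  have enc: "inj enc"
    by (rule injI) (auto simp: enc_def dest!: injD[OF p] injD[OF l])
  define e where "e u = l (map enc (li (rep u)))" for u
  have "inj_on e (carrier E)"
  proof (rule inj_onI)
    fix u v assume u: "u \<in> carrier E" and v: "v \<in> carrier E" and "e u = e v"
    then have "map enc (li (rep u)) = map enc (li (rep v))" using injD[OF l] by (auto simp: e_def)
    then have "li (rep u) = li (rep v)" using enc by (simp add: inj_map_eq_map)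
    then have "graph (rep u) = graph (rep v)" using li rep u v by metis
    then have "rep u = rep v" by (rule graph_inj)
    then show "u = v" using rep(2)[OF u] rep(2)[OF v] by simp
  qed
  then show ?thesis unfolding exterior_code_def by (rule someI[of "\<lambda>e. inj_on e (carrier E)"])
qed

section \<open>The functor from hom-Gerstenhaber to hom-Lie-Rinehart algebras\<close>

lemma functor_F_simps [simp]:
  "carrier (base (fobj functor_F Y)) = part Y 0" "mult (base (fobj functor_F Y)) = mult Y"
  "one (base (fobj functor_F Y)) = one Y" "zero (base (fobj functor_F Y)) = zero Y"
  "add (base (fobj functor_F Y)) = add Y" "smult (base (fobj functor_F Y)) = smult Y"
  "carrier (space (fobj functor_F Y)) = part Y 1"
  "zero (space (fobj functor_F Y)) = zero Y"
  "add (space (fobj functor_F Y)) = add Y" "smult (space (fobj functor_F Y)) = mult Y"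
  "lie (fobj functor_F Y) = bracket Y" "phi (fobj functor_F Y) = twist Y"
  "alpha (fobj functor_F Y) = twist Y" "anchor (fobj functor_F Y) = bracket Y"
  by (simp_all add: functor_F_def)

locale gerst =
  fixes R :: "'r ring" and Y :: "('r, 'g) hom_gerstenhaber_data"
  assumes hom_gerstenhaber: "hom_gerstenhaber R Y"
begin

lemmas on = hom_gerstenhaber[unfolded hom_gerstenhaber_iff]

sublocale twisted_bracket Y "part Y" "bracket Y" "twist Y"
  by (rule on_twisted_bracket[OF on])

sublocale Y: module R Y by (rule on_module[OF on])

abbreviation "B \<equiv> base (fobj functor_F Y)"
abbreviation "K \<equiv> space (fobj functor_F Y)"

lemma part_closed: "u \<in> part Y i \<Longrightarrow> u \<in> carrier Y"
  by (rule on_d_closed[OF on])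

lemma part_minus: "u \<in> part Y i \<Longrightarrow> \<ominus>\<^bsub>Y\<^esub> u \<in> part Y i"
  and part_smult: "r \<in> carrier R \<Longrightarrow> u \<in> part Y i \<Longrightarrow> r \<odot>\<^bsub>Y\<^esub> u \<in> part Y i"
  using Y.submoduleE(3,4)[OF on_submodule[OF on, of i]] by blast+

lemma part_mult: "u \<in> part Y 0 \<Longrightarrow> v \<in> part Y i \<Longrightarrow> u \<otimes>\<^bsub>Y\<^esub> v \<in> part Y i"
  using on_mult[OF on, of u 0 v i] by simp

lemma part_bracket: "u \<in> part Y 1 \<Longrightarrow> v \<in> part Y i \<Longrightarrow> bracket Y u v \<in> part Y i"
  using b_dg[of u 1 v i i] by simp

lemma part_abelian_group:
  assumes "carrier H = part Y i" "add H = add Y" "zero H = zero Y"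
  shows "abelian_group H"
  by (rule abelian_groupI)
    (auto simp: assms a_ac part_closed intro!: bexI[of _ "\<ominus>\<^bsub>Y\<^esub> _"] r_neg part_minus)

text \<open>Additive inverses are defined by a description that refers to the carrier, so those
  formed in a graded part must be identified with those of the whole algebra.\<close>

lemma part_a_inv:
  assumes "carrier H = part Y i" "add H = add Y" "zero H = zero Y" "u \<in> part Y i"
  shows "\<ominus>\<^bsub>H\<^esub> u = \<ominus>\<^bsub>Y\<^esub> u"
proof -
  interpret H: abelian_group H by (rule part_abelian_group[OF assms(1-3)])
  show ?thesis
    by (rule H.minus_equality) (use assms in \<open>simp_all add: part_minus part_closed l_neg\<close>)
qed

lemma part_comm: "u \<in> part Y 0 \<Longrightarrow> v \<in> part Y i \<Longrightarrow> v \<otimes>\<^bsub>Y\<^esub> u = u \<otimes>\<^bsub>Y\<^esub> v"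
  using d_comm[of u 0 v i] by (simp add: signed_def)

lemma B_cring: "cring B"
proof (rule cringI)
  show "abelian_group B" by (rule part_abelian_group) simp_all
  show "comm_monoid B"
  proof (rule comm_monoidI)
    show "x \<otimes>\<^bsub>B\<^esub> y = y \<otimes>\<^bsub>B\<^esub> x" if "x \<in> carrier B" "y \<in> carrier B" for x y
      using that part_comm[of y x 0] by simp
  qed (simp_all add: part_mult on_one[OF on] m_assoc part_closed)
qed (simp add: l_distr part_closed)

lemma B_algebra: "algebra R B"
  by (rule algebraI)
    (auto simp: Y.R.is_cring B_cring part_smult part_closed Y.smult_l_distr Y.smult_r_distr Y.smult_assoc1
      on_smult_left[OF on])

lemma K_module: "module B K"
proof (rule moduleI)
  show "abelian_group K" by (rule part_abelian_group) simp_all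
qed (auto simp: B_cring part_mult part_closed l_distr r_distr m_assoc)

lemma smult_one_mult: "r \<in> carrier R \<Longrightarrow> u \<in> carrier Y \<Longrightarrow> (r \<odot>\<^bsub>Y\<^esub> \<one>\<^bsub>Y\<^esub>) \<otimes>\<^bsub>Y\<^esub> u = r \<odot>\<^bsub>Y\<^esub> u"
  by (simp add: on_smult_left[OF on])

lemma KR_module: "module R (restrict_scalars B K)"
proof (rule moduleI)
  show "abelian_group (restrict_scalars B K)" by (rule part_abelian_group) simp_all
qed (auto simp: Y.R.is_cring part_closed smult_one_mult part_smult Y.smult_l_distr Y.smult_r_distr
    Y.smult_assoc1 l_distr on_smult_left[OF on])

lemmas twist_hom = algebra_homD[OF on_twist_hom[OF on]]
lemmas bracket_lin = on_bracket[OF on]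

lemma bracket_skew_1_1: "x \<in> part Y 1 \<Longrightarrow> y \<in> part Y 1 \<Longrightarrow> bracket Y x y = \<ominus>\<^bsub>Y\<^esub> bracket Y y x"
  using skew[of x 1 y 1] by (simp add: signed_def)

lemma bracket_skew_0_1: "a \<in> part Y 0 \<Longrightarrow> x \<in> part Y 1 \<Longrightarrow> bracket Y a x = \<ominus>\<^bsub>Y\<^esub> bracket Y x a"
  using skew[of a 0 x 1] by (simp add: signed_def)

lemma bracket_mult_1: "x \<in> part Y 1 \<Longrightarrow> a \<in> part Y 0 \<Longrightarrow> y \<in> part Y i \<Longrightarrow>
    bracket Y x (a \<otimes>\<^bsub>Y\<^esub> y) = twist Y a \<otimes>\<^bsub>Y\<^esub> bracket Y x y \<oplus>\<^bsub>Y\<^esub> bracket Y x a \<otimes>\<^bsub>Y\<^esub> twist Y y"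
  using b_leibniz[of x 1 a 0 y i] by (simp add: signed_def part_closed a_comm)

text \<open>The Leibniz rule is available in the second argument, so the bracket is turned round;
  the term with \<open>[b, a]\<close> vanishes by degree.\<close>

lemma bracket_mult_left:
  assumes "x \<in> part Y 1" "a \<in> part Y 0" "b \<in> part Y 0"
  shows "bracket Y (a \<otimes>\<^bsub>Y\<^esub> x) b = twist Y a \<otimes>\<^bsub>Y\<^esub> bracket Y x b"
proof -
  have "a \<otimes>\<^bsub>Y\<^esub> x \<in> part Y 1" using assms by (simp add: part_mult)
  then have "bracket Y b (a \<otimes>\<^bsub>Y\<^esub> x) = \<ominus>\<^bsub>Y\<^esub> bracket Y (a \<otimes>\<^bsub>Y\<^esub> x) b"
    using assms by (intro bracket_skew_0_1)
  moreover have "bracket Y b (a \<otimes>\<^bsub>Y\<^esub> x) = \<ominus>\<^bsub>Y\<^esub> (twist Y a \<otimes>\<^bsub>Y\<^esub> bracket Y x b)"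
    using b_leibniz[of b 0 a 0 x 1] assms b_dg_0[of b a] bracket_skew_0_1[of b x]
    by (simp add: signed_def part_closed r_minus)
  ultimately have "\<ominus>\<^bsub>Y\<^esub> bracket Y (a \<otimes>\<^bsub>Y\<^esub> x) b = \<ominus>\<^bsub>Y\<^esub> (twist Y a \<otimes>\<^bsub>Y\<^esub> bracket Y x b)" by simp
  moreover have "bracket Y (a \<otimes>\<^bsub>Y\<^esub> x) b \<in> carrier Y" "twist Y a \<otimes>\<^bsub>Y\<^esub> bracket Y x b \<in> carrier Y"
    using assms by (simp_all add: part_closed)
  ultimately show ?thesis by (metis minus_minus)
qed

lemma F_hom_lie_algebra: "hom_lie_algebra R (restrict_scalars B K) (bracket Y) (twist Y)"
proof (intro hom_lie_algebra.intro KR_module hom_lie_algebra_axioms.intro)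
  show "bilinear_map R (restrict_scalars B K) (restrict_scalars B K) (restrict_scalars B K) (bracket Y)"
    by (auto simp: bilinear_map_def linear_map_def part_bracket bracket_lin part_closed smult_one_mult)
  show "linear_map R (restrict_scalars B K) (restrict_scalars B K) (twist Y)"
    by (auto simp: linear_map_def twist_hom part_closed smult_one_mult)
  fix x y assume "x \<in> carrier (restrict_scalars B K)" "y \<in> carrier (restrict_scalars B K)"
  then have xy: "x \<in> part Y 1" "y \<in> part Y 1" by simp_all
  have "\<ominus>\<^bsub>K\<^esub> bracket Y y x = \<ominus>\<^bsub>Y\<^esub> bracket Y y x"
    by (rule part_a_inv[where i = 1]) (use xy in \<open>simp_all add: part_bracket\<close>)
  then show "bracket Y x y = \<ominus>\<^bsub>restrict_scalars B K\<^esub> bracket Y y x"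
    using bracket_skew_1_1[OF xy] by simp
  show "twist Y (bracket Y x y) = bracket Y (twist Y x) (twist Y y)"
    using xy by (simp add: on_twist_bracket[OF on] part_closed)
  fix z assume "z \<in> carrier (restrict_scalars B K)"
  then have z: "z \<in> part Y 1" by simp
  show "bracket Y (twist Y x) (bracket Y y z) \<oplus>\<^bsub>restrict_scalars B K\<^esub> bracket Y (twist Y y) (bracket Y z x)
      \<oplus>\<^bsub>restrict_scalars B K\<^esub> bracket Y (twist Y z) (bracket Y x y) = \<zero>\<^bsub>restrict_scalars B K\<^esub>"
    using on_jacobi[OF on xy z] by (simp add: signed_def)
qed

text \<open>The graded Jacobi identity in degrees 1, 1, 0, where all three signs are trivial, after
  turning round the two brackets whose first argument has degree 0.\<close>

lemma rep_identity:
  assumes x: "x \<in> part Y 1" and y: "y \<in> part Y 1" and a: "a \<in> part Y 0"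
  shows "bracket Y (bracket Y x y) (twist Y a) =
    bracket Y (twist Y x) (bracket Y y a) \<ominus>\<^bsub>Y\<^esub> bracket Y (twist Y y) (bracket Y x a)"
proof -
  let ?X = "bracket Y (twist Y x) (bracket Y y a)" and ?Y = "bracket Y (twist Y y) (bracket Y x a)"
    and ?Z = "bracket Y (bracket Y x y) (twist Y a)"
  have c: "?X \<in> carrier Y" "?Y \<in> carrier Y" "?Z \<in> carrier Y"
    using x y a by (simp_all add: part_closed)
  have 1: "bracket Y (twist Y y) (bracket Y a x) = \<ominus>\<^bsub>Y\<^esub> ?Y"
    using x y a bracket_skew_0_1[OF a x] by (simp add: b_minus_right part_closed)
  have 2: "bracket Y (twist Y a) (bracket Y x y) = \<ominus>\<^bsub>Y\<^esub> ?Z"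
    using x y a by (intro bracket_skew_0_1) (simp_all add: part_bracket)
  have "?X \<oplus>\<^bsub>Y\<^esub> \<ominus>\<^bsub>Y\<^esub> ?Y \<oplus>\<^bsub>Y\<^esub> \<ominus>\<^bsub>Y\<^esub> ?Z = \<zero>\<^bsub>Y\<^esub>"
    using on_jacobi[OF on x y a] unfolding 1 2 by (simp add: signed_def)
  then have "(?X \<ominus>\<^bsub>Y\<^esub> ?Y) \<oplus>\<^bsub>Y\<^esub> \<ominus>\<^bsub>Y\<^esub> ?Z = \<zero>\<^bsub>Y\<^esub>"
    by (simp add: a_minus_def)
  then show ?thesis using c by (metis a_inv_closed minus_closed minus_equality minus_minus)
qed

lemma F_representation:
  "hom_lie_representation R (restrict_scalars B K) (bracket Y) (twist Y) B (bracket Y) (twist Y)"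
proof (intro hom_lie_representation.intro F_hom_lie_algebra hom_lie_representation_axioms.intro)
  interpret BA: algebra R B by (rule B_algebra)
  show "module R B" ..
  show "bilinear_map R (restrict_scalars B K) B B (bracket Y)"
    by (auto simp: bilinear_map_def linear_map_def part_bracket bracket_lin part_closed smult_one_mult)
  show "linear_map R B B (twist Y)"
    by (auto simp: linear_map_def twist_hom part_closed)
  show "bracket Y (twist Y x) (twist Y v) = twist Y (bracket Y x v)"
    if "x \<in> carrier (restrict_scalars B K)" "v \<in> carrier B" for x v
    using that by (simp add: on_twist_bracket[OF on] part_closed)
  show "bracket Y (bracket Y x y) (twist Y v) =
      bracket Y (twist Y x) (bracket Y y v) \<ominus>\<^bsub>B\<^esub> bracket Y (twist Y y) (bracket Y x v)"
    if "x \<in> carrier (restrict_scalars B K)" "y \<in> carrier (restrict_scalars B K)" "v \<in> carrier B" for x y v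
  proof -
    have "\<ominus>\<^bsub>B\<^esub> bracket Y (twist Y y) (bracket Y x v) = \<ominus>\<^bsub>Y\<^esub> bracket Y (twist Y y) (bracket Y x v)"
      by (rule part_a_inv[where i = 0]) (use that in \<open>simp_all add: part_bracket\<close>)
    then show ?thesis using rep_identity[of x y v] that by (simp add: a_minus_def)
  qed
qed

lemma F_hom_lie_rinehart: "hom_lie_rinehart R (fobj functor_F Y)"
  unfolding hom_lie_rinehart_def Let_def
proof (intro conjI)
  show "algebra_hom R B B (phi (fobj functor_F Y))"
    by (rule algebra_homI) (simp_all add: twist_hom part_closed)
  show "\<forall>x\<in>carrier K. anchor (fobj functor_F Y) x \<in> twisted_derivations R B (phi (fobj functor_F Y))"
    using bracket_mult_1[where i = 0] 
    by (auto simp: twisted_derivations_def linear_map_def part_bracket bracket_lin part_closed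
        part_comm[of _ _ 0])
  show "\<forall>a\<in>carrier B. linear_map R (restrict_scalars B K) B (\<lambda>x. anchor (fobj functor_F Y) x a)"
    by (auto simp: linear_map_def part_bracket bracket_lin part_closed smult_one_mult)
qed (simp_all add: B_algebra K_module F_hom_lie_algebra[simplified] F_representation[simplified]
      twist_hom part_closed bracket_mult_left bracket_mult_1[where i = 1, simplified])

end

section \<open>The categories\<close>

lemma hom_gerstenhaber_homsD:
  assumes "h \<in> hom_gerstenhaber_homs R E E'"
  shows "h \<in> extensional (carrier E)" "algebra_hom R E E' h"
    "\<And>i u. u \<in> part E i \<Longrightarrow> h u \<in> part E' i"
    "\<And>u v. u \<in> carrier E \<Longrightarrow> v \<in> carrier E \<Longrightarrow> h (bracket E u v) = bracket E' (h u) (h v)"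
    "\<And>u. u \<in> carrier E \<Longrightarrow> h (twist E u) = twist E' (h u)"
  using assms by (auto simp: hom_gerstenhaber_homs_def)

lemma hom_gerstenhaber_homsI:
  assumes "h \<in> extensional (carrier E)" "algebra_hom R E E' h"
    "\<And>i u. u \<in> part E i \<Longrightarrow> h u \<in> part E' i"
    "\<And>u v. u \<in> carrier E \<Longrightarrow> v \<in> carrier E \<Longrightarrow> h (bracket E u v) = bracket E' (h u) (h v)"
    "\<And>u. u \<in> carrier E \<Longrightarrow> h (twist E u) = twist E' (h u)"
  shows "h \<in> hom_gerstenhaber_homs R E E'"
  using assms by (auto simp: hom_gerstenhaber_homs_def)

lemma hLR_homsD:
  assumes "k \<in> hom_lie_rinehart_homs R X Y"
  shows "fst k \<in> extensional (carrier (base X))" "snd k \<in> extensional (carrier (space X))"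
    "algebra_hom R (base X) (base Y) (fst k)"
    "\<And>x. x \<in> carrier (space X) \<Longrightarrow> snd k x \<in> carrier (space Y)"
    "\<And>x y. x \<in> carrier (space X) \<Longrightarrow> y \<in> carrier (space X) \<Longrightarrow>
      snd k (x \<oplus>\<^bsub>space X\<^esub> y) = snd k x \<oplus>\<^bsub>space Y\<^esub> snd k y"
    "\<And>a x. a \<in> carrier (base X) \<Longrightarrow> x \<in> carrier (space X) \<Longrightarrow>
      snd k (a \<odot>\<^bsub>space X\<^esub> x) = fst k a \<odot>\<^bsub>space Y\<^esub> snd k x"
    "\<And>x y. x \<in> carrier (space X) \<Longrightarrow> y \<in> carrier (space X) \<Longrightarrow> snd k (lie X x y) = lie Y (snd k x) (snd k y)"
    "\<And>x. x \<in> carrier (space X) \<Longrightarrow> snd k (alpha X x) = alpha Y (snd k x)"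
    "\<And>a. a \<in> carrier (base X) \<Longrightarrow> fst k (phi X a) = phi Y (fst k a)"
    "\<And>x a. x \<in> carrier (space X) \<Longrightarrow> a \<in> carrier (base X) \<Longrightarrow>
      fst k (anchor X x a) = anchor Y (snd k x) (fst k a)"
  using assms by (auto simp: hom_lie_rinehart_homs_def linear_map_def)

text \<open>Linearity of \<open>f\<close> over \<open>R\<close> is deduced: \<open>r\<close> acts on
  the module as the element \<open>r 1\<close> of \<open>A\<close>, and \<open>f\<close> is
  semilinear along \<open>g\<close>.\<close>

lemma hLR_homsI:
  assumes "g \<in> extensional (carrier (base X))" "f \<in> extensional (carrier (space X))"
    "algebra_hom R (base X) (base Y) g" "algebra R (base X)"
    "\<And>x. x \<in> carrier (space X) \<Longrightarrow> f x \<in> carrier (space Y)"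
    "\<And>x y. x \<in> carrier (space X) \<Longrightarrow> y \<in> carrier (space X) \<Longrightarrow>
      f (x \<oplus>\<^bsub>space X\<^esub> y) = f x \<oplus>\<^bsub>space Y\<^esub> f y"
    "\<And>a x. a \<in> carrier (base X) \<Longrightarrow> x \<in> carrier (space X) \<Longrightarrow>
      f (a \<odot>\<^bsub>space X\<^esub> x) = g a \<odot>\<^bsub>space Y\<^esub> f x"
    "\<And>x y. x \<in> carrier (space X) \<Longrightarrow> y \<in> carrier (space X) \<Longrightarrow> f (lie X x y) = lie Y (f x) (f y)"
    "\<And>x. x \<in> carrier (space X) \<Longrightarrow> f (alpha X x) = alpha Y (f x)"
    "\<And>a. a \<in> carrier (base X) \<Longrightarrow> g (phi X a) = phi Y (g a)"
    "\<And>x a. x \<in> carrier (space X) \<Longrightarrow> a \<in> carrier (base X) \<Longrightarrow>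
      g (anchor X x a) = anchor Y (f x) (g a)"
  shows "(g, f) \<in> hom_lie_rinehart_homs R X Y"
proof -
  interpret algebra R "base X" by fact
  have "r \<odot>\<^bsub>base X\<^esub> \<one>\<^bsub>base X\<^esub> \<in> carrier (base X)" "g (r \<odot>\<^bsub>base X\<^esub> \<one>\<^bsub>base X\<^esub>) = r \<odot>\<^bsub>base Y\<^esub> \<one>\<^bsub>base Y\<^esub>"
    if "r \<in> carrier R" for r
    using that algebra_homD[OF assms(3)] by simp_all
  then show ?thesis using assms by (simp add: hom_lie_rinehart_homs_def linear_map_def Pi_iff)
qed

lemma algebra_hom_compose:
  assumes "algebra_hom R A B g" "algebra_hom R B C g'" "algebra R A"
  shows "algebra_hom R A C (compose (carrier A) g' g)"
proof -
  interpret algebra R A by fact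
  show ?thesis using algebra_homD[OF assms(1)] algebra_homD[OF assms(2)]
    by (intro algebra_homI) (simp_all add: compose_eq)
qed

lemma hLR_homs_compose:
  assumes X: "hom_lie_rinehart R X" and k: "k \<in> hom_lie_rinehart_homs R X Y" and l: "l \<in> hom_lie_rinehart_homs R Y Z"
  shows "(compose (carrier (base X)) (fst l) (fst k), compose (carrier (space X)) (snd l) (snd k))
    \<in> hom_lie_rinehart_homs R X Z"
proof -
  interpret hlr_data R X by (rule hlr_data.intro[OF X])
  note K = hLR_homsD[OF k] algebra_homD[OF hLR_homsD(3)[OF k]]
  note L = hLR_homsD[OF l] algebra_homD[OF hLR_homsD(3)[OF l]]
  show ?thesis
    by (rule hLR_homsI)
      (simp_all add: RA.algebra_axioms algebra_hom_compose[OF K(3) L(3) RA.algebra_axioms] compose_eq K L)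
qed

lemma hLR_homs_id:
  assumes X: "hom_lie_rinehart R X"
  shows "(\<lambda>a \<in> carrier (base X). a, \<lambda>x \<in> carrier (space X). x) \<in> hom_lie_rinehart_homs R X X"
proof -
  interpret hlr_data R X by (rule hlr_data.intro[OF X])
  show ?thesis by (rule hLR_homsI) (auto intro!: algebra_homI RA.algebra_axioms)
qed

lemma hLR_all_simps:
  "Obj (hLR_all R) = {X. hom_lie_rinehart R X}" "Hom (hLR_all R) = hom_lie_rinehart_homs R"
  "idt (hLR_all R) X = (\<lambda>a \<in> carrier (base X). a, \<lambda>x \<in> carrier (space X). x)"
  "cmp (hLR_all R) X Y Z l k =
     (compose (carrier (base X)) (fst l) (fst k), compose (carrier (space X)) (snd l) (snd k))"
  by (simp_all add: hLR_all_def split: prod.splits)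

lemma hGR_simps:
  "Obj (hGR R) = {E. hom_gerstenhaber R E}" "Hom (hGR R) = hom_gerstenhaber_homs R"
  "idt (hGR R) E = (\<lambda>x \<in> carrier E. x)" "cmp (hGR R) E E' E'' l k = compose (carrier E) l k"
  by (simp_all add: hGR_def)

lemma hLR_all_category: "is_category (hLR_all R)"
  unfolding is_category_def hLR_all_simps
proof (intro conjI ballI; (simp only: mem_Collect_eq)?)
  fix W X Y Z k l m
  assume W: "hom_lie_rinehart R W" and X: "hom_lie_rinehart R X" and k: "k \<in> hom_lie_rinehart_homs R W X" and l: "l \<in> hom_lie_rinehart_homs R X Y"
    and m: "m \<in> hom_lie_rinehart_homs R Y Z"
  show "(compose (carrier (base W)) (fst m) (fst (compose (carrier (base W)) (fst l) (fst k), compose (carrier (space W)) (snd l) (snd k))),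
      compose (carrier (space W)) (snd m) (snd (compose (carrier (base W)) (fst l) (fst k), compose (carrier (space W)) (snd l) (snd k)))) =
    (compose (carrier (base W)) (fst (compose (carrier (base X)) (fst m) (fst l), compose (carrier (space X)) (snd m) (snd l))) (fst k),
     compose (carrier (space W)) (snd (compose (carrier (base X)) (fst m) (fst l), compose (carrier (space X)) (snd m) (snd l))) (snd k))"
    using hLR_homsD(4)[OF k] algebra_homD(1)[OF hLR_homsD(3)[OF k]] by (auto simp: compose_def fun_eq_iff)
next
  fix X Y k assume "hom_lie_rinehart R X" and k: "k \<in> hom_lie_rinehart_homs R X Y"
  note K = hLR_homsD(1,2,4)[OF k] algebra_homD(1)[OF hLR_homsD(3)[OF k]]
  show "(compose (carrier (base X)) (fst k) (fst (\<lambda>a\<in>carrier (base X). a, \<lambda>x\<in>carrier (space X). x)),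
      compose (carrier (space X)) (snd k) (snd (\<lambda>a\<in>carrier (base X). a, \<lambda>x\<in>carrier (space X). x))) = k"
    using K(1,2) by (intro prod_eqI) (auto simp: compose_def fun_eq_iff extensional_def)
  show "(compose (carrier (base X)) (fst (\<lambda>a\<in>carrier (base Y). a, \<lambda>x\<in>carrier (space Y). x)) (fst k),
      compose (carrier (space X)) (snd (\<lambda>a\<in>carrier (base Y). a, \<lambda>x\<in>carrier (space Y). x)) (snd k)) = k"
    using K by (intro prod_eqI) (auto simp: compose_def fun_eq_iff extensional_def)
qed (auto intro: hLR_homs_compose hLR_homs_id)

lemma on_closed:
  assumes "hom_gerstenhaber R E"
  shows "module R E" "ring E" "\<And>u v. u \<in> carrier E \<Longrightarrow> v \<in> carrier E \<Longrightarrow> bracket E u v \<in> carrier E"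
    "\<And>u. u \<in> carrier E \<Longrightarrow> twist E u \<in> carrier E" "\<And>u i. u \<in> part E i \<Longrightarrow> u \<in> carrier E"
  using assms unfolding hom_gerstenhaber_iff
  by (auto simp: on_module on_ring on_bracket algebra_homD(1)[OF on_twist_hom] on_d_closed)

lemma hGR_homs_compose:
  assumes E: "hom_gerstenhaber R E" and k: "k \<in> hom_gerstenhaber_homs R E E'" and l: "l \<in> hom_gerstenhaber_homs R E' E''"
  shows "compose (carrier E) l k \<in> hom_gerstenhaber_homs R E E''"
proof -
  note C = on_closed[OF E]
  interpret E: ring E by (rule C)
  interpret M: module R E by (rule C)
  note K = hom_gerstenhaber_homsD[OF k] algebra_homD[OF hom_gerstenhaber_homsD(2)[OF k]]
  note L = hom_gerstenhaber_homsD[OF l] algebra_homD[OF hom_gerstenhaber_homsD(2)[OF l]]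
  show ?thesis
  proof (rule hom_gerstenhaber_homsI)
    show "algebra_hom R E E'' (compose (carrier E) l k)"
      by (rule algebra_homI) (simp_all add: compose_eq K L)
    show "compose (carrier E) l k u \<in> part E'' i" if "u \<in> part E i" for u i
      using that C(5)[OF that] by (simp add: compose_eq K L)
  qed (simp_all add: compose_eq K L C)
qed

lemma hGR_homs_id:
  assumes E: "hom_gerstenhaber R E"
  shows "(\<lambda>x \<in> carrier E. x) \<in> hom_gerstenhaber_homs R E E"
proof -
  note C = on_closed[OF E]
  interpret E: ring E by (rule C)
  interpret M: module R E by (rule C)
  show ?thesis
  proof (rule hom_gerstenhaber_homsI)
    show "(\<lambda>x \<in> carrier E. x) u \<in> part E i" if "u \<in> part E i" for u i
      using that C(5)[OF that] by simp
  qed (auto intro!: algebra_homI simp: C)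
qed

lemma hGR_category: "is_category (hGR R)"
  unfolding is_category_def hGR_simps
proof (intro conjI ballI; (simp only: mem_Collect_eq)?)
  fix W X Y Z k l m
  assume k: "k \<in> hom_gerstenhaber_homs R W X"
  show "compose (carrier W) m (compose (carrier W) l k) = compose (carrier W) (compose (carrier X) m l) k"
    using algebra_homD(1)[OF hom_gerstenhaber_homsD(2)[OF k]] by (auto simp: compose_def fun_eq_iff)
next
  fix X Y k assume k: "k \<in> hom_gerstenhaber_homs R X Y"
  note K = hom_gerstenhaber_homsD(1)[OF k] algebra_homD(1)[OF hom_gerstenhaber_homsD(2)[OF k]]
  show "compose (carrier X) k (\<lambda>x\<in>carrier X. x) = k" "compose (carrier X) (\<lambda>x\<in>carrier Y. x) k = k"
    using K by (auto simp: compose_def fun_eq_iff extensional_def)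
qed (auto intro: hGR_homs_compose hGR_homs_id)

lemma F_homs:
  assumes E: "hom_gerstenhaber R E" and E': "hom_gerstenhaber R E'" and k: "k \<in> hom_gerstenhaber_homs R E E'"
  shows "fmor functor_F E E' k \<in> hom_lie_rinehart_homs R (fobj functor_F E) (fobj functor_F E')"
proof -
  interpret E: gerst R E by (rule gerst.intro[OF E])
  note K = hom_gerstenhaber_homsD[OF k] algebra_homD[OF hom_gerstenhaber_homsD(2)[OF k]]
  have "(restrict k (part E 0), restrict k (part E 1)) \<in> hom_lie_rinehart_homs R (fobj functor_F E) (fobj functor_F E')"
    by (rule hLR_homsI)
      (auto simp: E.B_algebra K E.part_closed E.part_mult E.part_bracket[simplified] E.part_smult on_one[OF E.on]
        E.part_mult[where i = 1, simplified] intro!: algebra_homI)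
  then show ?thesis by (simp add: functor_F_def)
qed

lemma functor_F_functor: "is_functor (hGR R) (hLR_all R) functor_F"
  unfolding is_functor_def
proof (intro conjI hGR_category hLR_all_category ballI; (simp only: hGR_simps hLR_all_simps mem_Collect_eq)?)
  show "hom_lie_rinehart R (fobj functor_F Y)" if "hom_gerstenhaber R Y" for Y
    by (rule gerst.F_hom_lie_rinehart[OF gerst.intro[OF that]])
  show "fmor functor_F E E' k \<in> hom_lie_rinehart_homs R (fobj functor_F E) (fobj functor_F E')"
    if "hom_gerstenhaber R E" "hom_gerstenhaber R E'" "k \<in> hom_gerstenhaber_homs R E E'" for E E' k
    using that by (rule F_homs)
  show "fmor functor_F Y Y (\<lambda>x\<in>carrier Y. x) = (\<lambda>a\<in>carrier (base (fobj functor_F Y)). a,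
      \<lambda>x\<in>carrier (space (fobj functor_F Y)). x)"
    if "hom_gerstenhaber R Y" for Y
    using on_closed(5)[OF that] by (auto simp: functor_F_def fun_eq_iff)
  show "fmor functor_F X Z (compose (carrier X) l k) =
    (compose (carrier (base (fobj functor_F X))) (fst (fmor functor_F Y Z l)) (fst (fmor functor_F X Y k)),
     compose (carrier (space (fobj functor_F X))) (snd (fmor functor_F Y Z l)) (snd (fmor functor_F X Y k)))"
    if X: "hom_gerstenhaber R X" and k: "k \<in> hom_gerstenhaber_homs R X Y" for X Y Z k l
    using on_closed(5)[OF X] hom_gerstenhaber_homsD(3)[OF k]
    by (auto simp: functor_F_def compose_def fun_eq_iff)
qed

section \<open>The adjunction\<close>

locale hlr_universe = hlr_data R X
  for R :: "'r ring" and X :: "('r, 'u, 'u) hom_lie_rinehart_data" +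
  assumes infinite_universe: "infinite (UNIV :: 'u set)"
begin

abbreviation "e \<equiv> exterior_code X"
abbreviation "GX \<equiv> fobj (functor_G R) X"

lemma e_inj: "inj_on e (carrier E)"
  by (rule exterior_code_inj[OF infinite_universe exterior_module_axioms])

lemma e_inv [simp]: "u \<in> carrier E \<Longrightarrow> inv_into (carrier E) e (e u) = u"
  by (rule inv_into_f_f[OF e_inj])

lemma GX_simps:
  "carrier GX = e ` carrier E" "one GX = e \<one>\<^bsub>E\<^esub>" "zero GX = e \<zero>\<^bsub>E\<^esub>" "part GX i = e ` dg i"
  "smult GX r w = e (r \<odot>\<^bsub>E\<^esub> inv_into (carrier E) e w)"
  by (simp_all add: functor_G_def transport_def Let_def)

lemma GX_ops:
  assumes "u \<in> carrier E" "v \<in> carrier E"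
  shows "e u \<otimes>\<^bsub>GX\<^esub> e v = e (u \<otimes>\<^bsub>E\<^esub> v)" "e u \<oplus>\<^bsub>GX\<^esub> e v = e (u \<oplus>\<^bsub>E\<^esub> v)"
    "bracket GX (e u) (e v) = e (bb u v)"
  using assms by (simp_all add: functor_G_def transport_def Let_def del: bb_b0)

lemma GX_twist: "u \<in> carrier E \<Longrightarrow> twist GX (e u) = e (tw u)"
  by (simp add: functor_G_def transport_def Let_def EG_twist)

lemma GX_smult: "u \<in> carrier E \<Longrightarrow> r \<odot>\<^bsub>GX\<^esub> e u = e (r \<odot>\<^bsub>E\<^esub> u)"
  by (simp add: GX_simps)

lemma GX_hom_gerstenhaber: "hom_gerstenhaber R GX"
  by (rule hom_gerstenhaber_transfer[OF E_hom_gerstenhaber e_inj])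
    (simp_all add: GX_simps GX_ops GX_smult GX_twist del: bb_b0)

end

text \<open>Composition of \<open>h\<close> with the unit, since the two wedges are
  \<open>sc a\<close> and \<open>gn x\<close>. It is stated outside the locales so that it forms a
  family indexed by all \<open>X\<close>.\<close>

definition adjunct ::
  "('r, 'u, 'u) hom_lie_rinehart_data \<Rightarrow> ('u \<Rightarrow> 'u) \<Rightarrow> ('u \<Rightarrow> 'u) \<times> ('u \<Rightarrow> 'u)" where
  "adjunct X h =
     (\<lambda>a \<in> carrier (base X). h (exterior_code X (wedge (base X) (space X) a [])),
      \<lambda>x \<in> carrier (space X). h (exterior_code X (wedge (base X) (space X) \<one>\<^bsub>base X\<^esub> [x])))"

section \<open>The bijection between the two kinds of morphisms\<close>

context hlr_universe
begin

lemma adjunct_apply: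
  "a \<in> carrier A \<Longrightarrow> fst (adjunct X h) a = h (e (sc a))"
  "x \<in> carrier L \<Longrightarrow> snd (adjunct X h) x = h (e (gn x))"
  by (simp_all add: adjunct_def sc_def gn_def)

lemma GX_hom_eqI:
  assumes h: "h \<in> hom_gerstenhaber_homs R GX Y" and h': "h' \<in> hom_gerstenhaber_homs R GX Y"
    and sc: "\<And>a. a \<in> carrier A \<Longrightarrow> h (e (sc a)) = h' (e (sc a))"
    and gn: "\<And>x. x \<in> carrier L \<Longrightarrow> h (e (gn x)) = h' (e (gn x))"
  shows "h = h'"
proof -
  note H = algebra_homD[OF hom_gerstenhaber_homsD(2)[OF h], unfolded GX_simps]
  note H' = algebra_homD[OF hom_gerstenhaber_homsD(2)[OF h'], unfolded GX_simps]
  have "h (e u) = h' (e u)" if "u \<in> carrier E" for u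
    using that
  proof (induction rule: E_induct)
    case (sc a)
    then show ?case by (rule assms(3))
  next
    case (gn x v)
    then show ?case using H(3)[of "e (gn x)" "e v"] H'(3)[of "e (gn x)" "e v"] assms(4)
      by (simp add: GX_ops)
  next
    case (add u v)
    then show ?case using H(2)[of "e u" "e v"] H'(2)[of "e u" "e v"] by (simp add: GX_ops)
  qed
  then show ?thesis
    using hom_gerstenhaber_homsD(1)[OF h] hom_gerstenhaber_homsD(1)[OF h']
    by (intro extensionalityI[of h "carrier GX"]) (auto simp: GX_simps)
qed

lemma adjunct_hom:
  assumes Y: "hom_gerstenhaber R Y" and h: "h \<in> hom_gerstenhaber_homs R GX Y"
  shows "adjunct X h \<in> hom_lie_rinehart_homs R X (fobj functor_F Y)"
proof -
  interpret Y: gerst R Y by (rule gerst.intro[OF Y])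
  note H = hom_gerstenhaber_homsD[OF h, unfolded GX_simps] algebra_homD[OF hom_gerstenhaber_homsD(2)[OF h], unfolded GX_simps]
  have hadd: "h (e (u \<oplus>\<^bsub>E\<^esub> v)) = h (e u) \<oplus>\<^bsub>Y\<^esub> h (e v)" 
    and hmult: "h (e (u \<otimes>\<^bsub>E\<^esub> v)) = h (e u) \<otimes>\<^bsub>Y\<^esub> h (e v)"
    and hbr: "h (e (bb u v)) = bracket Y (h (e u)) (h (e v))"
    if "u \<in> carrier E" "v \<in> carrier E" for u v
    using H(4)[of "e u" "e v"] H(7)[of "e u" "e v"] H(8)[of "e u" "e v"] that
    by (simp_all add: GX_ops del: bb_b0)
  have htw: "h (e (tw u)) = twist Y (h (e u))" if "u \<in> carrier E" for u
    using H(5)[of "e u"] that by (simp add: GX_twist)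
  have hone: "h (e \<one>\<^bsub>E\<^esub>) = \<one>\<^bsub>Y\<^esub>" by (rule H(9))
  have hsm: "h (e (r \<odot>\<^bsub>E\<^esub> u)) = r \<odot>\<^bsub>Y\<^esub> h (e u)" if "r \<in> carrier R" "u \<in> carrier E" for r u
    using algebra_homD(5)[OF hom_gerstenhaber_homsD(2)[OF h], of r "e u"] that
    by (simp add: GX_simps(1) GX_smult)
  have hd: "h (e u) \<in> part Y i" if "u \<in> dg i" for u i
    using H(3)[of "e u" i] that by simp
  have scR: "sc (r \<odot>\<^bsub>A\<^esub> a) = r \<odot>\<^bsub>E\<^esub> sc a" if "r \<in> carrier R" "a \<in> carrier A" for r a
    using that by (simp add: E_smult sc_mult[symmetric] RA.smult_one_mult)
  have "(\<lambda>a \<in> carrier A. h (e (sc a)), \<lambda>x \<in> carrier L. h (e (gn x)))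
      \<in> hom_lie_rinehart_homs R X (fobj functor_F Y)"
  proof (rule hLR_homsI)
    show "algebra_hom R A (base (fobj functor_F Y)) (\<lambda>a \<in> carrier A. h (e (sc a)))"
      by (rule algebra_homI) (simp_all add: hd sc_add sc_mult sc_one scR hadd hmult hone hsm)
    show "algebra R A" ..
    show "(\<lambda>x \<in> carrier L. h (e (gn x))) (lie X x y) = lie (fobj functor_F Y)
        ((\<lambda>x \<in> carrier L. h (e (gn x))) x) ((\<lambda>x \<in> carrier L. h (e (gn x))) y)"
      if "x \<in> carrier L" "y \<in> carrier L" for x y
      using hbr[of "gn x" "gn y"] that by (simp add: b0_gn dx_gn)
    show "(\<lambda>a \<in> carrier A. h (e (sc a))) (anchor X x a) = anchor (fobj functor_F Y)
        ((\<lambda>x \<in> carrier L. h (e (gn x))) x) ((\<lambda>a \<in> carrier A. h (e (sc a))) a)"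
      if "x \<in> carrier L" "a \<in> carrier A" for x a
      using hbr[of "gn x" "sc a"] that by (simp add: b0_gn dx_sc)
    show "(\<lambda>x \<in> carrier L. h (e (gn x))) (alpha X x) = alpha (fobj functor_F Y) ((\<lambda>x \<in> carrier L. h (e (gn x))) x)"
      if "x \<in> carrier L" for x
      using htw[of "gn x"] that by (simp add: tw.lift_gn)
    show "(\<lambda>a \<in> carrier A. h (e (sc a))) (phi X a) = phi (fobj functor_F Y) ((\<lambda>a \<in> carrier A. h (e (sc a))) a)"
      if "a \<in> carrier A" for a
      using htw[of "sc a"] that by (simp add: tw.lift_sc)
  qed (simp_all add: hd gn_add gn_smult hadd hmult)
  then show ?thesis by (simp add: adjunct_def sc_def gn_def)
qed

text \<open>The preimage is the ring map extending \<open>k\<close>, read through the code. Grading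
  and twist are checked by induction over generators; \<open>bracket_map\<close> reduces the
  brackets to the compatibility of \<open>k\<close> with \<open>lie\<close> and
  \<open>anchor\<close>.\<close>

lemma adjunct_surj:
  assumes Y: "hom_gerstenhaber R Y" and k: "k \<in> hom_lie_rinehart_homs R X (fobj functor_F Y)"
  shows "\<exists>h \<in> hom_gerstenhaber_homs R GX Y. adjunct X h = k"
proof -
  interpret Y: gerst R Y by (rule gerst.intro[OF Y])
  note K = hLR_homsD[OF k, simplified] algebra_homD[OF hLR_homsD(3)[OF k], simplified]
  have kp: "fst k a \<in> part Y 0" if "a \<in> carrier A" for a using K(11) that .
  have kq: "snd k x \<in> part Y 1" if "x \<in> carrier L" for x using K(4)[OF that] by simp
  note [simp] = Y.part_closed[OF kp] Y.part_closed[OF kq]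
  interpret lf: exterior_lift A L Y "fst k" "snd k"
  proof unfold_locales
    \<comment> \<open>The relation of the exterior algebra is met because graded commutativity of
      \<open>Y\<close> includes the vanishing of odd squares.\<close>
    show "snd k x \<otimes>\<^bsub>Y\<^esub> snd k x = \<zero>\<^bsub>Y\<^esub>" if "x \<in> carrier L" for x
      using on_odd_square[OF Y.on, of 1 "snd k x"] K that by simp
    show "snd k x \<otimes>\<^bsub>Y\<^esub> fst k a = fst k a \<otimes>\<^bsub>Y\<^esub> snd k x" if "a \<in> carrier A" "x \<in> carrier L" for a x
      using Y.part_comm[of "fst k a" "snd k x" 1] K that by simp
  qed (use K in \<open>auto simp del: One_nat_def\<close>)
  have lf_part: "lf.lift u \<in> part Y n" if "u \<in> dg n" for u n
    using that
  proof (induction rule: dg_induct)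
    case (gn n x v)
    then show ?case using on_mult[OF Y.on, of "snd k x" 1 "lf.lift v" n] K by (simp add: lf.lift_gn_mult)
  qed (use K in \<open>simp_all add: lf.lift_sc lf.lift_add lf.lift_zero\<close>)
  have lf_tw: "lf.lift (tw u) = twist Y (lf.lift u)" if "u \<in> carrier E" for u
    using that
  proof (induction rule: E_induct)
    case (sc a)
    then show ?case using K by (simp add: tw.lift_sc lf.lift_sc)
  next
    case (gn x v)
    then show ?case using K by (simp add: tw.lift_gn_mult lf.lift_gn_mult Y.t_mult Y.part_closed)
  next
    case (add u v)
    then show ?case by (simp add: tw.lift_add lf.lift_add Y.t_add)
  qed
  interpret bm: bracket_map E dg bb tw Y "part Y" "bracket Y" "twist Y" lf.lift
  proof unfold_locales
    show "lf.lift (bb u v) = bracket Y (lf.lift u) (lf.lift v)" if uv: "u \<in> dg 1" "v \<in> dg 1" for u v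
    proof -
      obtain x y where "u = gn x" "v = gn y" "x \<in> carrier L" "y \<in> carrier L"
        using gn_in_dg_1[OF uv(1)] gn_in_dg_1[OF uv(2)] by blast
      then show ?thesis using K by (simp add: b0_gn dx_gn lf.lift_gn)
    qed
    show "lf.lift (bb u v) = bracket Y (lf.lift u) (lf.lift v)" if uv: "u \<in> dg 1" "v \<in> dg 0" for u v
    proof -
      obtain x a where "u = gn x" "v = sc a" "x \<in> carrier L" "a \<in> carrier A"
        using gn_in_dg_1[OF uv(1)] sc_in_dg_0[OF uv(2)] by blast
      then show ?thesis using K by (simp add: b0_gn dx_sc lf.lift_gn lf.lift_sc)
    qed
  qed (simp_all add: lf.lift_add lf.lift_mult lf_part lf_tw)
  have lf_bb: "lf.lift (bb u v) = bracket Y (lf.lift u) (lf.lift v)"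
    if u: "u \<in> carrier E" and v: "v \<in> carrier E" for u v
    using u
  proof (induction rule: E_induct_wdg)
    case (wdg a xs)
    show ?case using v
    proof (induction rule: E_induct_wdg)
      case (wdg c ys)
      show ?case by (rule bm.h_b[OF wdg_dg wdg_dg]) (use wdg \<open>a \<in> _\<close> \<open>set xs \<subseteq> _\<close> in auto)
    next
      case (add v w)
      then show ?case using wdg by (simp add: b0_add_right lf.lift_add Y.b_add_right)
    qed
  next
    case (add u w)
    then show ?case using v by (simp add: b0_add_left lf.lift_add Y.b_add_left)
  qed
  define h where "h = (\<lambda>w \<in> carrier GX. lf.lift (inv_into (carrier E) e w))"
  have h_e: "h (e u) = lf.lift u" if "u \<in> carrier E" for u
    using that by (simp add: h_def GX_simps)
  have E_cl: "r \<odot>\<^bsub>E\<^esub> u \<in> carrier E" if "r \<in> carrier R" "u \<in> carrier E" for r u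
    using that by (simp add: E_smult)
  have "h \<in> hom_gerstenhaber_homs R GX Y"
  proof (rule hom_gerstenhaber_homsI)
    show "algebra_hom R GX Y h"
    proof (rule algebra_homI)
      show "h (r \<odot>\<^bsub>GX\<^esub> w) = r \<odot>\<^bsub>Y\<^esub> h w" if rw: "r \<in> carrier R" "w \<in> carrier GX" for r w
      proof -
        obtain u where u: "w = e u" "u \<in> carrier E" using rw by (auto simp: GX_simps)
        have "lf.lift (r \<odot>\<^bsub>E\<^esub> u) = r \<odot>\<^bsub>Y\<^esub> lf.lift u"
          using rw u K by (simp add: E_smult lf.lift_sc_mult Y.smult_one_mult)
        then show ?thesis using u rw E_cl by (simp add: GX_smult h_e)
      qed
    qed (auto simp: GX_simps(1-4) GX_ops h_e lf.lift_add lf.lift_mult lf.lift_one)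
    show "h w \<in> part Y i" if "w \<in> part GX i" for w i
      using that by (auto simp: GX_simps h_e lf_part)
  qed (auto simp: GX_simps(1-4) GX_ops GX_twist h_e lf_bb lf_tw simp del: bb_b0, simp add: h_def GX_simps)
  moreover have "adjunct X h = k"
  proof (rule prod_eqI)
    show "fst (adjunct X h) = fst k"
    proof (rule extensionalityI[of _ "carrier A"])
      show "fst (adjunct X h) \<in> extensional (carrier A)" by (simp add: adjunct_def)
    qed (use K in \<open>simp_all add: adjunct_apply h_e lf.lift_sc\<close>)
    show "snd (adjunct X h) = snd k"
    proof (rule extensionalityI[of _ "carrier L"])
      show "snd (adjunct X h) \<in> extensional (carrier L)" by (simp add: adjunct_def)
    qed (use K in \<open>simp_all add: adjunct_apply h_e lf.lift_gn\<close>)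
  qed
  ultimately show ?thesis by blast
qed

lemma adjunct_bij:
  assumes Y: "hom_gerstenhaber R Y"
  shows "bij_betw (adjunct X) (hom_gerstenhaber_homs R GX Y) (hom_lie_rinehart_homs R X (fobj functor_F Y))"
  unfolding bij_betw_def
proof (intro conjI inj_onI)
  fix h h' assume h: "h \<in> hom_gerstenhaber_homs R GX Y" "h' \<in> hom_gerstenhaber_homs R GX Y"
    and eq: "adjunct X h = adjunct X h'"
  show "h = h'"
    by (rule GX_hom_eqI[OF h]) (use adjunct_apply eq in metis)+
qed (use adjunct_hom[OF Y] adjunct_surj[OF Y] in blast)

text \<open>The exterior algebra acts on \<open>A \<times> L\<close>, its quotient by the degrees above one.\<close>

lemma gn_inj:
  assumes "x \<in> carrier L" "y \<in> carrier L" "gn x = gn y"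
  shows "x = y"
proof -
  let ?N = "prod_group A L"
  interpret N: abelian_group ?N
    by (intro prod_group R.abelian_group_axioms M.abelian_group_axioms)
  have comm: "a \<odot>\<^bsub>L\<^esub> (b \<odot>\<^bsub>L\<^esub> z) = b \<odot>\<^bsub>L\<^esub> (a \<odot>\<^bsub>L\<^esub> z)"
    if "a \<in> carrier A" "b \<in> carrier A" "z \<in> carrier L" for a b z
    using that by (simp add: smult_assoc1[symmetric] R.m_comm)
  interpret act: exterior_action A L ?N "\<lambda>a (b, y). (a \<otimes>\<^bsub>A\<^esub> b, a \<odot>\<^bsub>L\<^esub> y)" "\<lambda>x (b, y). (\<zero>\<^bsub>A\<^esub>, b \<odot>\<^bsub>L\<^esub> x)"
    by (intro exterior_action.intro exterior_action_axioms.intro exterior_module_axioms N.abelian_group_axioms)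
      (auto simp: prod_group_def R.l_distr R.r_distr smult_l_distr smult_r_distr smult_assoc1 R.m_assoc comm)
  have n: "(\<one>\<^bsub>A\<^esub>, \<zero>\<^bsub>L\<^esub>) \<in> carrier ?N" by (simp add: prod_group_def)
  have r: "act.rec (gn z) (\<one>\<^bsub>A\<^esub>, \<zero>\<^bsub>L\<^esub>) = (\<zero>\<^bsub>A\<^esub>, z)" if "z \<in> carrier L" for z
  proof -
    have "act.rec (wdg \<one>\<^bsub>A\<^esub> [z]) (\<one>\<^bsub>A\<^esub>, \<zero>\<^bsub>L\<^esub>) =
        (case foldr (\<lambda>x (b, y). (\<zero>\<^bsub>A\<^esub>, b \<odot>\<^bsub>L\<^esub> x)) [z] (\<one>\<^bsub>A\<^esub>, \<zero>\<^bsub>L\<^esub>) of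
          (b, y) \<Rightarrow> (\<one>\<^bsub>A\<^esub> \<otimes>\<^bsub>A\<^esub> b, \<one>\<^bsub>A\<^esub> \<odot>\<^bsub>L\<^esub> y))"
      by (rule act.rec_wdg) (use that n in simp_all)
    then show ?thesis using that by (simp add: gn_def)
  qed
  have "(\<zero>\<^bsub>A\<^esub>, x) = (\<zero>\<^bsub>A\<^esub>, y)"
    using r[OF assms(1)] r[OF assms(2)] unfolding assms(3) by (rule trans[OF sym])
  then show ?thesis by (rule Pair_inject)
qed

text \<open>The product of \<open>a\<close> with \<open>gn x\<close> is \<open>gn (a x)\<close>, and
  \<open>gn_inj\<close> returns an equation between such products to \<open>L\<close>, where
  faithfulness is given.\<close>

lemma GX_faithful:
  assumes "faithful_action A L"
  shows "faithful_action (base (fobj functor_F GX)) (space (fobj functor_F GX))"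
  unfolding faithful_action_def
proof (intro ballI impI)
  fix w w' assume w: "w \<in> carrier (base (fobj functor_F GX))" "w' \<in> carrier (base (fobj functor_F GX))"
    and eq: "\<forall>y\<in>carrier (space (fobj functor_F GX)). w \<odot>\<^bsub>space (fobj functor_F GX)\<^esub> y = w' \<odot>\<^bsub>space (fobj functor_F GX)\<^esub> y"
  obtain a a' where a: "a \<in> carrier A" "w = e (sc a)" "a' \<in> carrier A" "w' = e (sc a')"
    using w by (auto simp: GX_simps dest!: sc_in_dg_0)
  have "a \<odot>\<^bsub>L\<^esub> x = a' \<odot>\<^bsub>L\<^esub> x" if x: "x \<in> carrier L" for x
  proof -
    have "e (gn x) \<in> part GX 1" using x by (simp add: GX_simps)
    then have "w \<otimes>\<^bsub>GX\<^esub> e (gn x) = w' \<otimes>\<^bsub>GX\<^esub> e (gn x)" using eq by simp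
    then have "e (sc a \<otimes>\<^bsub>E\<^esub> gn x) = e (sc a' \<otimes>\<^bsub>E\<^esub> gn x)" using a x by (simp add: GX_ops)
    then have "sc a \<otimes>\<^bsub>E\<^esub> gn x = sc a' \<otimes>\<^bsub>E\<^esub> gn x"
      using a x by (intro inj_onD[OF e_inj]) simp_all
    then have "gn (a \<odot>\<^bsub>L\<^esub> x) = gn (a' \<odot>\<^bsub>L\<^esub> x)" using a x by (simp add: gn_smult)
    then show ?thesis using a x by (intro gn_inj) simp_all
  qed
  then have "a = a'" using assms a unfolding faithful_action_def by blast
  then show "w = w'" using a by simp
qed

end

section \<open>Functoriality and naturality\<close>

lemma fmor_G:
  assumes inf: "infinite (UNIV :: 'u set)" and X: "hom_lie_rinehart R X" and Y: "hom_lie_rinehart R Y"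
    and k: "k \<in> hom_lie_rinehart_homs R X (Y :: ('r, 'u, 'u) hom_lie_rinehart_data)"
  shows "fmor (functor_G R) X Y k \<in> hom_gerstenhaber_homs R (fobj (functor_G R) X) (fobj (functor_G R) Y)"
    and "a \<in> carrier (base X) \<Longrightarrow> fmor (functor_G R) X Y k (exterior_code X (exterior_module.sc (base X) (space X) a))
      = exterior_code Y (exterior_module.sc (base Y) (space Y) (fst k a))"
    and "x \<in> carrier (space X) \<Longrightarrow> fmor (functor_G R) X Y k (exterior_code X (exterior_module.gn (base X) (space X) x))
      = exterior_code Y (exterior_module.gn (base Y) (space Y) (snd k x))"
proof -
  interpret X: hlr_universe R X by (intro hlr_universe.intro hlr_data.intro X hlr_universe_axioms.intro inf)
  interpret Y: hlr_universe R Y by (intro hlr_universe.intro hlr_data.intro Y hlr_universe_axioms.intro inf)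
  note K = hLR_homsD[OF k] algebra_homD[OF hLR_homsD(3)[OF k]]
  interpret fc: exterior_functoriality R X.A X.L Y.A Y.L "fst k" "snd k"
    by (intro exterior_functoriality.intro X.exterior_module_axioms Y.exterior_module_axioms
        X.RA.algebra_axioms Y.RA.algebra_axioms exterior_functoriality_axioms.intro K)
  let ?h = "fmor (functor_G R) X Y k"
  have h: "?h (X.e u) = Y.e (fc.lf.lift u)" if "u \<in> carrier X.E" for u
    using that by (simp add: functor_G_def Let_def case_prod_unfold fc.exterior_map_apply)
  show 1: "?h (X.e (X.sc a)) = Y.e (Y.sc (fst k a))" if "a \<in> carrier X.A" for a
    using that by (simp add: h fc.lf.lift_sc)
  show 2: "?h (X.e (X.gn x)) = Y.e (Y.gn (snd k x))" if "x \<in> carrier X.L" for x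
    using that by (simp add: h fc.lf.lift_gn)
  txt \<open>The map agrees with the homomorphism adjunct to the composite of \<open>k\<close> with the unit at \<open>Y\<close>.\<close>
  have "adjunct Y (\<lambda>w \<in> carrier Y.GX. w) \<in> hom_lie_rinehart_homs R Y (fobj functor_F Y.GX)"
    by (intro Y.adjunct_hom Y.GX_hom_gerstenhaber hGR_homs_id)
  note hLR_homs_compose[OF X k this]
  from X.adjunct_surj[OF Y.GX_hom_gerstenhaber this]
  obtain h' where h': "h' \<in> hom_gerstenhaber_homs R X.GX Y.GX"
    and adj: "adjunct X h' = (compose (carrier X.A) (fst (adjunct Y (\<lambda>w \<in> carrier Y.GX. w))) (fst k),
      compose (carrier X.L) (snd (adjunct Y (\<lambda>w \<in> carrier Y.GX. w))) (snd k))"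
    by blast
  have sc: "h' (X.e (X.sc a)) = Y.e (Y.sc (fst k a))" if "a \<in> carrier X.A" for a
  proof -
    have "h' (X.e (X.sc a)) = fst (adjunct Y (\<lambda>w \<in> carrier Y.GX. w)) (fst k a)"
      using X.adjunct_apply(1)[OF that, of h'] adj that by (simp add: compose_eq)
    then show ?thesis using that K by (simp add: Y.adjunct_apply Y.GX_simps)
  qed
  have gn: "h' (X.e (X.gn x)) = Y.e (Y.gn (snd k x))" if "x \<in> carrier X.L" for x
  proof -
    have "h' (X.e (X.gn x)) = snd (adjunct Y (\<lambda>w \<in> carrier Y.GX. w)) (snd k x)"
      using X.adjunct_apply(2)[OF that, of h'] adj that by (simp add: compose_eq)
    then show ?thesis using that K by (simp add: Y.adjunct_apply Y.GX_simps)
  qed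
  note H' = algebra_homD[OF hom_gerstenhaber_homsD(2)[OF h'], unfolded X.GX_simps]
  have "h' (X.e u) = Y.e (fc.lf.lift u)" if "u \<in> carrier X.E" for u
    using that
  proof (induction rule: X.E_induct)
    case (sc a)
    then show ?case using \<open>\<And>a. a \<in> carrier X.A \<Longrightarrow> h' (X.e (X.sc a)) = _ a\<close> by (simp add: fc.lf.lift_sc)
  next
    case (gn x v)
    then show ?case using H'(3)[of "X.e (X.gn x)" "X.e v"]
        \<open>\<And>x. x \<in> carrier X.L \<Longrightarrow> h' (X.e (X.gn x)) = _ x\<close> K
      by (simp add: X.GX_ops Y.GX_ops fc.lf.lift_gn_mult)
  next
    case (add u v)
    then show ?case using H'(2)[of "X.e u" "X.e v"] by (simp add: X.GX_ops Y.GX_ops fc.lf.lift_add)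
  qed
  moreover have "?h \<in> extensional (X.e ` carrier X.E)"
    by (simp add: functor_G_def Let_def case_prod_unfold)
  ultimately have "?h = h'"
    using hom_gerstenhaber_homsD(1)[OF h', unfolded X.GX_simps] h
    by (intro extensionalityI[of ?h "X.e ` carrier X.E"]) auto
  then show "?h \<in> hom_gerstenhaber_homs R X.GX Y.GX" using h' by simp
qed

text \<open>By \<open>GX_hom_eqI\<close>, the identity and composition laws are compared only on the
  images of \<open>A\<close> and \<open>L\<close>, so that the maps given by
  \<open>exterior_map\<close> need not be composed on general elements.\<close>

lemma functor_G_functor:
  assumes inf: "infinite (UNIV :: 'u set)"
  shows "is_functor (hLR_all R) (hGR R)
    (functor_G R :: (('r, 'u, 'u) hom_lie_rinehart_data, ('u \<Rightarrow> 'u) \<times> ('u \<Rightarrow> 'u),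
      ('r, 'u) hom_gerstenhaber_data, 'u \<Rightarrow> 'u) functor_data)"
  unfolding is_functor_def
proof (intro conjI hGR_category hLR_all_category ballI; (simp only: hGR_simps hLR_all_simps mem_Collect_eq)?)
  note I = hlr_universe.intro hlr_data.intro hlr_universe_axioms.intro inf
  show "hom_gerstenhaber R (fobj (functor_G R) X)" if "hom_lie_rinehart R X"
    for X :: "('r, 'u, 'u) hom_lie_rinehart_data"
    by (rule hlr_universe.GX_hom_gerstenhaber) (intro I that)
  show "fmor (functor_G R) X Y k \<in> hom_gerstenhaber_homs R (fobj (functor_G R) X) (fobj (functor_G R) Y)"
    if "hom_lie_rinehart R X" "hom_lie_rinehart R Y" "k \<in> hom_lie_rinehart_homs R X Y"
    for X Y :: "('r, 'u, 'u) hom_lie_rinehart_data" and k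
    using that by (rule fmor_G(1)[OF inf])
  show "fmor (functor_G R) X X (\<lambda>a\<in>carrier (base X). a, \<lambda>x\<in>carrier (space X). x) = (\<lambda>x\<in>carrier (fobj (functor_G R) X). x)"
    if X: "hom_lie_rinehart R X" for X :: "('r, 'u, 'u) hom_lie_rinehart_data"
  proof -
    interpret X: hlr_universe R X by (intro I X)
    show ?thesis
      by (rule X.GX_hom_eqI[OF fmor_G(1)[OF inf X X hLR_homs_id[OF X]] hGR_homs_id[OF X.GX_hom_gerstenhaber]])
        (simp_all add: fmor_G[OF inf X X hLR_homs_id[OF X]] X.GX_simps)
  qed
  show "fmor (functor_G R) X Z (compose (carrier (base X)) (fst l) (fst k), compose (carrier (space X)) (snd l) (snd k)) =
      compose (carrier (fobj (functor_G R) X)) (fmor (functor_G R) Y Z l) (fmor (functor_G R) X Y k)"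
    if X: "hom_lie_rinehart R X" and Y: "hom_lie_rinehart R Y" and Z: "hom_lie_rinehart R Z"
      and k: "k \<in> hom_lie_rinehart_homs R X Y" and l: "l \<in> hom_lie_rinehart_homs R Y Z"
    for X Y Z :: "('r, 'u, 'u) hom_lie_rinehart_data" and k l
  proof -
    interpret X: hlr_universe R X by (intro I X)
    note K = hLR_homsD[OF k] algebra_homD[OF hLR_homsD(3)[OF k]]
    note kl = hLR_homs_compose[OF X k l]
    show ?thesis
    proof (rule X.GX_hom_eqI)
      show "compose (carrier X.GX) (fmor (functor_G R) Y Z l) (fmor (functor_G R) X Y k)
          \<in> hom_gerstenhaber_homs R X.GX (fobj (functor_G R) Z)"
        by (rule hGR_homs_compose[OF X.GX_hom_gerstenhaber fmor_G(1)[OF inf X Y k] fmor_G(1)[OF inf Y Z l]])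
    qed (simp_all add: fmor_G[OF inf X Z kl] fmor_G[OF inf X Y k] fmor_G[OF inf Y Z l] compose_eq X.GX_simps K)
  qed
qed

text \<open>The bijection is \<open>adjunct X\<close> for every \<open>Y\<close>. On the carriers
  naturality follows from the values of \<open>fmor\<close> on generators; off the carriers both
  sides are \<open>undefined\<close>.\<close>

lemma G_left_adjoint_F:
  assumes inf: "infinite (UNIV :: 'u set)"
  shows "left_adjoint (hLR_all R) (hGR R)
    (functor_G R :: (('r, 'u, 'u) hom_lie_rinehart_data, ('u \<Rightarrow> 'u) \<times> ('u \<Rightarrow> 'u),
      ('r, 'u) hom_gerstenhaber_data, 'u \<Rightarrow> 'u) functor_data) functor_F"
  unfolding left_adjoint_def
proof (intro conjI functor_G_functor[OF inf] functor_F_functor exI[of _ "\<lambda>X Y. adjunct X"] ballI;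
    (simp only: hGR_simps hLR_all_simps mem_Collect_eq)?)
  note I = hlr_universe.intro hlr_data.intro hlr_universe_axioms.intro inf
  show "bij_betw (adjunct X) (hom_gerstenhaber_homs R (fobj (functor_G R) X) Y)
      (hom_lie_rinehart_homs R X (fobj functor_F Y))"
    if "hom_lie_rinehart R X" "hom_gerstenhaber R Y" for X :: "('r, 'u, 'u) hom_lie_rinehart_data" and Y
    by (rule hlr_universe.adjunct_bij) (intro I that)+
  show "adjunct X' (compose (carrier (fobj (functor_G R) X')) (compose (carrier (fobj (functor_G R) X)) k h)
      (fmor (functor_G R) X' X f)) =
    (compose (carrier (base X'))
      (fst (compose (carrier (base X)) (fst (fmor functor_F Y Y' k)) (fst (adjunct X h)),
            compose (carrier (space X)) (snd (fmor functor_F Y Y' k)) (snd (adjunct X h)))) (fst f),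
     compose (carrier (space X'))
      (snd (compose (carrier (base X)) (fst (fmor functor_F Y Y' k)) (fst (adjunct X h)),
            compose (carrier (space X)) (snd (fmor functor_F Y Y' k)) (snd (adjunct X h)))) (snd f))"
    if X: "hom_lie_rinehart R X" and X': "hom_lie_rinehart R X'" and Y: "hom_gerstenhaber R Y"
      and f: "f \<in> hom_lie_rinehart_homs R X' X" and h: "h \<in> hom_gerstenhaber_homs R (fobj (functor_G R) X) Y"
    for X X' :: "('r, 'u, 'u) hom_lie_rinehart_data" and Y Y' f k h
  proof -
    interpret X: hlr_universe R X by (intro I X)
    interpret X': hlr_universe R X' by (intro I X')
    note F = hLR_homsD[OF f] algebra_homD[OF hLR_homsD(3)[OF f]]
    have adj: "fst (adjunct X h) a \<in> part Y 0" "snd (adjunct X h) x \<in> part Y 1"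
      if "a \<in> carrier X.A" "x \<in> carrier X.L" for a x
      using hLR_homsD(4)[OF X.adjunct_hom[OF Y h]] algebra_homD(1)[OF hLR_homsD(3)[OF X.adjunct_hom[OF Y h]]] that
      by simp_all
    have 1: "fst (fmor functor_F Y Y' k) y = k y" if "y \<in> part Y 0" for y
      using that by (simp add: functor_F_def)
    have 2: "snd (fmor functor_F Y Y' k) y = k y" if "y \<in> part Y 1" for y
      using that by (simp add: functor_F_def)
    have c: "fmor (functor_G R) X' X f w \<in> carrier X.GX" if "w \<in> carrier X'.GX" for w
      using algebra_homD(1)[OF hom_gerstenhaber_homsD(2)[OF fmor_G(1)[OF inf X' X f]]] that .
    show ?thesis
    proof (rule prod_eqI; rule ext; simp only: fst_conv snd_conv)
      fix a
      show "fst (adjunct X' (compose (carrier X'.GX) (compose (carrier X.GX) k h) (fmor (functor_G R) X' X f))) a =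
        compose (carrier X'.A) (compose (carrier X.A) (fst (fmor functor_F Y Y' k)) (fst (adjunct X h))) (fst f) a"
      proof (cases "a \<in> carrier X'.A")
        case True
        then have fa: "fst f a \<in> carrier X.A" using F by simp
        have "h (X.e (X.sc (fst f a))) \<in> part Y 0"
          using adj(1)[OF fa X.M.zero_closed] X.adjunct_apply(1)[OF fa, of h] by simp
        then show ?thesis using True fa
          by (simp add: X'.adjunct_apply X.adjunct_apply compose_eq X'.GX_simps X.GX_simps fmor_G[OF inf X' X f] 1)
      qed (simp add: adjunct_def compose_def)
    next
      fix x
      show "snd (adjunct X' (compose (carrier X'.GX) (compose (carrier X.GX) k h) (fmor (functor_G R) X' X f))) x =
        compose (carrier X'.L) (compose (carrier X.L) (snd (fmor functor_F Y Y' k)) (snd (adjunct X h))) (snd f) x"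
      proof (cases "x \<in> carrier X'.L")
        case True
        then have fx: "snd f x \<in> carrier X.L" using F by simp
        have "h (X.e (X.gn (snd f x))) \<in> part Y 1"
          using adj(2)[OF X.R.zero_closed fx] X.adjunct_apply(2)[OF fx, of h] by simp
        then show ?thesis using True fx
          by (simp add: X'.adjunct_apply X.adjunct_apply compose_eq X'.GX_simps X.GX_simps fmor_G[OF inf X' X f] 2)
      qed (simp add: adjunct_def compose_def)
    qed
  qed
qed

section \<open>Restriction to full subcategories\<close>

lemma full_subcategory_simps [simp]:
  "Obj (full_subcategory C S) = Obj C \<inter> S" "Hom (full_subcategory C S) = Hom C"
  "idt (full_subcategory C S) = idt C" "cmp (full_subcategory C S) = cmp C"
  by (simp_all add: full_subcategory_def)

lemma full_subcategory_category:
  assumes "is_category C"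
  shows "is_category (full_subcategory C S)"
  using assms unfolding is_category_def full_subcategory_simps by (elim conjE) (intro conjI; blast)

lemma functor_restrict:
  assumes F: "is_functor C D F" and S: "\<And>X. X \<in> Obj C \<Longrightarrow> X \<in> S \<Longrightarrow> fobj F X \<in> T"
  shows "is_functor (full_subcategory C S) (full_subcategory D T) F"
  using F S full_subcategory_category[of C S] full_subcategory_category[of D T]
  unfolding is_functor_def full_subcategory_simps by (elim conjE) (intro conjI; blast)

text \<open>Hom-sets and composition are unchanged in a full subcategory, so the same bijections
  serve; only the objects have to be looked after.\<close>

lemma left_adjoint_restrict:
  assumes adj: "left_adjoint C D G F"
    and S: "\<And>X. X \<in> Obj C \<Longrightarrow> X \<in> S \<Longrightarrow> fobj G X \<in> T"
    and T: "\<And>Y. Y \<in> Obj D \<Longrightarrow> Y \<in> T \<Longrightarrow> fobj F Y \<in> S"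
  shows "left_adjoint (full_subcategory C S) (full_subcategory D T) G F"
proof -
  have "is_functor (full_subcategory C S) (full_subcategory D T) G"
    "is_functor (full_subcategory D T) (full_subcategory C S) F"
    using adj S T unfolding left_adjoint_def by (blast intro: functor_restrict)+
  moreover obtain \<Phi> where
    "\<forall>X \<in> Obj C. \<forall>Y \<in> Obj D. bij_betw (\<Phi> X Y) (Hom D (fobj G X) Y) (Hom C X (fobj F Y))"
    "\<forall>X \<in> Obj C. \<forall>X' \<in> Obj C. \<forall>Y \<in> Obj D. \<forall>Y' \<in> Obj D.
       \<forall>f \<in> Hom C X' X. \<forall>k \<in> Hom D Y Y'. \<forall>h \<in> Hom D (fobj G X) Y.
       \<Phi> X' Y' (cmp D (fobj G X') (fobj G X) Y' (cmp D (fobj G X) Y Y' k h) (fmor G X' X f)) =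
       cmp C X' X (fobj F Y') (cmp C X (fobj F Y) (fobj F Y') (fmor F Y Y' k) (\<Phi> X Y h)) f"
    using adj unfolding left_adjoint_def by (elim conjE exE)
  ultimately show ?thesis
    unfolding left_adjoint_def full_subcategory_simps
    by (intro conjI exI[of _ \<Phi>]) blast+
qed

theorem theorem3p12:
  fixes R :: "'r ring"
    and G :: "(('r, 'u, 'u) hom_lie_rinehart_data, ('u \<Rightarrow> 'u) \<times> ('u \<Rightarrow> 'u),
               ('r, 'u) hom_gerstenhaber_data, 'u \<Rightarrow> 'u) functor_data"
  assumes "cring R" and "infinite (UNIV :: 'u set)"
    and "G = functor_G R"
  shows "is_functor (hLR R) (hGR R) G \<and>
         left_adjoint (hLR R) (hGR_faithful R) G functor_F \<and>
         left_adjoint (hLR_all R) (hGR R) G functor_F"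
proof (intro conjI)
  show adj: "left_adjoint (hLR_all R) (hGR R) G functor_F"
    unfolding assms(3) by (rule G_left_adjoint_F[OF assms(2)])
  show "left_adjoint (hLR R) (hGR_faithful R) G functor_F"
    unfolding hLR_def hGR_faithful_def
  \<comment> \<open>For \<open>functor_F\<close> the condition on objects is the definition of
    \<open>hGR_faithful\<close>; what remains is the faithfulness of the exterior algebra.\<close>
  proof (rule left_adjoint_restrict[OF adj]; simp only: mem_Collect_eq hLR_all_simps)
    fix X :: "('r, 'u, 'u) hom_lie_rinehart_data"
    assume X: "hom_lie_rinehart R X" and f: "faithful_action (base X) (space X)"
    interpret hlr_universe R X
      by (intro hlr_universe.intro hlr_data.intro X hlr_universe_axioms.intro assms)
    show "faithful_action (base (fobj functor_F (fobj G X))) (space (fobj functor_F (fobj G X)))"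
      unfolding assms(3) by (rule GX_faithful[OF f])
  qed
  \<comment> \<open>Presenting \<open>hGR R\<close> as its own full subcategory on
    \<open>UNIV\<close> makes restriction of the source alone an instance of
    \<open>functor_restrict\<close>.\<close>
  have "is_functor (hLR R) (full_subcategory (hGR R) UNIV) G"
    unfolding hLR_def assms(3)
    by (rule functor_restrict[OF functor_G_functor[OF assms(2)]]) simp
  then show "is_functor (hLR R) (hGR R) G" by (simp add: full_subcategory_def)
qed

end
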